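(* Let $n\ge 1$, let $\lambda$ be a partition of $n$ and $\mu$ a partition of $n-1$ with $\mu\nearrow\lambda$. Let $1\le j\le n$ and let $\rho$ be a partition of $n-j$. Then the value $\Gamma^{\lambda,\mu\nearrow\lambda}_{(j,\rho)}$ of the generalized character $\Gamma^{\lambda,\mu\nearrow\lambda}$ on permutations of class $(j,\rho)$ is $$\Gamma^{\lambda,\mu\nearrow\lambda}_{(j,\rho)}=\sum_{\nu\vdash n-j,\ \nu\subseteq\mu}\varphi_{\mu/\nu,\lambda/\nu}\,\chi^{\nu}_{\rho},$$ where $\chi^\nu_\rho$ is the value of the irreducible character $\chi^\nu$ of $S(n-j)$ on permutations of cycle type $\rho$, and $$\varphi_{\mu/\nu,\lambda/\nu}=\begin{cases}(-1)^{\langle\lambda/\nu\rangle}\prod_{s\in SC}[c(\lambda/\mu)-c(s)]\prod_{d\in DB,\ d\neq\lambda/\mu}[c(\lambda/\mu)-c(d)]^{-1}, & \text{if } \lambda/\nu \text{ is a broken border strip},\\ 0,&\text{otherwise},\end{cases}$$ with $SC$ and $DB$ the sets of sharp corners and dull boxes of $\lambda/\nu$, $c(\lambda/\mu)$ the content of the single box of $\lambda/\mu$, and $\langle\lambda/\nu\rangle$ the height of $\lambda/\nu$.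
   Context: $S(n)$ is the symmetric group on $\{1,\dots,n\}$ and $S(n-1)\subset S(n)$ is the subgroup of permutations fixing $n$ ($S(0)=\{e\}$). For a partition $\lambda$, $\chi^\lambda$ is the irreducible character of the corresponding symmetric group indexed by $\lambda$ ($\chi^\emptyset$ is the trivial character of $S(0)$, value $1$). Partitions are identified with Young diagrams; $\mu\nearrow\lambda$ means $\lambda$ is obtained from $\mu$ by adding one box. For $\lambda\vdash n$, $\mu\vdash n-1$, $\mu\nearrow\lambda$, the generalized character is the function on $S(n)$ given by $\Gamma^{\lambda,\mu\nearrow\lambda}(x)=\frac{\chi^\mu(e)}{(n-1)!}\sum_{y\in S(n-1)}\chi^\lambda(xy^{-1})\chi^\mu(y)$. For $1\le j\le n$ and $\rho\vdash n-j$, the class $(j,\rho)$ is the set of permutations in $S(n)$ whose cycle containing $n$ has length $j$ and whose remaining cycles have lengths given by the parts of $\rho$; $\Gamma^{\lambda,\mu\nearrow\lambda}$ is constant on each such class and $\Gamma^{\lambda,\mu\nearrow\lambda}_{(j,\rho)}$ denotes that constant. The content of a box in row $i$ and column $j$ is $c=j-i$. A skew diagram is a broken border strip if it contains no $2\times2$ block of boxes; a (connected) border strip is a connected broken border strip (boxes connected via shared edges). A sharp corner of a broken border strip is a box of it having a box of it directly below and a box of it directly to its right; a dull box is a box of it with no box of it directly to its right and none directly below. The height of a border strip is one less than the number of rows it occupies; the height $\langle\lambda/\nu\rangle$ of a broken border strip is the sum of the heights of its connected components. *)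

theory Defs
  imports Complex_Main "HOL-Library.Multiset" "HOL-Library.Function_Algebras"
    "HOL-Combinatorics.Permutations" "HOL-Combinatorics.Orbits"
begin

section \<open>Partitions and Young diagrams\<close>

definition partition_of :: "nat \<Rightarrow> nat list \<Rightarrow> bool" where
  "partition_of n p \<longleftrightarrow> sorted_wrt (\<ge>) p \<and> 0 \<notin> set p \<and> sum_list p = n"

type_synonym box = "nat \<times> nat"

text \<open>Boxes are pairs (row, column); rows are counted from 1 downwards and columns from 1 to the
  right.\<close>

definition diagram :: "nat list \<Rightarrow> box set" where
  "diagram p = {(i, j). 1 \<le> i \<and> i \<le> length p \<and> 1 \<le> j \<and> j \<le> p ! (i - 1)}"

definition adds_box :: "nat list \<Rightarrow> nat list \<Rightarrow> bool" (infix "\<nearrow>" 50) where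
  "mu \<nearrow> lam \<longleftrightarrow> (\<exists>b. b \<notin> diagram mu \<and> diagram lam = insert b (diagram mu))"

definition content :: "box \<Rightarrow> int" where
  "content b = int (snd b) - int (fst b)"


section \<open>Irreducible characters of the symmetric groups\<close>

text \<open>
  The irreducible representation of \<open>S(n)\<close> indexed by a partition \<open>lam\<close> of \<open>n\<close> is the complex Specht
  module of \<open>lam\<close>, so that a one-row partition gives the trivial representation and a one-column
  partition gives the sign representation.  It lives in the space of complex functions on tabloids.
\<close>

definition fun_scale :: "complex \<Rightarrow> ('a \<Rightarrow> complex) \<Rightarrow> 'a \<Rightarrow> complex" where
  "fun_scale c f = (\<lambda>x. c * f x)"

global_interpretation cfun: vector_space fun_scale
  by unfold_locales (auto simp: fun_scale_def fun_eq_iff algebra_simps)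

text \<open>Trace of an operator \<open>f\<close> on a finite-dimensional \<open>f\<close>-invariant subspace \<open>V\<close>, computed in some
  basis of \<open>V\<close>.\<close>

definition trace_on ::
  "('a \<Rightarrow> complex) set \<Rightarrow> (('a \<Rightarrow> complex) \<Rightarrow> ('a \<Rightarrow> complex)) \<Rightarrow> complex" where
  "trace_on V f =
     (let B = (SOME B. cfun.independent B \<and> cfun.span B = V)
      in \<Sum>b\<in>B. cfun.representation B (f b) b)"

definition Sym :: "nat \<Rightarrow> (nat \<Rightarrow> nat) set" where
  "Sym n = {s. s permutes {1..n}}"

definition tableau :: "nat list \<Rightarrow> (box \<Rightarrow> nat) \<Rightarrow> bool" where
  "tableau lam T \<longleftrightarrow> bij_betw T (diagram lam) {1..sum_list lam}"

text \<open>A tabloid is encoded as the function sending every entry \<open>1, \<dots>, n\<close> to the row containing it,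
  and all other numbers to 0.\<close>

type_synonym tabloid = "nat \<Rightarrow> nat"

definition tabloid_of :: "nat list \<Rightarrow> (box \<Rightarrow> nat) \<Rightarrow> tabloid" where
  "tabloid_of lam T =
     (\<lambda>m. if m \<in> T ` diagram lam then fst (the_inv_into (diagram lam) T m) else 0)"

definition column_stabilizer :: "nat list \<Rightarrow> (box \<Rightarrow> nat) \<Rightarrow> (nat \<Rightarrow> nat) set" where
  "column_stabilizer lam T =
     {s \<in> Sym (sum_list lam).
        \<forall>b\<in>diagram lam. \<exists>b'\<in>diagram lam. snd b' = snd b \<and> s (T b) = T b'}"

definition basis_vector :: "'a \<Rightarrow> 'a \<Rightarrow> complex" where
  "basis_vector a = (\<lambda>x. if x = a then 1 else 0)"

definition polytabloid :: "nat list \<Rightarrow> (box \<Rightarrow> nat) \<Rightarrow> tabloid \<Rightarrow> complex" where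
  "polytabloid lam T =
     (\<Sum>s\<in>column_stabilizer lam T.
        fun_scale (of_int (sign s)) (basis_vector (tabloid_of lam (s \<circ> T))))"

definition specht_module :: "nat list \<Rightarrow> (tabloid \<Rightarrow> complex) set" where
  "specht_module lam = cfun.span (polytabloid lam ` {T. tableau lam T})"

text \<open>The permutation \<open>s\<close> replaces every entry \<open>m\<close> by \<open>s m\<close>, so it sends the tabloid \<open>t\<close> to
  \<open>t \<circ> inv s\<close>; extended linearly to functions on tabloids this is the following operator.\<close>

definition perm_act :: "(nat \<Rightarrow> nat) \<Rightarrow> (tabloid \<Rightarrow> complex) \<Rightarrow> tabloid \<Rightarrow> complex" where
  "perm_act s f = (\<lambda>t. f (t \<circ> s))"

definition irr_char :: "nat list \<Rightarrow> (nat \<Rightarrow> nat) \<Rightarrow> complex" where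
  "irr_char lam s = trace_on (specht_module lam) (perm_act s)"

text \<open>Fixed points count as cycles of length 1.\<close>

definition cycle_class :: "nat \<Rightarrow> nat list \<Rightarrow> (nat \<Rightarrow> nat) set" where
  "cycle_class n rho =
     {s \<in> Sym n. image_mset card (mset_set (orbit s ` {1..n})) = mset rho}"

text \<open>\<open>the_elem\<close> yields the only value that the character takes on the class.\<close>

definition irr_char_at :: "nat list \<Rightarrow> nat list \<Rightarrow> complex" where
  "irr_char_at nu rho = the_elem (irr_char nu ` cycle_class (sum_list nu) rho)"


section \<open>Generalized characters\<close>

definition gen_char :: "nat list \<Rightarrow> nat list \<Rightarrow> (nat \<Rightarrow> nat) \<Rightarrow> complex" where
  "gen_char lam mu x =
     (let n = sum_list lam
      in irr_char mu id / fact (n - 1) *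
         (\<Sum>y\<in>Sym (n - 1). irr_char lam (x \<circ> inv y) * irr_char mu y))"

definition gen_class :: "nat \<Rightarrow> nat \<Rightarrow> nat list \<Rightarrow> (nat \<Rightarrow> nat) set" where
  "gen_class n j rho =
     {s \<in> Sym n. card (orbit s n) = j \<and>
        image_mset card (mset_set (orbit s ` {1..n} - {orbit s n})) = mset rho}"


section \<open>Broken border strips\<close>

definition broken_border_strip :: "box set \<Rightarrow> bool" where
  "broken_border_strip S \<longleftrightarrow>
     \<not> (\<exists>i j. {(i, j), (i + 1, j), (i, j + 1), (i + 1, j + 1)} \<subseteq> S)"

definition sharp_corners :: "box set \<Rightarrow> box set" where
  "sharp_corners S = {(i, j) \<in> S. (i + 1, j) \<in> S \<and> (i, j + 1) \<in> S}"

definition dull_boxes :: "box set \<Rightarrow> box set" where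
  "dull_boxes S = {(i, j) \<in> S. (i + 1, j) \<notin> S \<and> (i, j + 1) \<notin> S}"

definition shares_edge :: "box \<Rightarrow> box \<Rightarrow> bool" where
  "shares_edge a b \<longleftrightarrow>
     fst a = fst b \<and> (snd b = snd a + 1 \<or> snd a = snd b + 1) \<or>
     snd a = snd b \<and> (fst b = fst a + 1 \<or> fst a = fst b + 1)"

definition box_components :: "box set \<Rightarrow> box set set" where
  "box_components S = (\<lambda>a. {(a, b). a \<in> S \<and> b \<in> S \<and> shares_edge a b}\<^sup>* `` {a}) ` S"

definition strip_height :: "box set \<Rightarrow> nat" where
  "strip_height S = (\<Sum>C\<in>box_components S. card (fst ` C) - 1)"

text \<open>The coefficient of \<open>nu\<close>, for partitions with \<open>nu \<subseteq> mu \<nearrow> lam\<close>.\<close>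

definition phi :: "nat list \<Rightarrow> nat list \<Rightarrow> nat list \<Rightarrow> complex" where
  "phi mu lam nu =
     (let S = diagram lam - diagram nu; e = the_elem (diagram lam - diagram mu)
      in if broken_border_strip S then
           (-1) ^ strip_height S *
           (\<Prod>s\<in>sharp_corners S. of_int (content e - content s)) *
           (\<Prod>d\<in>dull_boxes S - {e}. inverse (of_int (content e - content d)))
         else 0)"

end

theory Submission
  imports Defs
begin

text \<open>Let \<open>P\<^sub>\<mu>\<close> be the projection of the Specht module \<open>V\<^sup>\<lambda>\<close> onto its \<open>\<mu>\<close>-isotypic part over \<open>S(n-1)\<close>.
  By the orthogonality of characters, the generalized character at \<open>x\<close> is the trace of \<open>x P\<^sub>\<mu>\<close> on \<open>V\<^sup>\<lambda>\<close>.
  For the transposition \<open>s = (n-1 n)\<close> the Jucys-Murphy elements satisfy \<open>s X\<^sub>n\<^sub>-\<^sub>1 = X\<^sub>n s - 1\<close> and act by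
  contents, so \<open>P s P = P / (c(\<lambda>/\<mu>) - c(\<mu>/\<kappa>))\<close> for \<open>P = P\<^sub>\<mu> P\<^sub>\<kappa>\<close>.  Hence for \<open>y \<in> S(n-1)\<close> the value of the
  generalized character of \<open>\<mu> \<nearrow> \<lambda>\<close> at \<open>y s\<close> is the sum over \<open>\<kappa> \<nearrow> \<mu>\<close> of the values of that of
  \<open>\<kappa> \<nearrow> \<mu>\<close> at \<open>y\<close>, divided by \<open>c(\<lambda>/\<mu>) - c(\<mu>/\<kappa>)\<close>.  Every permutation that moves \<open>n\<close> is conjugate under
  \<open>S(n-1)\<close> to such a product \<open>y s\<close>, and passing to \<open>y\<close> shortens the cycle of the largest point by one.
  The coefficients \<open>\<phi>\<close> obey the same recursion: it is the partial fraction decomposition, evaluated at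
  \<open>x = c(\<lambda>/\<mu>)\<close>, of \<open>\<Prod>(x - c(s)) / \<Prod>(x - c(d))\<close> over the sharp corners \<open>s\<close> and dull boxes \<open>d\<close> of \<open>\<mu>/\<nu>\<close>.

  The branching rule does not need the standard basis of a Specht module: deleting the entry \<open>n\<close>
  shows that the dimension of \<open>V\<^sup>\<lambda>\<close> is at least the sum of the dimensions of the \<open>V\<^sup>\<mu>\<close>, and equality is
  forced by the bound \<open>n!\<close> for the sum of the squares of the dimensions together with the relation
  \<open>DU - UD = 1\<close> in Young's lattice.\<close>

text \<open>The value of an irreducible character on a class is read off with
  \<open>the_elem\<close>, so the formula also needs that the character depends only on the cycle
  type. This is not derived from the conjugacy of permutations of equal cycle type: the formula for
  n boxes needs it only for fewer boxes, and summed over \<mu> it yields it for n boxes. Complete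
  reducibility is never invoked. It suffices that endomorphisms of Specht modules are scalars and
  that distinct shapes admit no homomorphism in at least one direction; the symmetry of the
  character pairing makes up for the other. The contents enter through the sum of all
  transpositions, which is central and hence a scalar on every Specht module. Dividing by
  c(\<lambda>/\<mu>) - c(\<mu>/\<kappa>) is possible because an addable and a removable box of \<mu>
  never lie on one diagonal. In the recursion for the coefficients, the sharp corners must be fewer
  than the dull boxes, or the partial fractions would acquire a polynomial part. If the box of
  \<lambda>/\<mu> completes a 2 x 2 block, the first box of the block is a sharp corner of equal
  content, so the coefficient vanishes by itself.\<close>

section \<open>Linear algebra of function spaces\<close>

text \<open>As simp rules these replace \<open>f + g\<close> by \<open>\<lambda>x. f x + g x\<close> even below other operators.\<close>

declare plus_fun_apply [simp del] zero_fun_apply [simp del]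

global_interpretation cpair: vector_space_pair fun_scale fun_scale ..

abbreviation lin :: "(('a \<Rightarrow> complex) \<Rightarrow> ('b \<Rightarrow> complex)) \<Rightarrow> bool" where
  "lin \<equiv> Vector_Spaces.linear fun_scale fun_scale"

lemma linI:
  "(\<And>x y. A (x + y) = A x + A y) \<Longrightarrow> (\<And>c x. A (fun_scale c x) = fun_scale c (A x)) \<Longrightarrow> lin A"
  by (simp add: Vector_Spaces.linear_iff cfun.vector_space_axioms)

lemma lin_simps:
  assumes "lin A"
  shows "A (x + y) = A x + A y" "A (fun_scale c x) = fun_scale c (A x)"
    "A (x - y) = A x - A y" "A 0 = 0" "A (\<Sum>i\<in>I. g i) = (\<Sum>i\<in>I. A (g i))"
  using assms
  by (auto simp: cpair.linear_add cpair.linear_scale cpair.linear_diff cpair.linear_0 cpair.linear_sum)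

lemma lin_id: "lin (\<lambda>x. x)"
  by (rule linI) auto

lemma lin_compose: "lin A \<Longrightarrow> lin B \<Longrightarrow> lin (\<lambda>x. A (B x))"
  by (rule linI) (simp_all add: lin_simps[of A] lin_simps[of B])

lemma lin_sum_scale: "(\<And>i. i \<in> I \<Longrightarrow> lin (A i)) \<Longrightarrow> lin (\<lambda>x. \<Sum>i\<in>I. fun_scale (c i) (A i x))"
  by (rule linI) (simp_all add: lin_simps(1,2)[of "A _"] sum.distrib cfun.scale_right_distrib
    cfun.scale_sum_right mult.commute cong: sum.cong)

lemma lin_span_eq:
  assumes "lin A" "lin B" "x \<in> cfun.span S" "\<And>b. b \<in> S \<Longrightarrow> A b = B b"
  shows "A x = B x"
  using cpair.linear_eq_on[OF assms] .

lemma lin_span_in: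
  assumes "lin A" "cfun.subspace W" "\<And>b. b \<in> S \<Longrightarrow> A b \<in> W" "x \<in> cfun.span S"
  shows "A x \<in> W"
  using assms(4)
proof (induction rule: cfun.span_induct_alt)
  case base then show ?case using lin_simps(4)[OF assms(1)] cfun.subspace_0[OF assms(2)] by metis
next
  case (step c x y)
  then show ?case using assms
    by (simp add: lin_simps(1,2)[OF assms(1)] cfun.subspace_add cfun.subspace_scale)
qed

lemma sum_fun_apply: "(\<Sum>i\<in>I. f i) x = (\<Sum>i\<in>I. f i x)"
  by (induction I rule: infinite_finite_induct) (auto simp: plus_fun_apply zero_fun_apply)

lemma fun_scale_apply: "fun_scale c f x = c * f x"
  by (simp add: fun_scale_def)

text \<open>The space of all functions on tabloids is infinite-dimensional, so dimension arguments
  carry an explicit finiteness condition.\<close>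

definition fin_dim :: "('a \<Rightarrow> complex) set \<Rightarrow> bool" where
  "fin_dim V \<longleftrightarrow> cfun.subspace V \<and> (\<exists>F. finite F \<and> V \<subseteq> cfun.span F)"

lemma fin_dim_subspace: "fin_dim V \<Longrightarrow> cfun.subspace V"
  by (simp add: fin_dim_def)

lemma fin_dim_subset: "fin_dim V \<Longrightarrow> cfun.subspace U \<Longrightarrow> U \<subseteq> V \<Longrightarrow> fin_dim U"
  unfolding fin_dim_def by blast

lemma fin_dim_independent:
  assumes "fin_dim V" "cfun.independent B" "B \<subseteq> V"
  shows "finite B" "card B \<le> cfun.dim V"
proof -
  obtain F where F: "finite F" "V \<subseteq> cfun.span F" using assms by (auto simp: fin_dim_def)
  show fB: "finite B" using cfun.independent_span_bound[OF F(1) assms(2)] F assms(3) by blast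
  obtain C where C: "C \<subseteq> V" "cfun.independent C" "V \<subseteq> cfun.span C" "card C = cfun.dim V"
    by (rule cfun.basis_exists)
  have "finite C" using cfun.independent_span_bound[OF F(1) C(2)] F C(1) by blast
  then show "card B \<le> cfun.dim V"
    using cfun.independent_span_bound[OF _ assms(2)] C assms(3) by (metis subset_trans)
qed

lemma fin_dim_basis:
  assumes "fin_dim V"
  obtains B where "finite B" "cfun.independent B" "cfun.span B = V" "card B = cfun.dim V"
proof -
  obtain B where B: "B \<subseteq> V" "cfun.independent B" "V \<subseteq> cfun.span B" "card B = cfun.dim V"
    by (rule cfun.basis_exists)
  moreover have "cfun.span B = V"
    using B assms by (metis fin_dim_subspace cfun.span_minimal subset_antisym)
  ultimately show ?thesis using that fin_dim_independent[OF assms] by blast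
qed

lemma fin_dim_dim_eq:
  assumes "fin_dim V" "cfun.subspace U" "U \<subseteq> V" "cfun.dim U = cfun.dim V"
  shows "U = V"
proof (rule ccontr)
  assume "U \<noteq> V"
  then obtain x where x: "x \<in> V" "x \<notin> U" using assms by auto
  obtain B where B: "finite B" "cfun.independent B" "cfun.span B = U" "card B = cfun.dim U"
    using fin_dim_basis fin_dim_subset assms by metis
  have "cfun.independent (insert x B)" using B x by (simp add: cfun.independent_insert)
  moreover have "insert x B \<subseteq> V" using x B assms cfun.span_superset by blast
  ultimately have "card (insert x B) \<le> cfun.dim V" using fin_dim_independent[OF assms(1)] by blast
  moreover have "x \<notin> B" using x B cfun.span_base by blast
  ultimately show False using B assms by simp
qed

lemma fin_dim_dim_mono: "fin_dim V \<Longrightarrow> cfun.subspace U \<Longrightarrow> U \<subseteq> V \<Longrightarrow> cfun.dim U \<le> cfun.dim V"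
  by (metis fin_dim_basis fin_dim_subset fin_dim_independent(2) cfun.span_superset subset_trans)

lemma fin_dim_dim_0:
  assumes "fin_dim V" "cfun.dim V = 0" "v \<in> V" shows "v = 0"
proof -
  obtain B where "finite B" "cfun.independent B" "cfun.span B = V" "card B = cfun.dim V"
    by (rule fin_dim_basis[OF assms(1)])
  then show ?thesis using assms by auto
qed

lemma lin_image_subspace: "lin A \<Longrightarrow> cfun.subspace V \<Longrightarrow> cfun.subspace (A ` V)"
  using cpair.linear_subspace_image by blast

lemma fin_dim_image:
  assumes "lin A" "fin_dim V" shows "fin_dim (A ` V)"
proof -
  obtain F where F: "finite F" "V \<subseteq> cfun.span F" using assms by (auto simp: fin_dim_def)
  have "A ` V \<subseteq> cfun.span (A ` F)"
    using F(2) lin_span_in[OF assms(1) cfun.subspace_span[of "A ` F"], of F]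
    by (auto intro: cfun.span_base)
  then show ?thesis
    using F(1) lin_image_subspace[OF assms(1) fin_dim_subspace[OF assms(2)]] by (auto simp: fin_dim_def)
qed

section \<open>Coordinates with respect to a finite basis, and traces\<close>

abbreviation coord :: "('a \<Rightarrow> complex) set \<Rightarrow> ('a \<Rightarrow> complex) \<Rightarrow> ('a \<Rightarrow> complex) \<Rightarrow> complex" where
  "coord B \<equiv> cfun.representation B"

lemma coord_expand:
  "finite B \<Longrightarrow> cfun.independent B \<Longrightarrow> v \<in> cfun.span B \<Longrightarrow> (\<Sum>b\<in>B. fun_scale (coord B v b) b) = v"
  by (rule cfun.sum_representation_eq) auto

lemma coord_sum_scale:
  "cfun.independent B \<Longrightarrow> (\<And>i. i \<in> I \<Longrightarrow> v i \<in> cfun.span B) \<Longrightarrow>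
    coord B (\<Sum>i\<in>I. fun_scale (c i) (v i)) b = (\<Sum>i\<in>I. c i * coord B (v i) b)"
  by (simp add: cfun.representation_sum cfun.span_scale cfun.representation_scale)

lemma coord_lin:
  assumes "finite B" "cfun.independent B" "cfun.independent C" "lin A"
    "A ` cfun.span B \<subseteq> cfun.span C" "v \<in> cfun.span B"
  shows "coord C (A v) c = (\<Sum>b\<in>B. coord B v b * coord C (A b) c)"
proof -
  have "A v = (\<Sum>b\<in>B. fun_scale (coord B v b) (A b))"
    by (subst coord_expand[OF assms(1,2,6), symmetric]) (simp add: lin_simps[OF assms(4)])
  then show ?thesis
    using assms(3,5) by (subst coord_sum_scale[symmetric]) (auto intro: cfun.span_base)
qed

text \<open>Both sides expand to the same double sum of products of matrix entries. Since the two
  spaces and their bases may differ, this one identity gives the independence of the trace from the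
  basis (with the identity as \<open>A'\<close>) as well as its cyclicity.\<close>

lemma basis_trace_comm:
  fixes A :: "('a \<Rightarrow> complex) \<Rightarrow> ('b \<Rightarrow> complex)"
  assumes "finite B" "cfun.independent B" "finite C" "cfun.independent C" "lin A" "lin A'"
    "A ` cfun.span B \<subseteq> cfun.span C" "A' ` cfun.span C \<subseteq> cfun.span B"
  shows "(\<Sum>b\<in>B. coord B (A' (A b)) b) = (\<Sum>c\<in>C. coord C (A (A' c)) c)"
proof -
  have "(\<Sum>b\<in>B. coord B (A' (A b)) b) = (\<Sum>b\<in>B. \<Sum>c\<in>C. coord C (A b) c * coord B (A' c) b)"
    using assms by (intro sum.cong refl coord_lin) (auto intro: cfun.span_base)
  also have "\<dots> = (\<Sum>c\<in>C. \<Sum>b\<in>B. coord B (A' c) b * coord C (A b) c)"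
    by (subst sum.swap) (simp add: mult.commute)
  also have "\<dots> = (\<Sum>c\<in>C. coord C (A (A' c)) c)"
    using assms by (intro sum.cong refl coord_lin[symmetric]) (auto 4 4 intro: cfun.span_base)
  finally show ?thesis .
qed

lemma trace_on_chosen_basis:
  assumes "fin_dim V"
  obtains B where "finite B" "cfun.independent B" "cfun.span B = V" 
    "trace_on V = (\<lambda>f. \<Sum>b\<in>B. coord B (f b) b)"
proof -
  define B where "B = (SOME B. cfun.independent B \<and> cfun.span B = V)"
  have "\<exists>B. cfun.independent B \<and> cfun.span B = V" by (rule fin_dim_basis[OF assms]) blast
  then have "cfun.independent B \<and> cfun.span B = V" unfolding B_def by (rule someI_ex)
  moreover from this have "finite B" using fin_dim_independent[OF assms] cfun.span_superset by metis
  ultimately show ?thesis using that by (simp add: trace_on_def[abs_def] B_def Let_def)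
qed

lemma trace_basis:
  assumes "fin_dim V" "cfun.independent B" "cfun.span B = V" "lin A" "A ` V \<subseteq> V"
  shows "trace_on V A = (\<Sum>b\<in>B. coord B (A b) b)"
proof -
  obtain C where C: "finite C" "cfun.independent C" "cfun.span C = V" 
    "trace_on V = (\<lambda>f. \<Sum>b\<in>C. coord C (f b) b)" by (rule trace_on_chosen_basis[OF assms(1)])
  have "finite B" using fin_dim_independent[OF assms(1,2)] assms(3) cfun.span_superset by metis
  from basis_trace_comm[OF this assms(2) C(1,2) assms(4) lin_id] show ?thesis
    using C assms by simp
qed

lemma trace_comm:
  assumes "fin_dim V" "fin_dim W" "lin A" "lin A'" "A ` V \<subseteq> W" "A' ` W \<subseteq> V"
  shows "trace_on V (\<lambda>v. A' (A v)) = trace_on W (\<lambda>w. A (A' w))"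
proof -
  obtain B where B: "finite B" "cfun.independent B" "cfun.span B = V" 
    "trace_on V = (\<lambda>f. \<Sum>b\<in>B. coord B (f b) b)" by (rule trace_on_chosen_basis[OF assms(1)])
  obtain C where C: "finite C" "cfun.independent C" "cfun.span C = W" 
    "trace_on W = (\<lambda>f. \<Sum>b\<in>C. coord C (f b) b)" by (rule trace_on_chosen_basis[OF assms(2)])
  show ?thesis using basis_trace_comm[OF B(1,2) C(1,2) assms(3,4)] B C assms by simp
qed

lemma trace_cong:
  assumes "fin_dim V" "\<And>v. v \<in> V \<Longrightarrow> f v = g v"
  shows "trace_on V f = trace_on V g"
proof -
  obtain B where "finite B" "cfun.independent B" "cfun.span B = V" 
    "trace_on V = (\<lambda>f. \<Sum>b\<in>B. coord B (f b) b)" by (rule trace_on_chosen_basis[OF assms(1)])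
  then show ?thesis using assms cfun.span_base by (metis (no_types, lifting) sum.cong)
qed

lemma trace_sum_scale:
  assumes "fin_dim V" "\<And>i v. i \<in> I \<Longrightarrow> v \<in> V \<Longrightarrow> A i v \<in> V"
  shows "trace_on V (\<lambda>v. \<Sum>i\<in>I. fun_scale (c i) (A i v)) = (\<Sum>i\<in>I. c i * trace_on V (A i))"
proof -
  obtain B where B: "finite B" "cfun.independent B" "cfun.span B = V" 
    "trace_on V = (\<lambda>f. \<Sum>b\<in>B. coord B (f b) b)" by (rule trace_on_chosen_basis[OF assms(1)])
  have "b \<in> B \<Longrightarrow> i \<in> I \<Longrightarrow> A i b \<in> cfun.span B" for i b
    using B assms cfun.span_base by blast
  then have "trace_on V (\<lambda>v. \<Sum>i\<in>I. fun_scale (c i) (A i v)) = (\<Sum>b\<in>B. \<Sum>i\<in>I. c i * coord B (A i b) b)"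
    unfolding B(4) by (intro sum.cong refl coord_sum_scale B) auto
  then show ?thesis unfolding B(4) sum_distrib_left by (subst (asm) sum.swap) simp
qed

lemma trace_sum:
  assumes "fin_dim V" "\<And>i v. i \<in> I \<Longrightarrow> v \<in> V \<Longrightarrow> A i v \<in> V"
  shows "trace_on V (\<lambda>v. \<Sum>i\<in>I. A i v) = (\<Sum>i\<in>I. trace_on V (A i))"
  using trace_sum_scale[OF assms, where c="\<lambda>_. 1"] by simp

lemma trace_scale:
  assumes "fin_dim V" "\<And>v. v \<in> V \<Longrightarrow> A v \<in> V"
  shows "trace_on V (\<lambda>v. fun_scale c (A v)) = c * trace_on V A"
  using trace_sum_scale[of V "{()}" "\<lambda>_. A" "\<lambda>_. c"] assms by simp

lemma trace_zero: "fin_dim V \<Longrightarrow> trace_on V (\<lambda>v. 0) = 0"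
  using trace_sum_scale[of V "{}" "\<lambda>_ v. v" "\<lambda>_. 0"] by simp

lemma trace_id: "fin_dim V \<Longrightarrow> trace_on V (\<lambda>v. v) = of_nat (cfun.dim V)"
  by (erule trace_on_chosen_basis) (auto simp: cfun.representation_basis cfun.dim_eq_card_independent cong: sum.cong)

text \<open>Writing \<open>P\<close> as \<open>P\<close> applied twice and moving one factor around
  the trace confines the computation to the image of \<open>P\<close>.\<close>

lemma trace_idempotent_compose:
  assumes "fin_dim V" "lin P" "P ` V \<subseteq> V" "\<And>v. v \<in> V \<Longrightarrow> P (P v) = P v"
    "lin A" "A ` V \<subseteq> V"
  shows "trace_on V (\<lambda>v. A (P v)) = trace_on (P ` V) (\<lambda>v. P (A v))"
proof -
  have *: "fin_dim (P ` V)" using assms fin_dim_image by blast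
  have "trace_on V (\<lambda>v. A (P v)) = trace_on V (\<lambda>v. A (P (P v)))"
    using assms by (intro trace_cong) auto
  also have "\<dots> = trace_on (P ` V) (\<lambda>w. P (A (P w)))"
    using assms by (intro trace_comm[OF assms(1) *, of P "\<lambda>v. A (P v)"]
        lin_compose[OF assms(5,2)]) auto
  also have "\<dots> = trace_on (P ` V) (\<lambda>w. P (A w))"
    using assms by (intro trace_cong *) auto
  finally show ?thesis .
qed

lemma trace_idempotent:
  assumes "fin_dim V" "lin P" "P ` V \<subseteq> V" "\<And>v. v \<in> V \<Longrightarrow> P (P v) = P v"
  shows "trace_on V P = of_nat (cfun.dim (P ` V))"
proof -
  have *: "fin_dim (P ` V)" using assms fin_dim_image by blast
  have "trace_on V P = trace_on (P ` V) (\<lambda>v. P v)"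
    using trace_idempotent_compose[OF assms lin_id] by blast
  also have "\<dots> = trace_on (P ` V) (\<lambda>v. v)"
    using assms by (intro trace_cong *) auto
  finally show ?thesis using trace_id[OF *] by simp
qed

lemma trace_conjugate:
  assumes "fin_dim V" "fin_dim W" "lin A" "lin A'" "A ` V \<subseteq> W" "A' ` W \<subseteq> V"
    "\<And>w. w \<in> W \<Longrightarrow> A (A' w) = w" "lin f" "f ` V \<subseteq> V" "\<And>v. v \<in> V \<Longrightarrow> A (f v) = g (A v)"
     "\<And>v. v \<in> V \<Longrightarrow> A' (A v) = v"
  shows "trace_on V f = trace_on W g"
proof -
  have "trace_on V f = trace_on V (\<lambda>v. A' (A (f v)))"
    using assms(9,11) by (intro trace_cong[OF assms(1)]) (metis image_subset_iff)
  also have "\<dots> = trace_on W (\<lambda>w. A (f (A' w)))"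
    using assms by (intro trace_comm[OF assms(1,2), of "\<lambda>v. A (f v)"]
        lin_compose[OF assms(3,8)]) (use assms(5,9) in blast)+
  also have "\<dots> = trace_on W g"
    using assms(6,7,10) by (intro trace_cong[OF assms(2)]) (metis image_subset_iff)
  finally show ?thesis .
qed

lemma dim_le_of_surj:
  assumes "fin_dim V" "cfun.subspace W" "lin A" "W \<subseteq> A ` V"
  shows "cfun.dim W \<le> cfun.dim V"
proof -
  obtain B where B: "finite B" "cfun.independent B" "cfun.span B = V" "card B = cfun.dim V"
    by (rule fin_dim_basis[OF assms(1)])
  have "W \<subseteq> cfun.span (A ` B)" using assms(4) cpair.linear_span_image[OF assms(3)] B by blast
  then have "cfun.dim W \<le> card (A ` B)" using B by (intro cfun.dim_le_card) auto
  then show ?thesis using card_image_le[OF B(1), of A] B by linarith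
qed

text \<open>A right inverse \<open>A'\<close> maps \<open>W\<close> onto a subspace of
  \<open>V\<close> that still covers \<open>W\<close>, so by dimension it is all of
  \<open>V\<close>. Hence \<open>A'\<close> is a two-sided inverse, and the inclusion of
  \<open>W\<close> in the image of \<open>A\<close> is an equality.\<close>

lemma isomorphism_of_dim_eq:
  assumes "fin_dim V" "cfun.subspace W" "lin A" "W \<subseteq> A ` V" "cfun.dim W = cfun.dim V"
  obtains A' where "lin A'" "A' ` W \<subseteq> V" "A ` V = W" "\<And>w. w \<in> W \<Longrightarrow> A (A' w) = w"
    "\<And>v. v \<in> V \<Longrightarrow> A' (A v) = v"
proof -
  obtain A' where A': "range A' \<subseteq> V" "lin A'" "\<forall>v\<in>A ` V. A (A' v) = v"
    using cpair.linear_exists_right_inverse_on[OF assms(3) fin_dim_subspace[OF assms(1)]] by blast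
  have sub: "cfun.subspace (A' ` W)" using A' assms lin_image_subspace by blast
  have fd': "fin_dim (A' ` W)" using fin_dim_subset[OF assms(1) sub] A' by blast
  have "W \<subseteq> A ` (A' ` W)"
  proof
    fix w assume "w \<in> W"
    then have "A (A' w) = w" using A'(3) assms(4) by blast
    then show "w \<in> A ` (A' ` W)" using \<open>w \<in> W\<close> by (metis imageI)
  qed
  then have "cfun.dim W \<le> cfun.dim (A' ` W)" using dim_le_of_surj[OF fd' assms(2,3)] by blast
  moreover have WV: "A' ` W \<subseteq> V" using A' by auto
  moreover have "cfun.dim (A' ` W) \<le> cfun.dim V"
    using fin_dim_dim_mono[OF assms(1) sub WV] .
  ultimately have VW: "A' ` W = V"
    using fin_dim_dim_eq[OF assms(1) sub WV] assms(5) by linarith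
  show ?thesis
  proof
    show "lin A'" "A' ` W \<subseteq> V" using A' VW by auto
    show 1: "A (A' w) = w" if "w \<in> W" for w using A'(3) assms(4) that by blast
    have "A ` A' ` W = W" using 1 by (simp add: image_image)
    then show "A ` V = W" by (simp add: VW)
    show "A' (A v) = v" if "v \<in> V" for v
    proof -
      from that VW have "v \<in> A' ` W" by simp
      then obtain w where "w \<in> W" "v = A' w" by (rule imageE) simp
      then show ?thesis using 1 by simp
    qed
  qed
qed

section \<open>Modules over the symmetric groups\<close>

lemma finite_Sym [simp]: "finite (Sym n)"
  by (simp add: Sym_def finite_permutations)

lemma card_Sym: "card (Sym n) = fact n"
  by (simp add: Sym_def card_permutations)

lemma Sym_id [simp]: "id \<in> Sym n"
  by (simp add: Sym_def permutes_id)

lemma Sym_comp [simp]: "s \<in> Sym n \<Longrightarrow> r \<in> Sym n \<Longrightarrow> s \<circ> r \<in> Sym n"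
  by (simp add: Sym_def permutes_compose)

lemma Sym_inv [simp]: "s \<in> Sym n \<Longrightarrow> inv s \<in> Sym n"
  by (simp add: Sym_def permutes_inv)

lemma Sym_mono: "m \<le> n \<Longrightarrow> s \<in> Sym m \<Longrightarrow> s \<in> Sym n"
  unfolding Sym_def by (auto intro: permutes_subset)

lemma Sym_permutes: "s \<in> Sym n \<Longrightarrow> s permutes {1..n}"
  by (simp add: Sym_def)

lemma Sym_bij: "s \<in> Sym n \<Longrightarrow> bij s"
  by (simp add: Sym_def permutes_bij)

lemma Sym_inv_o: "s \<in> Sym n \<Longrightarrow> s \<circ> inv s = id" "s \<in> Sym n \<Longrightarrow> inv s \<circ> s = id"
  by (simp_all add: Sym_def permutes_inv_o)

lemma Sym_cancel:
  assumes "s \<in> Sym n"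
  shows "s \<circ> (inv s \<circ> r) = r" "inv s \<circ> (s \<circ> r) = r" "(r \<circ> s) \<circ> inv s = r" "(r \<circ> inv s) \<circ> s = r"
  using Sym_inv_o[OF assms] by (metis comp_assoc comp_id id_comp)+

lemma Sym_inv_inv: "s \<in> Sym n \<Longrightarrow> inv (inv s) = s"
  by (simp add: Sym_def permutes_inv_inv)

lemma Sym_inv_comp: "s \<in> Sym n \<Longrightarrow> r \<in> Sym n \<Longrightarrow> inv (s \<circ> r) = inv r \<circ> inv s"
  by (meson o_inv_distrib Sym_bij)

lemma sum_Sym_left: "h \<in> Sym n \<Longrightarrow> (\<Sum>g\<in>Sym n. F (h \<circ> g)) = (\<Sum>g\<in>Sym n. F g)"
  by (rule sum.reindex_bij_witness[of _ "\<lambda>g. inv h \<circ> g" "\<lambda>g. h \<circ> g"]) (auto simp: Sym_cancel)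

lemma sum_Sym_right: "h \<in> Sym n \<Longrightarrow> (\<Sum>g\<in>Sym n. F (g \<circ> h)) = (\<Sum>g\<in>Sym n. F g)"
  by (rule sum.reindex_bij_witness[of _ "\<lambda>g. g \<circ> inv h" "\<lambda>g. g \<circ> h"]) (auto simp: Sym_cancel)

lemma sum_Sym_inv: "(\<Sum>g\<in>Sym n. F (inv g)) = (\<Sum>g\<in>Sym n. F g)"
  by (rule sum.reindex_bij_witness[of _ inv inv]) (auto simp: Sym_inv_inv)

section \<open>The action of permutations and its characters\<close>

lemma lin_perm_act: "lin (perm_act s)"
  by (rule linI) (auto simp: perm_act_def fun_eq_iff plus_fun_apply fun_scale_apply)

lemmas perm_act_simps = lin_simps[OF lin_perm_act]

lemma perm_act_comp: "perm_act s (perm_act r f) = perm_act (s \<circ> r) f"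
  by (simp add: perm_act_def comp_assoc)

lemma perm_act_id [simp]: "perm_act id f = f" "perm_act (\<lambda>x. x) f = f"
  by (simp_all add: perm_act_def comp_def)

text \<open>The group is recorded by \<open>n\<close> because the same space is restricted from S(n)
  to smaller symmetric groups; see \<open>sym_mod_mono\<close>.\<close>

definition sym_mod :: "nat \<Rightarrow> (tabloid \<Rightarrow> complex) set \<Rightarrow> bool" where
  "sym_mod n V \<longleftrightarrow> fin_dim V \<and> (\<forall>g\<in>Sym n. perm_act g ` V \<subseteq> V)"

lemma sym_mod_fin_dim: "sym_mod n V \<Longrightarrow> fin_dim V"
  by (simp add: sym_mod_def)

lemma sym_mod_subspace: "sym_mod n V \<Longrightarrow> cfun.subspace V"
  by (simp add: sym_mod_def fin_dim_subspace)

lemma sym_mod_act: "sym_mod n V \<Longrightarrow> g \<in> Sym n \<Longrightarrow> v \<in> V \<Longrightarrow> perm_act g v \<in> V"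
  by (auto simp: sym_mod_def)

lemma sym_mod_act_image: "sym_mod n V \<Longrightarrow> g \<in> Sym n \<Longrightarrow> perm_act g ` V \<subseteq> V"
  by (auto simp: sym_mod_def)

lemma sym_mod_mono: "m \<le> n \<Longrightarrow> sym_mod n V \<Longrightarrow> sym_mod m V"
  by (auto simp: sym_mod_def Sym_mono)

abbreviation character :: "(tabloid \<Rightarrow> complex) set \<Rightarrow> (nat \<Rightarrow> nat) \<Rightarrow> complex" where
  "character V g \<equiv> trace_on V (perm_act g)"

lemma character_comm:
  assumes "sym_mod n V" "x \<in> Sym n" "y \<in> Sym n"
  shows "character V (x \<circ> y) = character V (y \<circ> x)"
  using trace_comm[OF sym_mod_fin_dim[OF assms(1)] sym_mod_fin_dim[OF assms(1)], of "perm_act x" "perm_act y"]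
    assms sym_mod_act_image lin_perm_act by (simp add: perm_act_comp)

lemma character_conj:
  assumes "sym_mod n V" "x \<in> Sym n" "g \<in> Sym n"
  shows "character V (g \<circ> x \<circ> inv g) = character V x"
  using character_comm[OF assms(1), of "g \<circ> x" "inv g"] assms by (simp add: Sym_cancel)

lemma character_id: "sym_mod n V \<Longrightarrow> character V id = of_nat (cfun.dim V)"
  using trace_id[OF sym_mod_fin_dim] trace_cong[OF sym_mod_fin_dim, of n V "perm_act id" "\<lambda>v. v"] by simp

section \<open>Homomorphisms and Schur orthogonality\<close>

definition intertw ::
  "nat \<Rightarrow> (tabloid \<Rightarrow> complex) set \<Rightarrow> (tabloid \<Rightarrow> complex) set \<Rightarrow>
    ((tabloid \<Rightarrow> complex) \<Rightarrow> (tabloid \<Rightarrow> complex)) \<Rightarrow> bool" where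
  "intertw n V W A \<longleftrightarrow>
     lin A \<and> A ` V \<subseteq> W \<and> (\<forall>g\<in>Sym n. \<forall>v\<in>V. A (perm_act g v) = perm_act g (A v))"

text \<open>The conclusion of Schur's lemma serves as the definition of irreducibility: it is what
  the orthogonality relations use, and for Specht modules it can be checked directly.\<close>

definition simple_mod :: "nat \<Rightarrow> (tabloid \<Rightarrow> complex) set \<Rightarrow> bool" where
  "simple_mod n V \<longleftrightarrow> sym_mod n V \<and> cfun.dim V \<noteq> 0 \<and>
     (\<forall>A. intertw n V V A \<longrightarrow> (\<exists>s. \<forall>v\<in>V. A v = fun_scale s v))"

text \<open>One-sided, because the dominance argument for Specht modules excludes homomorphisms in
  one direction.\<close>

definition no_hom :: "nat \<Rightarrow> (tabloid \<Rightarrow> complex) set \<Rightarrow> (tabloid \<Rightarrow> complex) set \<Rightarrow> bool" where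
  "no_hom n V W \<longleftrightarrow> (\<forall>A. intertw n V W A \<longrightarrow> (\<forall>v\<in>V. A v = 0))"

text \<open>Averaging without the factor 1/n!, which reappears as \<open>fact n\<close> in
  \<open>trace_avg\<close>.\<close>

definition avg ::
  "nat \<Rightarrow> ((tabloid \<Rightarrow> complex) \<Rightarrow> (tabloid \<Rightarrow> complex)) \<Rightarrow> (tabloid \<Rightarrow> complex) \<Rightarrow> tabloid \<Rightarrow> complex"
  where "avg n A v = (\<Sum>g\<in>Sym n. perm_act g (A (perm_act (inv g) v)))"

lemma lin_avg: "lin A \<Longrightarrow> lin (avg n A)"
  unfolding avg_def
  by (rule linI) (simp_all add: perm_act_simps lin_simps(1,2)[of A] sum.distrib cfun.scale_sum_right)

lemma intertw_avg:
  assumes "sym_mod n V" "sym_mod n W" "lin A" "A ` V \<subseteq> W"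
  shows "intertw n V W (avg n A)"
  unfolding intertw_def
proof (intro conjI ballI lin_avg assms)
  show "avg n A ` V \<subseteq> W"
  proof safe
    fix v assume "v \<in> V"
    then have "A (perm_act (inv g) v) \<in> W" if "g \<in> Sym n" for g
      using that assms(4) sym_mod_act[OF assms(1)] Sym_inv by blast
    then show "avg n A v \<in> W"
      unfolding avg_def
      by (intro cfun.subspace_sum sym_mod_subspace[OF assms(2)] sym_mod_act[OF assms(2)])
  qed
  fix h v assume h: "h \<in> Sym n"
  have "avg n A (perm_act h v) = (\<Sum>g\<in>Sym n. perm_act g (A (perm_act (inv g \<circ> h) v)))"
    by (simp add: avg_def perm_act_comp)
  also have "\<dots> = (\<Sum>g\<in>Sym n. perm_act (h \<circ> g) (A (perm_act (inv (h \<circ> g) \<circ> h) v)))"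
    by (rule sum_Sym_left[OF h, symmetric])
  also have "\<dots> = (\<Sum>g\<in>Sym n. perm_act h (perm_act g (A (perm_act (inv g) v))))"
    using h by (intro sum.cong refl) (simp add: Sym_inv_comp Sym_cancel perm_act_comp)
  also have "\<dots> = perm_act h (avg n A v)" by (simp add: avg_def perm_act_simps)
  finally show "avg n A (perm_act h v) = perm_act h (avg n A v)" .
qed

text \<open>These are the elementary matrices; averaging them over the group turns statements about
  homomorphisms into orthogonality of matrix coefficients.\<close>

lemma rank_one_exists:
  assumes "cfun.independent B" "finite B" "b \<in> B"
  obtains E where "lin E" "\<And>v. v \<in> cfun.span B \<Longrightarrow> E v = fun_scale (coord B v b) c"
proof -
  obtain E where E: "lin E" "\<And>x. x \<in> B \<Longrightarrow> E x = (if x = b then c else 0)"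
    using cpair.linear_independent_extend[OF assms(1), of "\<lambda>x. if x = b then c else 0"] by blast
  have "E v = fun_scale (coord B v b) c" if v: "v \<in> cfun.span B" for v
  proof -
    have "E v = (\<Sum>b'\<in>B. fun_scale (coord B v b') (E b'))"
      by (subst coord_expand[OF assms(2,1) v, symmetric]) (simp add: lin_simps[OF E(1)])
    also have "\<dots> = (\<Sum>b'\<in>B. if b' = b then fun_scale (coord B v b) c else 0)"
      by (intro sum.cong refl) (simp add: E(2))
    finally show ?thesis using assms by simp
  qed
  then show ?thesis using that E(1) by blast
qed

text \<open>The product of a diagonal entry of \<open>inv g\<close> and one of \<open>g\<close>,
  summed over the group, is a coordinate of an averaged elementary matrix. Schur's lemma thus
  controls each term in the expansion of a product of two characters.\<close>

lemma avg_rank_one_coord: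
  assumes "sym_mod n V" "sym_mod n W" "cfun.independent B" "finite B" "cfun.span B = V" "b \<in> B"
    "cfun.independent C" "cfun.span C = W" "c \<in> C"
    "\<And>v. v \<in> V \<Longrightarrow> E v = fun_scale (coord B v b) c"
  shows "coord C (avg n E b) c =
    (\<Sum>g\<in>Sym n. coord B (perm_act (inv g) b) b * coord C (perm_act g c) c)"
proof -
  have bc: "b \<in> V" "c \<in> W" using assms cfun.span_base by auto
  have "avg n E b = (\<Sum>g\<in>Sym n. fun_scale (coord B (perm_act (inv g) b) b) (perm_act g c))"
    unfolding avg_def
    by (intro sum.cong refl) (simp add: assms(10) sym_mod_act[OF assms(1)] bc perm_act_simps)
  then show ?thesis
    using assms(7,8) bc sym_mod_act[OF assms(2)] by (simp add: coord_sum_scale)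
qed

lemma sum_character_inv_mult:
  assumes "sym_mod n V" "sym_mod n W" "cfun.independent B" "finite B" "cfun.span B = V"
    "cfun.independent C" "finite C" "cfun.span C = W"
  shows "(\<Sum>g\<in>Sym n. character V (inv g) * character W g) =
    (\<Sum>b\<in>B. \<Sum>c\<in>C. \<Sum>g\<in>Sym n. coord B (perm_act (inv g) b) b * coord C (perm_act g c) c)"
proof -
  have "(\<Sum>g\<in>Sym n. character V (inv g) * character W g) =
    (\<Sum>g\<in>Sym n. \<Sum>b\<in>B. \<Sum>c\<in>C. coord B (perm_act (inv g) b) b * coord C (perm_act g c) c)"
  proof (intro sum.cong refl)
    fix g assume g: "g \<in> Sym n"
    have "character V (inv g) = (\<Sum>b\<in>B. coord B (perm_act (inv g) b) b)"
      using assms g by (intro trace_basis) (auto simp: sym_mod_fin_dim sym_mod_act lin_perm_act)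
    moreover have "character W g = (\<Sum>c\<in>C. coord C (perm_act g c) c)"
      using assms g by (intro trace_basis) (auto simp: sym_mod_fin_dim sym_mod_act lin_perm_act)
    ultimately show "character V (inv g) * character W g =
      (\<Sum>b\<in>B. \<Sum>c\<in>C. coord B (perm_act (inv g) b) b * coord C (perm_act g c) c)"
      by (simp add: sum_product)
  qed
  also have "\<dots> = (\<Sum>b\<in>B. \<Sum>g\<in>Sym n. \<Sum>c\<in>C. coord B (perm_act (inv g) b) b * coord C (perm_act g c) c)"
    by (rule sum.swap)
  also have "\<dots> = (\<Sum>b\<in>B. \<Sum>c\<in>C. \<Sum>g\<in>Sym n. coord B (perm_act (inv g) b) b * coord C (perm_act g c) c)"
    by (intro sum.cong refl sum.swap)
  finally show ?thesis .
qed

lemma character_orthogonal: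
  assumes "sym_mod n V" "sym_mod n W" "no_hom n V W"
  shows "(\<Sum>g\<in>Sym n. character V (inv g) * character W g) = 0"
proof -
  obtain B where B: "finite B" "cfun.independent B" "cfun.span B = V" "card B = cfun.dim V"
    by (rule fin_dim_basis[OF sym_mod_fin_dim[OF assms(1)]])
  obtain C where C: "finite C" "cfun.independent C" "cfun.span C = W" "card C = cfun.dim W"
    by (rule fin_dim_basis[OF sym_mod_fin_dim[OF assms(2)]])
  have "(\<Sum>g\<in>Sym n. coord B (perm_act (inv g) b) b * coord C (perm_act g c) c) = 0"
    if bc: "b \<in> B" "c \<in> C" for b c
  proof -
    obtain E where E: "lin E" "\<And>v. v \<in> cfun.span B \<Longrightarrow> E v = fun_scale (coord B v b) c"
      using rank_one_exists[OF B(2,1) bc(1), where c = c] by blast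
    have "c \<in> W" "b \<in> V" using bc B C cfun.span_base by auto
    then have "E ` V \<subseteq> W"
      using E(2) B cfun.subspace_scale[OF sym_mod_subspace[OF assms(2)]] by auto
    then have "avg n E b = 0"
      using assms(3) intertw_avg[OF assms(1,2) E(1)] \<open>b \<in> V\<close> by (auto simp: no_hom_def)
    then show ?thesis
      using avg_rank_one_coord[OF assms(1,2) B(2,1,3) bc(1) C(2,3) bc(2), of E] E(2) B(3)
      by (simp add: cfun.representation_zero)
  qed
  then show ?thesis
    by (simp add: sum_character_inv_mult[OF assms(1,2) B(2,1,3) C(2,1,3)])
qed

lemma trace_avg:
  assumes "sym_mod n V" "lin A" "A ` V \<subseteq> V"
  shows "trace_on V (avg n A) = fact n * trace_on V A"
proof -
  have V: "fin_dim V" using assms sym_mod_fin_dim by auto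
  have in_V: "perm_act g (A (perm_act (inv g) v)) \<in> V" if "g \<in> Sym n" "v \<in> V" for g v
    using assms(3) sym_mod_act[OF assms(1)] that Sym_inv by blast
  have "trace_on V (\<lambda>v. perm_act g (A (perm_act (inv g) v))) = trace_on V A" if g: "g \<in> Sym n" for g
  proof -
    have AV: "\<And>v. v \<in> V \<Longrightarrow> A v \<in> V" using assms(3) by auto
    have "trace_on V (\<lambda>v. perm_act g (A (perm_act (inv g) v))) =
      trace_on V (\<lambda>v. A (perm_act (inv g) (perm_act g v)))"
      using AV sym_mod_act[OF assms(1)] g
      by (intro trace_comm[OF V V, of "\<lambda>v. A (perm_act (inv g) v)" "perm_act g"]
          lin_compose[OF assms(2) lin_perm_act] lin_perm_act) auto
    then show ?thesis using g by (simp add: perm_act_comp Sym_inv_o)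
  qed
  then have "trace_on V (\<lambda>v. \<Sum>g\<in>Sym n. perm_act g (A (perm_act (inv g) v))) = fact n * trace_on V A"
    using in_V by (subst trace_sum[OF V]) (auto simp: card_Sym)
  then show ?thesis by (simp add: avg_def[abs_def])
qed

lemma character_orthonormal:
  assumes "simple_mod n V"
  shows "(\<Sum>g\<in>Sym n. character V (inv g) * character V g) = fact n"
proof -
  have V: "sym_mod n V" "cfun.dim V \<noteq> 0"
    and scalar: "\<And>A. intertw n V V A \<Longrightarrow> \<exists>s. \<forall>v\<in>V. A v = fun_scale s v"
    using assms by (auto simp: simple_mod_def)
  have fV: "fin_dim V" using V sym_mod_fin_dim by auto
  obtain B where B: "finite B" "cfun.independent B" "cfun.span B = V" "card B = cfun.dim V"
    by (rule fin_dim_basis[OF fV])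
  have *: "(\<Sum>g\<in>Sym n. coord B (perm_act (inv g) b) b * coord B (perm_act g c) c)
    = (if c = b then fact n / of_nat (cfun.dim V) else 0)"
    if bc: "b \<in> B" "c \<in> B" for b c
  proof -
    obtain E where E: "lin E" "\<And>v. v \<in> cfun.span B \<Longrightarrow> E v = fun_scale (coord B v b) c"
      using rank_one_exists[OF B(2,1) bc(1), where c = c] by blast
    have cb: "c \<in> V" "b \<in> V" using bc B cfun.span_base by auto
    then have EV: "E ` V \<subseteq> V"
      using E(2) B cfun.subspace_scale[OF sym_mod_subspace[OF V(1)]] by auto
    then obtain s where s: "\<And>v. v \<in> V \<Longrightarrow> avg n E v = fun_scale s v"
      using scalar intertw_avg[OF V(1) V(1) E(1)] by blast
    have 1: "(\<Sum>g\<in>Sym n. coord B (perm_act (inv g) b) b * coord B (perm_act g c) c)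
        = coord B (avg n E b) c"
      using avg_rank_one_coord[OF V(1) V(1) B(2,1,3) bc(1) B(2,3) bc(2), of E] E(2) B(3) by simp
    also have "\<dots> = s * (if c = b then 1 else 0)"
      using s[OF cb(2)] cb bc B by (simp add: cfun.representation_scale cfun.representation_basis)
    finally have 2: "(\<Sum>g\<in>Sym n. coord B (perm_act (inv g) b) b * coord B (perm_act g c) c)
        = s * (if c = b then 1 else 0)" .
    \<comment> \<open>Comparing traces determines the scalar: averaging multiplies the trace by
      \<open>fact n\<close>, and for \<open>c = b\<close> the elementary matrix \<open>E\<close> has
      trace 1.\<close>
    have "s * of_nat (cfun.dim V) = fact n" if "c = b"
    proof -
      have "trace_on V (avg n E) = trace_on V (\<lambda>v. fun_scale s v)"
        using s by (intro trace_cong[OF fV])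
      also have "\<dots> = s * of_nat (cfun.dim V)"
        using trace_scale[OF fV, of "\<lambda>v. v"] trace_id[OF fV] by simp
      finally have "s * of_nat (cfun.dim V) = fact n * trace_on V E"
        using trace_avg[OF V(1) E(1) EV] by simp
      also have "trace_on V E = (\<Sum>b'\<in>B. coord B (E b') b')"
        by (rule trace_basis[OF fV B(2,3) E(1) EV])
      also have "\<dots> = (\<Sum>b'\<in>B. if b' = b then 1 else 0)"
        using bc B(2) cb B(3) \<open>c = b\<close> cfun.span_base[of _ B]
        by (intro sum.cong refl)
          (simp add: E(2)[unfolded B(3)] cfun.representation_scale cfun.representation_basis)
      finally show ?thesis using B bc by simp
    qed
    then show ?thesis using 2 V by (auto simp: field_simps)
  qed
  show ?thesis
    unfolding sum_character_inv_mult[OF V(1) V(1) B(2,1,3) B(2,1,3)]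
    using V B by (simp add: * cong: sum.cong)
qed

section \<open>Isotypic projections as central idempotents of the group algebra\<close>

definition isoproj ::
  "nat \<Rightarrow> (tabloid \<Rightarrow> complex) set \<Rightarrow> (tabloid \<Rightarrow> complex) \<Rightarrow> tabloid \<Rightarrow> complex" where
  "isoproj n V f =
     (\<Sum>y\<in>Sym n. fun_scale (of_nat (cfun.dim V) / fact n * character V y) (perm_act (inv y) f))"

lemma lin_isoproj: "lin (isoproj n V)"
  unfolding isoproj_def[abs_def] by (intro lin_sum_scale lin_perm_act)

lemmas isoproj_simps = lin_simps[OF lin_isoproj]

lemma isoproj_commute:
  assumes "lin A" "\<And>g. g \<in> Sym n \<Longrightarrow> A (perm_act g f) = perm_act g (A f)"
  shows "A (isoproj n V f) = isoproj n V (A f)"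
  using assms by (simp add: isoproj_def lin_simps[OF assms(1)])

lemma isoproj_in:
  assumes "sym_mod n U" "f \<in> U"
  shows "isoproj n V f \<in> U"
  unfolding isoproj_def
  using sym_mod_act[OF assms(1) Sym_inv assms(2)] sym_mod_subspace[OF assms(1)]
  by (intro cfun.subspace_sum cfun.subspace_scale) auto

text \<open>The coefficients form a class function, so after substituting \<open>g \<circ> y\<close>
  for \<open>y\<close> they may be read at \<open>y \<circ> g\<close> instead; this makes the group
  algebra element central.\<close>

lemma isoproj_perm_act:
  assumes "sym_mod n V" "g \<in> Sym n"
  shows "perm_act g (isoproj n V f) = isoproj n V (perm_act g f)"
proof -
  let ?c = "\<lambda>y. of_nat (cfun.dim V) / fact n * character V y"
  have "isoproj n V (perm_act g f) = (\<Sum>y\<in>Sym n. fun_scale (?c y) (perm_act (inv y \<circ> g) f))"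
    by (simp add: isoproj_def perm_act_comp)
  also have "\<dots> = (\<Sum>y\<in>Sym n. fun_scale (?c (g \<circ> y)) (perm_act (inv (g \<circ> y) \<circ> g) f))"
    by (rule sum_Sym_left[OF assms(2), symmetric])
  also have "\<dots> = (\<Sum>y\<in>Sym n. fun_scale (?c (y \<circ> g)) (perm_act (g \<circ> inv (y \<circ> g)) f))"
    using assms by (intro sum.cong refl) (simp add: character_comm Sym_inv_comp Sym_cancel)
  also have "\<dots> = (\<Sum>y\<in>Sym n. fun_scale (?c y) (perm_act (g \<circ> inv y) f))"
    by (rule sum_Sym_right[OF assms(2)])
  also have "\<dots> = perm_act g (isoproj n V f)"
    by (simp add: isoproj_def perm_act_simps perm_act_comp)
  finally show ?thesis ..
qed

lemma trace_isoproj: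
  assumes "sym_mod n U" "x \<in> Sym n"
  shows "trace_on U (\<lambda>v. perm_act x (isoproj n V v)) =
    (\<Sum>y\<in>Sym n. of_nat (cfun.dim V) / fact n * character V y * character U (x \<circ> inv y))"
proof -
  have "trace_on U (\<lambda>v. perm_act x (isoproj n V v)) = 
    trace_on U (\<lambda>v. \<Sum>y\<in>Sym n. fun_scale (of_nat (cfun.dim V) / fact n * character V y) (perm_act (x \<circ> inv y) v))"
    by (intro trace_cong sym_mod_fin_dim[OF assms(1)]) (simp add: isoproj_def perm_act_simps perm_act_comp)
  then show ?thesis
    using assms by (subst (asm) trace_sum_scale) (auto simp: sym_mod_fin_dim sym_mod_act)
qed

lemma isoproj_scalar:
  assumes "sym_mod n V" "simple_mod n W"
  obtains s where "\<And>w. w \<in> W \<Longrightarrow> isoproj n V w = fun_scale s w"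
    "s * of_nat (cfun.dim W) = of_nat (cfun.dim V) / fact n * (\<Sum>g\<in>Sym n. character V (inv g) * character W g)"
proof -
  have W: "sym_mod n W" using assms by (auto simp: simple_mod_def)
  have "intertw n W W (isoproj n V)"
    unfolding intertw_def using isoproj_perm_act[OF assms(1)] isoproj_in[OF W] lin_isoproj by auto
  then have "\<exists>s. \<forall>w\<in>W. isoproj n V w = fun_scale s w"
    using assms(2) unfolding simple_mod_def by blast
  then obtain s where s: "\<And>w. w \<in> W \<Longrightarrow> isoproj n V w = fun_scale s w" by blast
  have "s * of_nat (cfun.dim W) = trace_on W (\<lambda>v. fun_scale s v)"
    using trace_scale[OF sym_mod_fin_dim[OF W], of "\<lambda>v. v"] trace_id[OF sym_mod_fin_dim[OF W]] by simp
  also have "\<dots> = trace_on W (\<lambda>v. perm_act id (isoproj n V v))"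
    using s by (intro trace_cong sym_mod_fin_dim[OF W]) simp
  also have "\<dots> = (\<Sum>y\<in>Sym n. of_nat (cfun.dim V) / fact n * (character V y * character W (inv y)))"
    unfolding trace_isoproj[OF W Sym_id] by (simp add: mult.assoc)
  also have "\<dots> = of_nat (cfun.dim V) / fact n * (\<Sum>y\<in>Sym n. character V (inv y) * character W (inv (inv y)))"
    by (subst sum_Sym_inv[of "\<lambda>y. character V y * character W (inv y)"]) (simp add: sum_distrib_left)
  also have "(\<Sum>y\<in>Sym n. character V (inv y) * character W (inv (inv y))) = (\<Sum>y\<in>Sym n. character V (inv y) * character W y)"
    by (intro sum.cong refl) (simp add: Sym_inv_inv)
  finally show ?thesis using that s by blast
qed

lemma isoproj_self:
  assumes "simple_mod n V" "v \<in> V"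
  shows "isoproj n V v = v"
proof -
  have V: "sym_mod n V" "cfun.dim V \<noteq> 0" using assms by (auto simp: simple_mod_def)
  obtain s where s: "\<And>w. w \<in> V \<Longrightarrow> isoproj n V w = fun_scale s w"
    "s * of_nat (cfun.dim V) = of_nat (cfun.dim V) / fact n * (\<Sum>g\<in>Sym n. character V (inv g) * character V g)"
    using isoproj_scalar[OF V(1) assms(1)] by blast
  then have "s = 1" using V by (simp add: character_orthonormal[OF assms(1)])
  then show ?thesis using s(1)[OF assms(2)] by simp
qed

text \<open>Absence of homomorphisms in either direction is enough, because replacing
  \<open>g\<close> by its inverse exchanges the two characters in the orthogonality sum.\<close>

lemma isoproj_other:
  assumes "simple_mod n V" "simple_mod n W" "no_hom n V W \<or> no_hom n W V" "w \<in> W"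
  shows "isoproj n V w = 0"
proof -
  have V: "sym_mod n V" "sym_mod n W" "cfun.dim W \<noteq> 0" using assms by (auto simp: simple_mod_def)
  obtain s where s: "\<And>w. w \<in> W \<Longrightarrow> isoproj n V w = fun_scale s w"
    "s * of_nat (cfun.dim W) = of_nat (cfun.dim V) / fact n * (\<Sum>g\<in>Sym n. character V (inv g) * character W g)"
    using isoproj_scalar[OF V(1) assms(2)] by blast
  have "(\<Sum>g\<in>Sym n. character V (inv g) * character W g) = 0"
  proof (cases "no_hom n V W")
    case True then show ?thesis using character_orthogonal V by blast
  next
    case False
    then have "(\<Sum>g\<in>Sym n. character W (inv g) * character V g) = 0" using character_orthogonal V assms by blast
    then have "(\<Sum>g\<in>Sym n. character W (inv (inv g)) * character V (inv g)) = 0"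
      by (subst sum_Sym_inv[of "\<lambda>g. character W (inv g) * character V g"])
    moreover have "(\<Sum>g\<in>Sym n. character W (inv (inv g)) * character V (inv g)) = (\<Sum>g\<in>Sym n. character V (inv g) * character W g)"
      by (intro sum.cong refl) (simp add: Sym_inv_inv)
    ultimately show ?thesis by simp
  qed
  then have "s = 0" using s(2) V by simp
  then show ?thesis using s(1)[OF assms(4)] by simp
qed

text \<open>In the product of the two group algebra elements, the coefficient at
  \<open>inv w\<close> is a trace on \<open>W\<close> involving the projection for \<open>V\<close>.
  How that projection acts on \<open>W\<close> therefore decides the product on every function
  \<open>f\<close>, whether or not \<open>f\<close> lies in a given module.\<close>

lemma isoproj_isoproj:
  assumes "sym_mod n W"
  shows "isoproj n V (isoproj n W f) = 
    (\<Sum>w\<in>Sym n. fun_scale (of_nat (cfun.dim W) / fact n *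
        trace_on W (\<lambda>v. perm_act w (isoproj n V v))) (perm_act (inv w) f))"
proof -
  define a where "a = (\<lambda>y. of_nat (cfun.dim V) / fact n * character V y)"
  define b where "b = (\<lambda>y. of_nat (cfun.dim W) / fact n * character W y)"
  have "isoproj n V (isoproj n W f) =
    (\<Sum>y\<in>Sym n. \<Sum>z\<in>Sym n. fun_scale (a y * b z) (perm_act (inv y \<circ> inv z) f))"
    by (simp add: isoproj_def perm_act_simps cfun.scale_sum_right perm_act_comp a_def b_def)
  also have "\<dots> = (\<Sum>y\<in>Sym n. \<Sum>w\<in>Sym n. fun_scale (a y * b (w \<circ> inv y)) (perm_act (inv w) f))"
  proof (rule sum.cong[OF refl])
    fix y assume y: "y \<in> Sym n"
    have "(\<Sum>z\<in>Sym n. fun_scale (a y * b z) (perm_act (inv y \<circ> inv z) f)) = 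
      (\<Sum>w\<in>Sym n. fun_scale (a y * b (w \<circ> inv y)) (perm_act (inv y \<circ> inv (w \<circ> inv y)) f))"
      using sum_Sym_right[of "inv y" n "\<lambda>z. fun_scale (a y * b z) (perm_act (inv y \<circ> inv z) f)"] y
      by simp
    also have "\<dots> = (\<Sum>w\<in>Sym n. fun_scale (a y * b (w \<circ> inv y)) (perm_act (inv w) f))"
      using y by (intro sum.cong refl) (simp add: Sym_inv_comp[of _ n] Sym_inv_inv Sym_cancel)
    finally show "(\<Sum>z\<in>Sym n. fun_scale (a y * b z) (perm_act (inv y \<circ> inv z) f)) = 
      (\<Sum>w\<in>Sym n. fun_scale (a y * b (w \<circ> inv y)) (perm_act (inv w) f))" .
  qed
  also have "\<dots> = (\<Sum>w\<in>Sym n. fun_scale (\<Sum>y\<in>Sym n. a y * b (w \<circ> inv y)) (perm_act (inv w) f))"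
    by (subst sum.swap) (simp add: cfun.scale_sum_left)
  also have "\<dots> = (\<Sum>w\<in>Sym n. fun_scale (of_nat (cfun.dim W) / fact n *
        trace_on W (\<lambda>v. perm_act w (isoproj n V v))) (perm_act (inv w) f))"
    by (intro sum.cong refl arg_cong2[where f=fun_scale])
       (simp add: trace_isoproj[OF assms] a_def b_def sum_distrib_left ac_simps)
  finally show ?thesis .
qed

lemma isoproj_idem:
  assumes "simple_mod n V"
  shows "isoproj n V (isoproj n V f) = isoproj n V f"
proof -
  have V: "sym_mod n V" using assms by (auto simp: simple_mod_def)
  have "trace_on V (\<lambda>v. perm_act w (isoproj n V v)) = character V w" for w
    using isoproj_self[OF assms] by (intro trace_cong sym_mod_fin_dim[OF V]) simp
  then show ?thesis by (simp add: isoproj_isoproj[OF V]) (simp add: isoproj_def)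
qed

lemma isoproj_orthogonal:
  assumes "simple_mod n V" "simple_mod n W" "no_hom n V W \<or> no_hom n W V"
  shows "isoproj n V (isoproj n W f) = 0"
proof -
  have W: "sym_mod n W" using assms by (auto simp: simple_mod_def)
  have "trace_on W (\<lambda>v. perm_act w (isoproj n V v)) = trace_on W (\<lambda>v. 0)" for w
    using isoproj_other[OF assms] by (intro trace_cong sym_mod_fin_dim[OF W]) (simp add: perm_act_simps)
  then show ?thesis by (simp add: isoproj_isoproj[OF W] trace_zero[OF sym_mod_fin_dim[OF W]])
qed

section \<open>Specht modules\<close>

lemma bij_betw_transfer_permutes:
  assumes "bij_betw f A D" "bij_betw f' A D"
  obtains p where "p permutes A" "\<forall>x\<in>A. f (p x) = f' x"
proof -
  define p where "p = (\<lambda>x. if x \<in> A then inv_into A f (f' x) else x)"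
  have "bij_betw (inv_into A f \<circ> f') A A"
    using assms bij_betw_inv_into bij_betw_trans by blast
  then have "bij_betw p A A" by (rule bij_betw_cong[THEN iffD1, rotated]) (simp add: p_def)
  then have "p permutes A" by (rule bij_imp_permutes) (simp add: p_def)
  moreover have "\<forall>x\<in>A. f (p x) = f' x"
    using assms by (auto simp: p_def bij_betw_def intro!: f_inv_into_f)
  ultimately show ?thesis using that by blast
qed

section \<open>Young diagrams as down-closed sets of boxes\<close>

definition young :: "box set \<Rightarrow> bool" where
  "young D \<longleftrightarrow> finite D \<and> (\<forall>i j. (i, j) \<in> D \<longrightarrow> 1 \<le> i \<and> 1 \<le> j \<and>
     (\<forall>i' j'. 1 \<le> i' \<longrightarrow> i' \<le> i \<longrightarrow> 1 \<le> j' \<longrightarrow> j' \<le> j \<longrightarrow> (i', j') \<in> D))"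

lemma young_finite: "young D \<Longrightarrow> finite D"
  by (simp add: young_def)

lemma young_pos: "young D \<Longrightarrow> (i, j) \<in> D \<Longrightarrow> 1 \<le> i \<and> 1 \<le> j"
  unfolding young_def by blast

lemma young_down:
  "young D \<Longrightarrow> (i, j) \<in> D \<Longrightarrow> 1 \<le> i' \<Longrightarrow> i' \<le> i \<Longrightarrow> 1 \<le> j' \<Longrightarrow> j' \<le> j \<Longrightarrow> (i', j') \<in> D"
  unfolding young_def by blast

lemma down_closed_eq_interval:
  fixes A :: "nat set"
  assumes "finite A" "\<And>x y. x \<in> A \<Longrightarrow> 1 \<le> y \<Longrightarrow> y \<le> x \<Longrightarrow> y \<in> A" "0 \<notin> A"
  shows "A = {1..card A}"
proof (cases "A = {}")
  case False
  have eq: "A = {1..Max A}"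
  proof
    show "A \<subseteq> {1..Max A}" using assms by (auto simp: Suc_le_eq intro!: gr0I)
    show "{1..Max A} \<subseteq> A" using assms(2)[of "Max A"] Max_in[OF assms(1) False] by auto
  qed
  have "card A = card {1..Max A}" by (rule arg_cong[OF eq])
  then have "Max A = card A" by simp
  then show ?thesis using eq by (simp only:)
qed simp

lemma young_row_mem:
  assumes "young D"
  shows "(i, j) \<in> D \<longleftrightarrow> 1 \<le> j \<and> j \<le> card {b\<in>D. fst b = i}"
proof -
  define A where "A = {j. (i, j) \<in> D}"
  have img: "{b\<in>D. fst b = i} = Pair i ` A" by (auto simp: A_def)
  have "A = snd ` {b\<in>D. fst b = i}" by (force simp: A_def)
  then have "finite A" using young_finite[OF assms] by simp
  have "A = {1..card A}"
  proof (rule down_closed_eq_interval[OF \<open>finite A\<close>])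
    fix x y assume "x \<in> A" "1 \<le> y" "y \<le> x"
    then show "y \<in> A" using young_down[OF assms, of i x i y] young_pos[OF assms, of i x] by (simp add: A_def)
  next
    show "0 \<notin> A" using young_pos[OF assms, of i 0] by (auto simp: A_def)
  qed
  then have A: "x \<in> A \<longleftrightarrow> 1 \<le> x \<and> x \<le> card A" for x by (metis atLeastAtMost_iff)
  have card: "card {b\<in>D. fst b = i} = card A"
    unfolding img by (rule card_image) (simp add: inj_on_def)
  have "(i, j) \<in> D \<longleftrightarrow> j \<in> A" by (simp add: A_def)
  also have "\<dots> \<longleftrightarrow> 1 \<le> j \<and> j \<le> card A" by (rule A)
  finally show ?thesis unfolding card .
qed

text \<open>The numbers of boxes in the first \<open>k\<close> rows are the quantities compared in
  the dominance order; their differences are the row lengths.\<close>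

lemma young_eqI:
  assumes "young D" "young D'"
    "\<And>k. card {b\<in>D. fst b \<le> k} = card {b\<in>D'. fst b \<le> k}"
  shows "D = D'"
proof -
  have row: "card {b\<in>E. fst b = i} = card {b\<in>E. fst b \<le> i} - card {b\<in>E. fst b \<le> i - 1}"
    if "young E" "i \<ge> 1" for E :: "box set" and i
  proof -
    have "card {b\<in>E. fst b = i} = card ({b\<in>E. fst b \<le> i} - {b\<in>E. fst b \<le> i - 1})"
      using that by (intro arg_cong[where f = card]) auto
    also have "\<dots> = card {b\<in>E. fst b \<le> i} - card {b\<in>E. fst b \<le> i - 1}"
      by (rule card_Diff_subset) (use young_finite[OF that(1)] in auto)
    finally show ?thesis .
  qed
  have "(i, j) \<in> D \<longleftrightarrow> (i, j) \<in> D'" for i j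
  proof (cases "i \<ge> 1")
    case True
    then show ?thesis
      using assms(3) by (simp add: young_row_mem[OF assms(1)] young_row_mem[OF assms(2)] row assms(1,2))
  next
    case False
    then show ?thesis using young_pos assms(1,2) by blast
  qed
  then show ?thesis by auto
qed

text \<open>A tableau of shape \<open>D\<close> is encoded by the functions sending an entry to its row and to its
  column; the row function is the tabloid.\<close>

definition ytab :: "box set \<Rightarrow> tabloid \<Rightarrow> (nat \<Rightarrow> nat) \<Rightarrow> bool" where
  "ytab D r c \<longleftrightarrow> bij_betw (\<lambda>m. (r m, c m)) {1..card D} D \<and>
     (\<forall>m. m \<notin> {1..card D} \<longrightarrow> r m = 0 \<and> c m = 0)"

definition tabs :: "box set \<Rightarrow> tabloid set" where
  "tabs D = {r. \<exists>c. ytab D r c}"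

definition col_stab :: "nat \<Rightarrow> (nat \<Rightarrow> nat) \<Rightarrow> (nat \<Rightarrow> nat) set" where
  "col_stab n c = {s \<in> Sym n. c \<circ> s = c}"

text \<open>The condition \<open>t \<circ> s = r\<close> says that \<open>t\<close> is the tabloid \<open>r \<circ> inv s\<close>.\<close>

definition polytab :: "nat \<Rightarrow> tabloid \<Rightarrow> (nat \<Rightarrow> nat) \<Rightarrow> tabloid \<Rightarrow> complex" where
  "polytab n r c = (\<lambda>t. \<Sum>s\<in>col_stab n c. if t \<circ> s = r then of_int (sign s) else 0)"

definition specht :: "box set \<Rightarrow> (tabloid \<Rightarrow> complex) set" where
  "specht D = cfun.span {polytab (card D) r c | r c. ytab D r c}"

lemma ytab_bij: "ytab D r c \<Longrightarrow> bij_betw (\<lambda>m. (r m, c m)) {1..card D} D"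
  by (simp add: ytab_def)

lemma ytab_inj: "ytab D r c \<Longrightarrow> inj_on (\<lambda>m. (r m, c m)) {1..card D}"
  using ytab_bij bij_betw_def by blast

lemma ytab_injD:
  "ytab D r c \<Longrightarrow> r x = r y \<Longrightarrow> c x = c y \<Longrightarrow> x \<in> {1..card D} \<Longrightarrow> y \<in> {1..card D} \<Longrightarrow> x = y"
  using inj_onD[OF ytab_inj, of D r c x y] by simp

lemma ytab_mem: "ytab D r c \<Longrightarrow> m \<in> {1..card D} \<Longrightarrow> (r m, c m) \<in> D"
  using bij_betwE[OF ytab_bij] by blast

lemma ytab_surj:
  assumes "ytab D r c" "(i, j) \<in> D"
  obtains m where "m \<in> {1..card D}" "r m = i" "c m = j"
proof -
  have "(i, j) \<in> (\<lambda>m. (r m, c m)) ` {1..card D}"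
    using bij_betw_imp_surj_on[OF ytab_bij[OF assms(1)]] assms(2) by simp
  then show ?thesis using that by auto
qed

lemma ytab_out: "ytab D r c \<Longrightarrow> m \<notin> {1..card D} \<Longrightarrow> r m = 0 \<and> c m = 0"
  by (simp add: ytab_def)

lemma tabs_mem:
  assumes "t \<in> tabs D" "m \<in> {1..card D}"
  obtains j where "(t m, j) \<in> D"
proof -
  obtain c where "ytab D t c" using assms(1) by (auto simp: tabs_def)
  from ytab_mem[OF this assms(2)] show ?thesis by (rule that)
qed

lemma tabs_pos:
  assumes "young D" "t \<in> tabs D" "m \<in> {1..card D}"
  shows "1 \<le> t m"
proof -
  obtain j where "(t m, j) \<in> D" using tabs_mem[OF assms(2,3)] by blast
  then show ?thesis using young_pos[OF assms(1)] by blast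
qed

lemma ytab_exists: "finite D \<Longrightarrow> \<exists>r c. ytab D r c"
proof -
  assume "finite D"
  then obtain h where h: "bij_betw h {1..card D} D"
    using ex_bij_betw_nat_finite_1 by blast
  let ?r = "\<lambda>m. if m \<in> {1..card D} then fst (h m) else 0"
  let ?c = "\<lambda>m. if m \<in> {1..card D} then snd (h m) else 0"
  have "bij_betw (\<lambda>m. (?r m, ?c m)) {1..card D} D"
    using h by (rule bij_betw_cong[THEN iffD1, rotated]) simp
  then have "ytab D ?r ?c" by (simp add: ytab_def)
  then show ?thesis by blast
qed

lemma ytab_comp:
  assumes "ytab D r c" "s \<in> Sym (card D)"
  shows "ytab D (r \<circ> s) (c \<circ> s)"
proof -
  have s: "s permutes {1..card D}" using assms Sym_permutes by auto
  have "bij_betw ((\<lambda>m. (r m, c m)) \<circ> s) {1..card D} D"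
    using assms permutes_imp_bij[OF s] by (auto simp: ytab_def intro: bij_betw_trans)
  then show ?thesis
    using assms permutes_not_in[OF s] by (auto simp: ytab_def comp_def)
qed

lemma ytab_transitive:
  assumes "ytab D r c" "ytab D r' c'"
  obtains s where "s \<in> Sym (card D)" "r \<circ> s = r'" "c \<circ> s = c'"
proof -
  obtain p where p: "p permutes {1..card D}" "\<forall>x\<in>{1..card D}. (r (p x), c (p x)) = (r' x, c' x)"
    using assms bij_betw_transfer_permutes[of "\<lambda>m. (r m, c m)" _ D "\<lambda>m. (r' m, c' m)"]
    unfolding ytab_def by blast
  have "r (p x) = r' x \<and> c (p x) = c' x" for x
  proof (cases "x \<in> {1..card D}")
    case False
    then show ?thesis
      using assms permutes_not_in[OF p(1)] by (auto simp: ytab_def)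
  qed (use p in auto)
  then show ?thesis using that[of p] p by (auto simp: Sym_def fun_eq_iff)
qed

lemma ytab_fixed_id:
  assumes "ytab D r c" "s \<in> Sym (card D)" "r \<circ> s = r" "c \<circ> s = c"
  shows "s = id"
proof
  fix x
  have s: "s permutes {1..card D}" using assms Sym_permutes by auto
  show "s x = id x"
  proof (cases "x \<in> {1..card D}")
    case True
    then have "s x \<in> {1..card D}" using permutes_in_image[OF s] by blast
    moreover have "r (s x) = r x" "c (s x) = c x" using assms(3,4) by (metis comp_apply)+
    ultimately show ?thesis using ytab_injD[OF assms(1)] True by simp
  qed (simp add: permutes_not_in[OF s])
qed

lemma col_stab_Sym: "s \<in> col_stab n c \<Longrightarrow> s \<in> Sym n"
  by (simp add: col_stab_def)

lemma finite_col_stab [simp]: "finite (col_stab n c)"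
  by (simp add: col_stab_def)

lemma col_stab_id [simp]: "id \<in> col_stab n c"
  by (simp add: col_stab_def)

lemma card_col_stab_nonzero: "card (col_stab n c) \<noteq> 0"
  using col_stab_id[of n c] by (auto simp: card_eq_0_iff simp del: col_stab_id)

lemma col_stab_comp: "s \<in> col_stab n c \<Longrightarrow> s' \<in> col_stab n c \<Longrightarrow> s \<circ> s' \<in> col_stab n c"
  by (auto simp: col_stab_def comp_assoc[symmetric])

lemma col_stab_inv: "s \<in> col_stab n c \<Longrightarrow> inv s \<in> col_stab n c"
  unfolding col_stab_def using Sym_cancel(3) by (metis (mono_tags, lifting) Sym_inv mem_Collect_eq)

lemma sign_comp_Sym: "s \<in> Sym n \<Longrightarrow> s' \<in> Sym n \<Longrightarrow> sign (s \<circ> s') = sign s * sign s'"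
  by (intro sign_compose) (auto simp: Sym_def permutation_permutes)

lemma sign_inv_Sym: "s \<in> Sym n \<Longrightarrow> sign (inv s) = sign s"
  by (intro sign_inverse) (auto simp: Sym_def permutation_permutes)

lemma sum_col_stab_left: "h \<in> col_stab n c \<Longrightarrow> (\<Sum>g\<in>col_stab n c. F (h \<circ> g)) = (\<Sum>g\<in>col_stab n c. F g)"
  by (rule sum.reindex_bij_witness[of _ "\<lambda>g. inv h \<circ> g" "\<lambda>g. h \<circ> g"])
     (auto simp: Sym_cancel[OF col_stab_Sym] col_stab_comp col_stab_inv)

section \<open>The column antisymmetrizer and polytabloids\<close>

definition col_antisym ::
  "nat \<Rightarrow> (nat \<Rightarrow> nat) \<Rightarrow> (tabloid \<Rightarrow> complex) \<Rightarrow> tabloid \<Rightarrow> complex" where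
  "col_antisym n c f = (\<Sum>s\<in>col_stab n c. fun_scale (of_int (sign s)) (perm_act s f))"

lemma col_antisym_apply: "col_antisym n c f t = (\<Sum>s\<in>col_stab n c. of_int (sign s) * f (t \<circ> s))"
  by (simp add: col_antisym_def sum_fun_apply fun_scale_apply perm_act_def)

lemma sign_sq: "of_int (sign s) * (of_int (sign s) :: complex) = 1"
  by (simp add: sign_def)

lemma sum_sign_comp:
  assumes "s \<in> col_stab n c"
  shows "(\<Sum>s'\<in>col_stab n c. of_int (sign s') * F (s \<circ> s')) =
    of_int (sign s) * (\<Sum>s'\<in>col_stab n c. of_int (sign s') * F s' :: complex)"
proof -
  have "(\<Sum>s'\<in>col_stab n c. of_int (sign s') * F s' :: complex) =
    (\<Sum>s'\<in>col_stab n c. of_int (sign (s \<circ> s')) * F (s \<circ> s'))"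
    by (rule sum_col_stab_left[OF assms, symmetric])
  also have "\<dots> = (\<Sum>s'\<in>col_stab n c. of_int (sign s) * (of_int (sign s') * F (s \<circ> s')))"
    by (intro sum.cong refl)
       (simp add: sign_comp_Sym[OF col_stab_Sym[OF assms] col_stab_Sym] mult.assoc)
  also have "\<dots> = of_int (sign s) * (\<Sum>s'\<in>col_stab n c. of_int (sign s') * F (s \<circ> s'))"
    by (simp only: sum_distrib_left)
  finally have *: "(\<Sum>s'\<in>col_stab n c. of_int (sign s') * F s' :: complex) =
    of_int (sign s) * (\<Sum>s'\<in>col_stab n c. of_int (sign s') * F (s \<circ> s'))" .
  show ?thesis unfolding * mult.assoc[symmetric] sign_sq by simp
qed

lemma col_antisym_comp: "s \<in> col_stab n c \<Longrightarrow> col_antisym n c f (t \<circ> s) = of_int (sign s) * col_antisym n c f t"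
  using sum_sign_comp[of s n c "\<lambda>s'. f (t \<circ> s')"] by (simp add: col_antisym_apply comp_assoc)

lemma polytab_apply: "polytab n r c t = (\<Sum>s\<in>col_stab n c. of_int (sign s) * (if t \<circ> s = r then 1 else 0))"
  unfolding polytab_def by (intro sum.cong refl) simp

lemma polytab_comp: "s \<in> col_stab n c \<Longrightarrow> polytab n r c (t \<circ> s) = of_int (sign s) * polytab n r c t"
  using sum_sign_comp[of s n c "\<lambda>s'. if t \<circ> s' = r then 1 else 0"] by (simp add: polytab_apply comp_assoc)

lemma col_antisym_polytab: "col_antisym n c (polytab n r c) = fun_scale (of_nat (card (col_stab n c))) (polytab n r c)"
proof
  fix t
  have "col_antisym n c (polytab n r c) t = (\<Sum>s\<in>col_stab n c. of_int (sign s) * (of_int (sign s) * polytab n r c t))"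
    unfolding col_antisym_apply by (intro sum.cong refl) (simp add: polytab_comp)
  then show "col_antisym n c (polytab n r c) t = fun_scale (of_nat (card (col_stab n c))) (polytab n r c) t"
    by (simp add: mult.assoc[symmetric] sign_sq fun_scale_apply)
qed

text \<open>The transposition of \<open>a\<close> and \<open>b\<close> preserves the columns and
  fixes the tabloid \<open>t\<close>, so the value at \<open>t\<close> equals its own
  negative.\<close>

lemma col_antisym_repeated:
  assumes "a \<in> {1..n}" "b \<in> {1..n}" "a \<noteq> b" "c a = c b" "t a = t b"
  shows "col_antisym n c f t = 0"
proof -
  define s where "s = transpose a b"
  have inv: "h \<circ> s = h" if "h a = h b" for h :: "nat \<Rightarrow> nat"
    using that by (auto simp: s_def fun_eq_iff transpose_def)
  have "s \<in> col_stab n c"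
    using assms inv by (auto simp: col_stab_def Sym_def s_def intro: permutes_swap_id)
  then have "col_antisym n c f t = of_int (sign s) * col_antisym n c f t"
    using col_antisym_comp[of s n c f t] inv[OF assms(5)] by simp
  then show ?thesis using assms(3) by (simp add: s_def sign_swap_id)
qed

text \<open>Conjugation by \<open>s\<close> carries the column stabilizer of one tableau to that of
  the other without changing signs.\<close>

lemma perm_act_polytab:
  assumes "s \<in> Sym n"
  shows "perm_act s (polytab n r c) = polytab n (r \<circ> inv s) (c \<circ> inv s)"
proof
  fix t
  show "perm_act s (polytab n r c) t = polytab n (r \<circ> inv s) (c \<circ> inv s) t"
    unfolding perm_act_def polytab_def
  proof (rule sum.reindex_bij_witness[of _ "\<lambda>g. inv s \<circ> g \<circ> s" "\<lambda>g. s \<circ> g \<circ> inv s"])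
    fix g assume "g \<in> col_stab n c"
    then have g: "g \<in> Sym n" "c \<circ> g = c" by (auto simp: col_stab_def)
    show "inv s \<circ> (s \<circ> g \<circ> inv s) \<circ> s = g" using assms by (simp add: Sym_cancel comp_assoc Sym_inv_o)
    have "c \<circ> inv s \<circ> (s \<circ> g \<circ> inv s) = c \<circ> g \<circ> inv s"
      using assms by (simp add: comp_assoc Sym_cancel)
    then show "s \<circ> g \<circ> inv s \<in> col_stab n (c \<circ> inv s)" using assms g by (simp add: col_stab_def)
    have "t \<circ> (s \<circ> g \<circ> inv s) = r \<circ> inv s \<longleftrightarrow> t \<circ> s \<circ> g = r"
    proof
      assume "t \<circ> (s \<circ> g \<circ> inv s) = r \<circ> inv s"
      then have "t \<circ> (s \<circ> g \<circ> inv s) \<circ> s = r \<circ> inv s \<circ> s" by simp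
      then show "t \<circ> s \<circ> g = r" using assms by (simp add: comp_assoc Sym_inv_o)
    qed (simp add: comp_assoc[symmetric])
    moreover have "sign (s \<circ> g \<circ> inv s) = sign g"
      using assms g by (simp add: sign_comp_Sym[of _ n] sign_inv_Sym)
    ultimately show "(if t \<circ> (s \<circ> g \<circ> inv s) = r \<circ> inv s then of_int (sign (s \<circ> g \<circ> inv s)) else 0)
       = (if t \<circ> s \<circ> g = r then of_int (sign g) else (0 :: complex))" by simp
  next
    fix g assume "g \<in> col_stab n (c \<circ> inv s)"
    then have g: "g \<in> Sym n" "c \<circ> inv s \<circ> g = c \<circ> inv s" by (auto simp: col_stab_def)
    show "s \<circ> (inv s \<circ> g \<circ> s) \<circ> inv s = g" using assms by (simp add: Sym_cancel comp_assoc Sym_inv_o)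
    have "c \<circ> (inv s \<circ> g \<circ> s) = (c \<circ> inv s \<circ> g) \<circ> s" by (simp add: comp_assoc)
    also have "\<dots> = c" using assms g by (simp add: comp_assoc Sym_inv_o)
    finally show "inv s \<circ> g \<circ> s \<in> col_stab n c" using assms g by (simp add: col_stab_def)
  qed
qed

lemma polytab_self:
  assumes "ytab D r c"
  shows "polytab (card D) r c r = 1"
proof -
  have "polytab (card D) r c r = (\<Sum>s\<in>col_stab (card D) c. if s = id then 1 else 0)"
    unfolding polytab_def using ytab_fixed_id[OF assms]
    by (intro sum.cong refl) (auto simp: col_stab_def)
  then show ?thesis by simp
qed

lemma polytab_nonzero:
  assumes "polytab n r c t \<noteq> 0"
  obtains s where "s \<in> col_stab n c" "t = r \<circ> inv s"
proof -
  have "\<exists>s\<in>col_stab n c. t \<circ> s = r"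
  proof (rule ccontr)
    assume "\<not> ?thesis"
    then have "polytab n r c t = 0" unfolding polytab_def by (intro sum.neutral) auto
    then show False using assms by simp
  qed
  then obtain s where s: "s \<in> col_stab n c" "t \<circ> s = r" by blast
  then have "t = r \<circ> inv s" using Sym_cancel(3)[OF col_stab_Sym[OF s(1)], of t] by simp
  then show ?thesis using that s by blast
qed

lemma specht_gen: "ytab D r c \<Longrightarrow> polytab (card D) r c \<in> specht D"
  unfolding specht_def by (rule cfun.span_base) blast

lemma tabs_comp: "t \<in> tabs D \<Longrightarrow> s \<in> Sym (card D) \<Longrightarrow> t \<circ> s \<in> tabs D"
  using ytab_comp unfolding tabs_def by blast

lemma specht_support:
  assumes "f \<in> specht D" "f t \<noteq> 0"
  shows "t \<in> tabs D"
proof (rule ccontr)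
  assume t: "t \<notin> tabs D"
  have "f t = 0"
    using assms(1) unfolding specht_def
  proof (induction rule: cfun.span_induct_alt)
    case base then show ?case by (simp add: zero_fun_apply)
  next
    case (step k x y)
    then obtain r c where x: "x = polytab (card D) r c" "ytab D r c" by blast
    have "x t = 0"
    proof (rule ccontr)
      assume "x t \<noteq> 0"
      then obtain s where "s \<in> col_stab (card D) c" "t = r \<circ> inv s"
        using polytab_nonzero[of "card D" r c t] x(1) by blast
      then show False using t x(2) ytab_comp[OF x(2)] col_stab_Sym Sym_inv unfolding tabs_def by blast
    qed
    then show ?case using step by (simp add: plus_fun_apply fun_scale_apply)
  qed
  then show False using assms by simp
qed

lemma finite_ytab: 
  assumes "finite D" shows "finite {(r, c). ytab D r c}"
proof -
  let ?F = "\<lambda>B. {f :: nat \<Rightarrow> nat. \<forall>x. (x \<in> {1..card D} \<longrightarrow> f x \<in> B) \<and> (x \<notin> {1..card D} \<longrightarrow> f x = 0)}"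
  have "finite (?F (fst ` D) \<times> ?F (snd ` D))"
    using assms by (intro finite_cartesian_product finite_set_of_finite_funs) auto
  moreover have "{(r, c). ytab D r c} \<subseteq> ?F (fst ` D) \<times> ?F (snd ` D)"
  proof (rule subrelI)
    fix r c assume "(r, c) \<in> {(r, c). ytab D r c}"
    then have y: "ytab D r c" by simp
    have "r m \<in> fst ` D" "c m \<in> snd ` D" if "m \<in> {1..card D}" for m
      using imageI[OF ytab_mem[OF y that], of fst] imageI[OF ytab_mem[OF y that], of snd] by simp_all
    then show "(r, c) \<in> ?F (fst ` D) \<times> ?F (snd ` D)" using ytab_out[OF y] by blast
  qed
  ultimately show ?thesis by (rule rev_finite_subset)
qed

lemma sym_mod_specht:
  assumes "finite D"
  shows "sym_mod (card D) (specht D)"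
  unfolding sym_mod_def
proof (intro conjI ballI)
  have "{polytab (card D) r c | r c. ytab D r c} = (\<lambda>(r, c). polytab (card D) r c) ` {(r, c). ytab D r c}"
    by auto
  then have "finite {polytab (card D) r c | r c. ytab D r c}"
    using finite_ytab[OF assms] by simp
  then show "fin_dim (specht D)" unfolding fin_dim_def specht_def by auto
  fix g assume g: "g \<in> Sym (card D)"
  have gen: "perm_act g (polytab (card D) r c) \<in> specht D" if "ytab D r c" for r c
    using specht_gen[OF ytab_comp[OF that Sym_inv[OF g]]] g by (simp add: perm_act_polytab)
  show "perm_act g ` specht D \<subseteq> specht D"
  proof (rule image_subsetI)
    fix v assume "v \<in> specht D"
    then have v: "v \<in> cfun.span {polytab (card D) r c | r c. ytab D r c}" by (simp add: specht_def)
    show "perm_act g v \<in> specht D"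
    proof (rule lin_span_in[OF lin_perm_act _ _ v])
      show "cfun.subspace (specht D)" by (simp add: specht_def)
    qed (use gen in auto)
  qed
qed

lemma intertw_col_antisym:
  assumes "intertw n V W A" "sym_mod n V" "f \<in> V"
  shows "col_antisym n c (A f) = A (col_antisym n c f)"
  using assms unfolding col_antisym_def intertw_def by (simp add: lin_simps[of A] col_stab_Sym)

text \<open>If column \<open>j\<close> of the tableau reaches below row \<open>k\<close>, it fills
  rows 1 to \<open>k\<close> and has at least \<open>k\<close> entries there, whereas
  \<open>t\<close> takes distinct positive values on the column and so has at most \<open>k\<close>
  entries with value up to \<open>k\<close>. Otherwise all entries of the column are counted on the
  right.\<close>

lemma card_column_le:
  assumes "young D" "ytab D r c" "t \<in> tabs D'" "card D = n" "card D' = n" "young D'"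
    "inj_on (\<lambda>m. (t m, c m)) {1..n}"
  shows "card {m\<in>{1..n}. t m \<le> k \<and> c m = j} \<le> card {m\<in>{1..n}. r m \<le> k \<and> c m = j}"
proof (cases "\<forall>m\<in>{1..n}. c m = j \<longrightarrow> r m \<le> k")
  case True
  then show ?thesis by (intro card_mono) auto
next
  case False
  then obtain m0 where m0: "m0 \<in> {1..n}" "c m0 = j" "k < r m0" by auto
  have D: "(r m0, j) \<in> D" using ytab_mem[OF assms(2)] m0 assms(4) by blast
  have "{1..k} \<subseteq> r ` {m\<in>{1..n}. r m \<le> k \<and> c m = j}"
  proof
    fix i assume i: "i \<in> {1..k}"
    then have "(i, j) \<in> D" using young_down[OF assms(1) D] m0 young_pos[OF assms(1) D] by auto
    then obtain m where "m \<in> {1..n}" "r m = i" "c m = j"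
      using ytab_surj[OF assms(2)] assms(4) by blast
    then show "i \<in> r ` {m\<in>{1..n}. r m \<le> k \<and> c m = j}" using i by auto
  qed
  then have "k \<le> card {m\<in>{1..n}. r m \<le> k \<and> c m = j}"
    using surj_card_le[of "{m\<in>{1..n}. r m \<le> k \<and> c m = j}" "{1..k}" r] by simp
  moreover have "card {m\<in>{1..n}. t m \<le> k \<and> c m = j} \<le> card {1..k}"
  proof (rule card_inj_on_le[of t])
    show "inj_on t {m\<in>{1..n}. t m \<le> k \<and> c m = j}"
    proof (rule inj_onI)
      fix x y assume "x \<in> {m\<in>{1..n}. t m \<le> k \<and> c m = j}"
        "y \<in> {m\<in>{1..n}. t m \<le> k \<and> c m = j}" "t x = t y"
      then show "x = y" using inj_onD[OF assms(7), of x y] by simp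
    qed
    have "m \<in> {1..n} \<Longrightarrow> 1 \<le> t m" for m
      using tabs_pos[OF assms(6,3), of m] assms(5) by simp
    then show "t ` {m\<in>{1..n}. t m \<le> k \<and> c m = j} \<subseteq> {1..k}" by auto
  qed simp
  ultimately show ?thesis by simp
qed

lemma card_rows_tabs:
  assumes "t \<in> tabs D"
  shows "card {m\<in>{1..card D}. t m \<le> k} = card {b\<in>D. fst b \<le> k}"
proof -
  obtain c where c: "bij_betw (\<lambda>m. (t m, c m)) {1..card D} D" using assms by (auto simp: tabs_def ytab_def)
  have "(\<lambda>m. (t m, c m)) ` {m\<in>{1..card D}. t m \<le> k} =
      {b\<in>(\<lambda>m. (t m, c m)) ` {1..card D}. fst b \<le> k}" by auto
  also have "(\<lambda>m. (t m, c m)) ` {1..card D} = D" by (rule bij_betw_imp_surj_on[OF c])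
  finally have "bij_betw (\<lambda>m. (t m, c m)) {m\<in>{1..card D}. t m \<le> k} {b\<in>D. fst b \<le> k}"
    by (rule bij_betw_subset[OF c, rotated]) auto
  then show ?thesis by (rule bij_betw_same_card)
qed

lemma card_fibres:
  fixes c :: "nat \<Rightarrow> nat"
  assumes "finite A" "finite J" "c ` A \<subseteq> J"
  shows "card {m\<in>A. P m} = (\<Sum>j\<in>J. card {m\<in>A. P m \<and> c m = j})"
proof -
  have "(\<Sum>j\<in>J. \<Sum>m\<in>{m\<in>{m\<in>A. P m}. c m = j}. 1) = (\<Sum>m\<in>{m\<in>A. P m}. 1::nat)"
    using assms by (intro sum.group) auto
  then show ?thesis by simp
qed

lemma tabs_dominated:
  assumes "young D" "ytab D r c" "t \<in> tabs D'" "card D = n" "card D' = n" "young D'"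
    "inj_on (\<lambda>m. (t m, c m)) {1..n}"
  shows "card {b\<in>D'. fst b \<le> k} \<le> card {b\<in>D. fst b \<le> k}"
proof -
  have r: "r \<in> tabs D" using assms by (auto simp: tabs_def)
  note fib = card_fibres[of "{1..n}" "c ` {1..n}" c, OF finite_atLeastAtMost finite_imageI[OF finite_atLeastAtMost] order_refl]
  have "card {m\<in>{1..n}. t m \<le> k} = (\<Sum>j\<in>c ` {1..n}. card {m\<in>{1..n}. t m \<le> k \<and> c m = j})"
    by (rule fib)
  also have "\<dots> \<le> (\<Sum>j\<in>c ` {1..n}. card {m\<in>{1..n}. r m \<le> k \<and> c m = j})"
    by (rule sum_mono) (rule card_column_le[OF assms])
  also have "\<dots> = card {m\<in>{1..n}. r m \<le> k}" by (rule fib[symmetric])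
  finally show ?thesis
    using card_rows_tabs[OF r] card_rows_tabs[OF assms(3)] assms(4,5) by simp
qed

text \<open>For equal shapes the inequalities of \<open>card_column_le\<close> sum to an equality,
  so each of them is one. With \<open>k\<close> the length of a column this says that
  \<open>t\<close> keeps the entries of the column within its height, hence inside
  \<open>D\<close>.\<close>

lemma tabs_same_shape:
  assumes "young D" "ytab D r c" "t \<in> tabs D" "inj_on (\<lambda>m. (t m, c m)) {1..card D}"
  shows "ytab D t c"
proof -
  let ?n = "card D"
  have r: "r \<in> tabs D" using assms by (auto simp: tabs_def)
  note le = card_column_le[OF assms(1-3) refl refl assms(1,4)]
  have eq: "card {m\<in>{1..?n}. t m \<le> k \<and> c m = j} = card {m\<in>{1..?n}. r m \<le> k \<and> c m = j}"
    if "j \<in> c ` {1..?n}" for k j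
  proof (rule sum_mono_inv[of _ "c ` {1..?n}", OF _ le that])
    show "(\<Sum>j\<in>c ` {1..?n}. card {m\<in>{1..?n}. t m \<le> k \<and> c m = j}) =
      (\<Sum>j\<in>c ` {1..?n}. card {m\<in>{1..?n}. r m \<le> k \<and> c m = j})"
      unfolding card_fibres[of "{1..?n}" "c ` {1..?n}" c, OF finite_atLeastAtMost
          finite_imageI[OF finite_atLeastAtMost] order_refl, symmetric]
      by (rule trans[OF card_rows_tabs[OF assms(3)] card_rows_tabs[OF r, symmetric]])
  qed simp
  have "(t m, c m) \<in> D" if m: "m \<in> {1..?n}" for m
  proof -
    define A where "A = {m'\<in>{1..?n}. c m' = c m}"
    have A: "finite A" "m \<in> A" using m by (auto simp: A_def)
    define k where "k = Max (r ` A)"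
    have k: "\<And>m'. m' \<in> A \<Longrightarrow> r m' \<le> k" using A by (auto simp: k_def)
    have "k \<in> r ` A" unfolding k_def using A by (intro Max_in) auto
    then obtain m' where "m' \<in> A" "r m' = k" by auto
    then have kD: "(k, c m) \<in> D" using ytab_mem[OF assms(2), of m'] by (simp add: A_def)
    have "{m'\<in>{1..?n}. r m' \<le> k \<and> c m' = c m} = A" using k by (auto simp: A_def)
    then have "card {m'\<in>{1..?n}. t m' \<le> k \<and> c m' = c m} = card A" using eq[of "c m" k] m by simp
    then have "{m'\<in>{1..?n}. t m' \<le> k \<and> c m' = c m} = A"
      using A by (intro card_subset_eq) (auto simp: A_def)
    then have "t m \<le> k" using A by auto
    moreover have "1 \<le> t m"
      by (rule tabs_pos[OF assms(1,3) m])
    ultimately show ?thesis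
      using young_down[OF assms(1) kD] young_pos[OF assms(1) kD] by blast
  qed
  then have "(\<lambda>m. (t m, c m)) ` {1..?n} \<subseteq> D" by blast
  moreover have "card ((\<lambda>m. (t m, c m)) ` {1..?n}) = card D"
    using card_image[OF assms(4)] by simp
  ultimately have "(\<lambda>m. (t m, c m)) ` {1..?n} = D"
    using young_finite[OF assms(1)] by (intro card_subset_eq)
  moreover have "\<forall>m. m \<notin> {1..?n} \<longrightarrow> t m = 0 \<and> c m = 0"
    using assms(2,3) by (auto simp: tabs_def ytab_def)
  ultimately show ?thesis using assms(4) by (auto simp: ytab_def bij_betw_def)
qed

lemma col_antisym_nonzero:
  assumes "col_antisym n c f t \<noteq> 0" "f \<in> specht D" "card D = n"
  shows "inj_on (\<lambda>m. (t m, c m)) {1..n}" "t \<in> tabs D"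
proof -
  show "inj_on (\<lambda>m. (t m, c m)) {1..n}"
  proof (rule inj_onI)
    fix a b assume "a \<in> {1..n}" "b \<in> {1..n}" "(t a, c a) = (t b, c b)"
    then show "a = b" using col_antisym_repeated[of a n b c t f] assms(1) by auto
  qed
  have "\<exists>s\<in>col_stab n c. f (t \<circ> s) \<noteq> 0"
  proof (rule ccontr)
    assume "\<not> ?thesis"
    then have "col_antisym n c f t = 0" unfolding col_antisym_apply by (intro sum.neutral) auto
    then show False using assms(1) by simp
  qed
  then obtain s where s: "s \<in> col_stab n c" "f (t \<circ> s) \<noteq> 0" by blast
  then have "t \<circ> s \<in> tabs D" using specht_support assms by blast
  then have "(t \<circ> s) \<circ> inv s \<in> tabs D" using tabs_comp Sym_inv col_stab_Sym s assms by blast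
  then show "t \<in> tabs D" using Sym_cancel(3)[OF col_stab_Sym[OF s(1)]] by simp
qed

text \<open>The column antisymmetrizer \<open>col_antisym n c\<close> acts on the polytabloid as a nonzero scalar, so a homomorphism
  sends the polytabloid into the image of \<open>col_antisym n c\<close>.  That image is supported on tabloids whose rows
  meet each column of the tableau at most once, which forces dominance.\<close>

lemma no_hom_specht:
  assumes "young D" "young D'" "card D = n" "card D' = n"
    "card {b\<in>D. fst b \<le> k} < card {b\<in>D'. fst b \<le> k}"
  shows "no_hom n (specht D) (specht D')"
  unfolding no_hom_def
proof (intro allI impI ballI)
  fix A v assume A: "intertw n (specht D) (specht D') A" and v: "v \<in> specht D"
  have linA: "lin A" using A by (simp add: intertw_def)
  have "A (polytab n r c) = 0" if y: "ytab D r c" for r c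
  proof -
    have p: "polytab n r c \<in> specht D" using specht_gen[OF y] assms by simp
    have Ap: "A (polytab n r c) \<in> specht D'" using A p by (auto simp: intertw_def)
    have "col_antisym n c (A (polytab n r c)) t = 0" for t
    proof (rule ccontr)
      assume "col_antisym n c (A (polytab n r c)) t \<noteq> 0"
      from col_antisym_nonzero[OF this Ap assms(4)]
        tabs_dominated[OF assms(1) y _ assms(3,4,2), of t k]
      show False using assms(5) by simp
    qed
    then have "col_antisym n c (A (polytab n r c)) = 0" by (simp add: fun_eq_iff zero_fun_apply)
    moreover have "sym_mod n (specht D)" using sym_mod_specht[OF young_finite[OF assms(1)]] assms(3) by simp
    ultimately have "A (col_antisym n c (polytab n r c)) = 0" using intertw_col_antisym[OF A _ p, of c] by simp
    then have "fun_scale (of_nat (card (col_stab n c))) (A (polytab n r c)) = 0"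
      using linA by (simp add: col_antisym_polytab lin_simps(2)[of A])
    then show ?thesis by (simp add: card_col_stab_nonzero)
  qed
  moreover have "lin (\<lambda>v :: tabloid \<Rightarrow> complex. 0 :: tabloid \<Rightarrow> complex)" by (rule linI) simp_all
  ultimately show "A v = 0"
    using lin_span_eq[OF linA _ v[unfolded specht_def], of "\<lambda>_. 0"] assms(3) by blast
qed

text \<open>The antisymmetrized image \<open>F\<close> of a polytabloid is supported on the tabloids
  \<open>r \<circ> s\<close> with \<open>s\<close> in the column stabilizer, where its values are
  \<open>F r\<close> up to the sign of \<open>s\<close>; so \<open>F\<close> is a multiple of the
  polytabloid. As the group permutes the polytabloids transitively, the same factor holds on the
  whole module.\<close>

lemma simple_specht:
  assumes "young D" "card D = n"
  shows "simple_mod n (specht D)"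
  unfolding simple_mod_def
proof (intro conjI allI impI)
  show V: "sym_mod n (specht D)" using sym_mod_specht[OF young_finite[OF assms(1)]] assms by simp
  obtain r c where y: "ytab D r c" using ytab_exists[OF young_finite[OF assms(1)]] by blast
  have p: "polytab n r c \<in> specht D" using specht_gen[OF y] assms by simp
  have prr: "polytab n r c r = 1" using polytab_self[OF y] assms(2) by simp
  then have "polytab n r c \<noteq> 0" by (auto simp: zero_fun_apply)
  then show "cfun.dim (specht D) \<noteq> 0" using fin_dim_dim_0[OF sym_mod_fin_dim[OF V]] p by blast
  fix A assume A: "intertw n (specht D) (specht D) A"
  then have linA: "lin A" and Ap: "A (polytab n r c) \<in> specht D" using p by (auto simp: intertw_def)
  define F where "F = col_antisym n c (A (polytab n r c))"
  define N where "N = (of_nat (card (col_stab n c)) :: complex)"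
  have N: "N \<noteq> 0" by (simp add: N_def card_col_stab_nonzero)
  have FA: "F = fun_scale N (A (polytab n r c))"
    using intertw_col_antisym[OF A V p, of c] linA by (simp add: F_def N_def col_antisym_polytab lin_simps(2)[of A])
  have "F = fun_scale (F r) (polytab n r c)"
  proof
    fix t
    show "F t = fun_scale (F r) (polytab n r c) t"
    proof (cases "\<exists>s\<in>col_stab n c. t = r \<circ> s")
      case True
      then show ?thesis using prr by (auto simp: F_def col_antisym_comp polytab_comp fun_scale_apply)
    next
      case False
      have "polytab n r c t = 0"
      proof (rule ccontr)
        assume "polytab n r c t \<noteq> 0"
        then obtain s where "s \<in> col_stab n c" "t = r \<circ> inv s" by (rule polytab_nonzero)
        then show False using False col_stab_inv by blast
      qed
      moreover have "F t = 0"
      proof (rule ccontr)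
        assume "F t \<noteq> 0"
        then have "inj_on (\<lambda>m. (t m, c m)) {1..n}" "t \<in> tabs D"
          unfolding F_def using col_antisym_nonzero[OF _ Ap assms(2), of c t] by simp_all
        then have "ytab D t c" using tabs_same_shape[OF assms(1) y, of t] assms(2) by simp
        then obtain s where "s \<in> Sym (card D)" "r \<circ> s = t" "c \<circ> s = c"
          by (rule ytab_transitive[OF y])
        then show False using False assms(2) by (auto simp: col_stab_def)
      qed
      ultimately show ?thesis by (simp add: fun_scale_apply)
    qed
  qed
  then have "fun_scale N (A (polytab n r c)) = fun_scale N (fun_scale (F r / N) (polytab n r c))"
    using N FA by simp
  then have Apt: "A (polytab n r c) = fun_scale (F r / N) (polytab n r c)"
    using N by (simp only: cfun.scale_cancel_left) simp
  have "A v = fun_scale (F r / N) v" if "v \<in> specht D" for v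
  proof (rule lin_span_eq[OF linA _ that[unfolded specht_def]])
    show "lin (fun_scale (F r / N))"
      by (rule linI) (simp_all add: cfun.scale_right_distrib mult.commute)
    fix b assume "b \<in> {polytab (card D) r c | r c. ytab D r c}"
    then obtain r' c' where b: "b = polytab n r' c'" "ytab D r' c'" using assms(2) by blast
    obtain s where "s \<in> Sym (card D)" and s: "r \<circ> s = r'" "c \<circ> s = c'"
      by (rule ytab_transitive[OF y b(2)])
    then have sn: "s \<in> Sym n" using assms(2) by simp
    have bs: "b = perm_act (inv s) (polytab n r c)" using sn s b(1) by (simp add: perm_act_polytab Sym_inv_inv)
    have "A b = perm_act (inv s) (A (polytab n r c))" unfolding bs using A p sn by (simp add: intertw_def)
    then show "A b = fun_scale (F r / N) b"
      unfolding Apt bs by (simp add: perm_act_simps)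
  qed
  then show "\<exists>s. \<forall>v\<in>specht D. A v = fun_scale s v" by blast
qed

lemma no_hom_specht_distinct:
  assumes "young D" "young D'" "card D = n" "card D' = n" "D \<noteq> D'"
  shows "no_hom n (specht D) (specht D') \<or> no_hom n (specht D') (specht D)"
proof -
  obtain k where "card {b\<in>D. fst b \<le> k} \<noteq> card {b\<in>D'. fst b \<le> k}"
    using young_eqI[OF assms(1,2)] assms(5) by blast
  then consider "card {b\<in>D. fst b \<le> k} < card {b\<in>D'. fst b \<le> k}"
    | "card {b\<in>D'. fst b \<le> k} < card {b\<in>D. fst b \<le> k}" by linarith
  then show ?thesis
    using no_hom_specht[OF assms(1-4)] no_hom_specht[OF assms(2,1,4,3)] by cases blast+
qed

section \<open>Branching of Specht modules\<close>

text \<open>The linear extension of the map that deletes \<open>n\<close> from tabloids having \<open>n\<close> in row \<open>i\<close> and sends the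
  other tabloids to 0.\<close>

definition drop_top :: "nat \<Rightarrow> nat \<Rightarrow> (tabloid \<Rightarrow> complex) \<Rightarrow> tabloid \<Rightarrow> complex" where
  "drop_top n i f = (\<lambda>t. if t n = 0 then f (t(n := i)) else 0)"

lemma lin_drop_top: "lin (drop_top n i)"
  by (rule linI) (auto simp: drop_top_def fun_eq_iff plus_fun_apply fun_scale_apply)

lemma Sym_fixes: "g \<in> Sym m \<Longrightarrow> m < x \<Longrightarrow> g x = x"
  unfolding Sym_def by (auto intro: permutes_not_in)

lemma Sym_eq_fixed_iff: "g \<in> Sym m \<Longrightarrow> g n = n \<Longrightarrow> g x = n \<longleftrightarrow> x = n"
  by (metis Sym_bij bij_is_inj injD)

lemma col_stab_apply: "s \<in> col_stab n c \<Longrightarrow> c (s x) = c x"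
  by (simp add: col_stab_def fun_eq_iff)

lemma col_stabI: "s \<in> Sym n \<Longrightarrow> (\<And>x. c (s x) = c x) \<Longrightarrow> s \<in> col_stab n c"
  by (simp add: col_stab_def fun_eq_iff)

lemma drop_top_perm_act:
  assumes "g \<in> Sym m" "m < n"
  shows "drop_top n i (perm_act g f) = perm_act g (drop_top n i f)"
proof
  fix t :: tabloid
  have g: "g n = n" using assms by (rule Sym_fixes)
  then have "g x = n \<longleftrightarrow> x = n" for x using Sym_eq_fixed_iff[OF assms(1)] by blast
  then have "t(n := i) \<circ> g = (t \<circ> g)(n := i)" by (auto simp: fun_eq_iff)
  then show "drop_top n i (perm_act g f) t = perm_act g (drop_top n i f) t"
    by (simp add: drop_top_def perm_act_def g)
qed

lemma Sym_predI:
  assumes "s \<in> Sym (Suc m)" "s (Suc m) = Suc m"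
  shows "s \<in> Sym m"
proof -
  have "x = Suc m" if "x \<in> {1..Suc m} - {1..m}" for x using that by auto
  then have "s permutes {1..m}"
    using assms by (intro permutes_superset[OF Sym_permutes[OF assms(1)]]) auto
  then show ?thesis by (simp add: Sym_def)
qed

lemma ytab_extend:
  assumes "ytab D' r c" "b \<notin> D'" "finite D'" "D = insert b D'" "n = card D"
  shows "ytab D (r(n := fst b)) (c(n := snd b))"
proof -
  have n: "n = Suc (card D')" using assms by simp
  have "bij_betw (\<lambda>m. ((r(n := fst b)) m, (c(n := snd b)) m)) {1..card D'} D'"
    using ytab_bij[OF assms(1)] by (rule bij_betw_cong[THEN iffD1, rotated]) (simp add: n)
  then have "bij_betw (\<lambda>m. ((r(n := fst b)) m, (c(n := snd b)) m)) ({1..card D'} \<union> {n}) (D' \<union> {b})"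
    using assms(2) by (intro bij_betw_combine) (simp_all add: bij_betw_def)
  moreover have "{1..card D'} \<union> {n} = {1..card D}" using assms(5) n by auto
  ultimately have "bij_betw (\<lambda>m. ((r(n := fst b)) m, (c(n := snd b)) m)) {1..card D} D"
    using assms(4) by simp
  then show ?thesis using ytab_out[OF assms(1)] assms(5) n by (auto simp: ytab_def)
qed

text \<open>A term of the larger polytabloid survives only if the column permutation leaves
  \<open>n\<close> in the row of the box \<open>b\<close>. As it leaves \<open>n\<close> in the
  column of \<open>b\<close> too, it fixes \<open>n\<close>, and what remains is the column
  stabilizer of the smaller tableau.\<close>

lemma drop_top_polytab:
  assumes "ytab D' r c" "b \<notin> D'" "finite D'" "D = insert b D'" "n = card D"
  shows "drop_top n (fst b) (polytab n (r(n := fst b)) (c(n := snd b))) = polytab (card D') r c"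
proof
  fix t
  let ?r = "r(n := fst b)" and ?c = "c(n := snd b)" and ?m = "card D'"
  have n: "n = Suc ?m" using assms by simp
  have rc: "r n = 0" "c n = 0" using ytab_out[OF assms(1), of n] n by auto
  have y: "ytab D ?r ?c" by (rule ytab_extend[OF assms])
  show "drop_top n (fst b) (polytab n ?r ?c) t = polytab ?m r c t"
  proof (cases "t n = 0")
    case False
    \<comment> \<open>Every tabloid in the support of the smaller polytabloid has the default value
      0 at \<open>n\<close>.\<close>
    have "polytab ?m r c t = 0"
    proof (rule ccontr)
      assume "polytab ?m r c t \<noteq> 0"
      then obtain s where s: "s \<in> col_stab ?m c" "t = r \<circ> inv s" by (rule polytab_nonzero)
      then have "inv s n = n" using Sym_fixes[OF Sym_inv[OF col_stab_Sym[OF s(1)]]] n by simp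
      then show False using False s rc by simp
    qed
    then show ?thesis using False by (simp add: drop_top_def)
  next
    case True
    have fix_n: "s n = n" if s: "s \<in> col_stab n ?c" "t(n := fst b) \<circ> s = ?r" for s
    proof -
      have sp: "s permutes {1..card D}" using Sym_permutes[OF col_stab_Sym[OF s(1)]] assms(5) by simp
      define m where "m = inv s n"
      have sm: "s m = n" using permutes_inverses(1)[OF sp] by (simp add: m_def)
      have r: "?r m = ?r n" using fun_cong[OF s(2), of m] sm by simp
      have c: "?c m = ?c n" using col_stab_apply[OF s(1), of m] sm by (simp only:)
      have nD: "n \<in> {1..card D}" using n assms(5) by simp
      then have mD: "m \<in> {1..card D}" using permutes_in_image[OF sp, of m] sm by simp
      have "m = n" by (rule ytab_injD[OF y r c mD nD])
      then show ?thesis using sm by simp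
    qed
    have sub: "col_stab ?m c \<subseteq> col_stab n ?c"
    proof
      fix s assume s: "s \<in> col_stab ?m c"
      have S: "s \<in> Sym ?m" using col_stab_Sym[OF s] .
      have "s n = n" using Sym_fixes[OF S] n by simp
      then have "s x = n \<longleftrightarrow> x = n" for x using Sym_eq_fixed_iff[OF S] by blast
      then have "?c (s x) = ?c x" for x using col_stab_apply[OF s, of x] by simp
      then show "s \<in> col_stab n ?c" using Sym_mono[OF _ S, of n] n by (intro col_stabI) simp_all
    qed
    have eq: "t(n := fst b) \<circ> s = ?r \<longleftrightarrow> t \<circ> s = r" if s: "s \<in> col_stab ?m c" for s
    proof -
      have S: "s \<in> Sym ?m" using col_stab_Sym[OF s] .
      have sn: "s n = n" using Sym_fixes[OF S] n by simp
      have "s x = n \<longleftrightarrow> x = n" for x using Sym_eq_fixed_iff[OF S sn] .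
      then have 1: "t(n := fst b) \<circ> s = (t \<circ> s)(n := fst b)" by (auto simp: fun_eq_iff)
      have 2: "(t \<circ> s) n = r n" using sn True rc by simp
      show ?thesis
      proof
        assume "t(n := fst b) \<circ> s = ?r"
        then have E: "(t \<circ> s)(n := fst b) = r(n := fst b)" using 1 by simp
        show "t \<circ> s = r"
        proof
          fix x show "(t \<circ> s) x = r x" using fun_cong[OF E, of x] 2 by (cases "x = n") simp_all
        qed
      qed (simp add: 1)
    qed
    have "polytab n ?r ?c (t(n := fst b)) =
      (\<Sum>s\<in>col_stab ?m c. if t(n := fst b) \<circ> s = ?r then of_int (sign s) else 0)"
      unfolding polytab_def
    proof (rule sum.mono_neutral_right[OF finite_col_stab sub], rule ballI)
      fix s assume s: "s \<in> col_stab n ?c - col_stab ?m c"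
      have "t(n := fst b) \<circ> s \<noteq> ?r"
      proof
        assume "t(n := fst b) \<circ> s = ?r"
        then have sn: "s n = n" using fix_n s by blast
        have S: "s \<in> Sym n" using s col_stab_Sym by blast
        have Sm: "s \<in> Sym ?m" using Sym_predI S sn n by simp
        have "c (s x) = c x" for x
        proof (cases "x = n")
          case False
          then show ?thesis using col_stab_apply[of s n ?c x] s Sym_eq_fixed_iff[OF S sn, of x] by simp
        qed (simp add: sn)
        then have "s \<in> col_stab ?m c" using Sm by (intro col_stabI)
        then show False using s by simp
      qed
      then show "(if t(n := fst b) \<circ> s = ?r then of_int (sign s) else (0::complex)) = 0" by simp
    qed
    also have "\<dots> = polytab ?m r c t" unfolding polytab_def using eq by (intro sum.cong refl) simp
    finally show ?thesis using True by (simp add: drop_top_def)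
  qed
qed

text \<open>Only an inclusion is claimed here; restricting to the image of \<open>isoproj\<close>
  and comparing dimensions later turns it into an isomorphism.\<close>

lemma specht_drop_top_surj:
  assumes "b \<notin> D'" "finite D'" "D = insert b D'" "n = card D"
  shows "specht D' \<subseteq> drop_top n (fst b) ` specht D"
proof -
  have "cfun.subspace (drop_top n (fst b) ` specht D)"
    by (rule lin_image_subspace[OF lin_drop_top]) (simp add: specht_def)
  moreover have "{polytab (card D') r c | r c. ytab D' r c} \<subseteq> drop_top n (fst b) ` specht D"
  proof
    fix f assume "f \<in> {polytab (card D') r c | r c. ytab D' r c}"
    then obtain r c where f: "f = polytab (card D') r c" "ytab D' r c" by blast
    have "f = drop_top n (fst b) (polytab n (r(n := fst b)) (c(n := snd b)))"
      unfolding f(1) by (rule drop_top_polytab[OF f(2) assms, symmetric])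
    moreover have "polytab n (r(n := fst b)) (c(n := snd b)) \<in> specht D"
      using specht_gen[OF ytab_extend[OF f(2) assms]] assms(4) by simp
    ultimately show "f \<in> drop_top n (fst b) ` specht D" by simp
  qed
  ultimately show ?thesis unfolding specht_def[of D'] by (rule cfun.span_minimal[rotated])
qed

text \<open>The sum \<open>Q\<close> of the \<open>P i\<close> is again idempotent, so its trace is
  the dimension of its image and, by linearity, the sum of the dimensions of the images of the
  \<open>P i\<close>. When this reaches the dimension of \<open>V\<close>, \<open>Q\<close> is the
  identity on \<open>V\<close>.\<close>

lemma orthogonal_idempotents:
  assumes "fin_dim V" "finite I" and P: "\<And>i. i \<in> I \<Longrightarrow> lin (P i)" "\<And>i v. i \<in> I \<Longrightarrow> v \<in> V \<Longrightarrow> P i v \<in> V"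
    and idem: "\<And>i v. i \<in> I \<Longrightarrow> v \<in> V \<Longrightarrow> P i (P i v) = P i v"
    and orth: "\<And>i j v. i \<in> I \<Longrightarrow> j \<in> I \<Longrightarrow> i \<noteq> j \<Longrightarrow> v \<in> V \<Longrightarrow> P i (P j v) = 0"
  shows "(\<Sum>i\<in>I. cfun.dim (P i ` V)) \<le> cfun.dim V"
    and "(\<Sum>i\<in>I. cfun.dim (P i ` V)) = cfun.dim V \<Longrightarrow> v \<in> V \<Longrightarrow> (\<Sum>i\<in>I. P i v) = v"
proof -
  define Q where "Q = (\<lambda>v. \<Sum>i\<in>I. P i v)"
  have linQ: "lin Q"
    using lin_sum_scale[of I P "\<lambda>_. 1"] P(1) by (simp add: Q_def)
  have QV: "Q v \<in> V" if "v \<in> V" for v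
    unfolding Q_def using that by (intro cfun.subspace_sum fin_dim_subspace[OF assms(1)] P(2))
  have QQ: "Q (Q v) = Q v" if "v \<in> V" for v
  proof -
    have "P i (Q v) = P i v" if i: "i \<in> I" for i
    proof -
      have "P i (Q v) = (\<Sum>j\<in>I. P i (P j v))" unfolding Q_def by (rule lin_simps(5)[OF P(1)[OF i]])
      also have "\<dots> = (\<Sum>j\<in>I. if j = i then P i v else 0)"
        using i \<open>v \<in> V\<close> by (intro sum.cong refl) (auto simp: idem orth)
      finally show ?thesis using i assms(2) by simp
    qed
    then have "(\<Sum>i\<in>I. P i (Q v)) = (\<Sum>i\<in>I. P i v)" by (intro sum.cong refl)
    then show ?thesis unfolding Q_def .
  qed
  have QV': "Q ` V \<subseteq> V" using QV by blast
  have sub: "cfun.subspace (Q ` V)" by (rule lin_image_subspace[OF linQ fin_dim_subspace[OF assms(1)]])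
  have "of_nat (cfun.dim (Q ` V)) = trace_on V Q"
    using trace_idempotent[OF assms(1) linQ QV' QQ] by simp
  also have "\<dots> = (\<Sum>i\<in>I. trace_on V (P i))"
    unfolding Q_def by (rule trace_sum[OF assms(1) P(2)])
  also have "\<dots> = (\<Sum>i\<in>I. of_nat (cfun.dim (P i ` V)))"
    using P(2) by (intro sum.cong refl trace_idempotent[OF assms(1) P(1) _ idem]) blast+
  finally have "(of_nat (cfun.dim (Q ` V)) :: complex) = of_nat (\<Sum>i\<in>I. cfun.dim (P i ` V))"
    by simp
  then have eq: "cfun.dim (Q ` V) = (\<Sum>i\<in>I. cfun.dim (P i ` V))" by (simp only: of_nat_eq_iff)
  then show "(\<Sum>i\<in>I. cfun.dim (P i ` V)) \<le> cfun.dim V"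
    using fin_dim_dim_mono[OF assms(1) sub QV'] by simp
  assume "(\<Sum>i\<in>I. cfun.dim (P i ` V)) = cfun.dim V" and v: "v \<in> V"
  then have "Q ` V = V" using fin_dim_dim_eq[OF assms(1) sub QV'] eq by simp
  then have "v \<in> Q ` V" using v by simp
  then obtain w where w: "w \<in> V" "v = Q w" by blast
  then have "Q v = v" using QQ by simp
  then show "(\<Sum>i\<in>I. P i v) = v" by (simp add: Q_def)
qed

section \<open>Young's lattice and the dimensions of the Specht modules\<close>

definition young_cover :: "box set \<Rightarrow> box set \<Rightarrow> bool" where
  "young_cover E D \<longleftrightarrow> young E \<and> young D \<and> E \<subseteq> D \<and> card D = Suc (card E)"

definition youngs :: "nat \<Rightarrow> box set set" where
  "youngs n = {D. young D \<and> card D = n}"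

definition sdim :: "box set \<Rightarrow> nat" where
  "sdim D = cfun.dim (specht D)"

lemma young_coverE:
  assumes "young_cover E D"
  obtains b where "b \<notin> E" "D = insert b E" "finite E" "young E" "young D" "card D = Suc (card E)"
proof -
  have f: "finite D" "finite E" using assms young_finite unfolding young_cover_def by blast+
  then have "card (D - E) = 1" using assms by (simp add: young_cover_def card_Diff_subset)
  then obtain b where b: "D - E = {b}" by (auto simp: card_1_singleton_iff)
  moreover have "E \<subseteq> D" using assms by (simp add: young_cover_def)
  ultimately have "b \<notin> E" "D = insert b E" by auto
  then show ?thesis using that assms f by (simp add: young_cover_def)
qed

lemma youngs_bounded:
  assumes "D \<in> youngs n"
  shows "D \<subseteq> {1..n} \<times> {1..n}"
proof (rule subrelI)
  fix i j assume ij: "(i, j) \<in> D"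
  have y: "young D" "card D = n" using assms by (auto simp: youngs_def)
  have p: "1 \<le> i" "1 \<le> j" using young_pos[OF y(1) ij] by auto
  have "(\<lambda>i'. (i', j)) ` {1..i} \<subseteq> D" using young_down[OF y(1) ij] p by auto
  from card_mono[OF young_finite[OF y(1)] this] have "i \<le> n"
    using y(2) by (simp add: card_image inj_on_def)
  have "(\<lambda>j'. (i, j')) ` {1..j} \<subseteq> D" using young_down[OF y(1) ij] p by auto
  from card_mono[OF young_finite[OF y(1)] this] have "j \<le> n"
    using y(2) by (simp add: card_image inj_on_def)
  then show "(i, j) \<in> {1..n} \<times> {1..n}" using p \<open>i \<le> n\<close> by simp
qed

lemma finite_youngs [simp]: "finite (youngs n)"
proof (rule finite_subset)
  show "youngs n \<subseteq> Pow ({1..n} \<times> {1..n})" using youngs_bounded by blast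
qed simp

lemma sdim_pos: "young D \<Longrightarrow> 0 < sdim D"
  using simple_specht[of D "card D"] by (simp add: simple_mod_def sdim_def)

text \<open>Deleting the largest entry commutes with S(n-1), hence with \<open>isoproj\<close>. As
  \<open>isoproj\<close> is the identity on the target, every preimage may be replaced by its
  projection.\<close>

lemma sdim_le_image:
  assumes "young_cover E D" "n = card D"
  shows "sdim E \<le> cfun.dim (isoproj (n - 1) (specht E) ` specht D)"
proof -
  obtain b where b: "b \<notin> E" "D = insert b E" "finite E" "young E" "young D" "card D = Suc (card E)"
    using assms(1) by (rule young_coverE)
  let ?P = "isoproj (n - 1) (specht E)"
  have m: "n - 1 = card E" "n = Suc (card E)" using b assms(2) by auto
  have s: "simple_mod (n - 1) (specht E)" using simple_specht[OF b(4)] m by simp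
  have V: "fin_dim (specht D)" using sym_mod_fin_dim[OF sym_mod_specht[OF young_finite[OF b(5)]]] .
  have "specht E \<subseteq> drop_top n (fst b) ` ?P ` specht D"
  proof
    fix w assume w: "w \<in> specht E"
    then obtain v where v: "v \<in> specht D" "w = drop_top n (fst b) v"
      using specht_drop_top_surj[OF b(1,3,2) assms(2)] by blast
    have "w = ?P w" using isoproj_self[OF s w] by simp
    also have "\<dots> = drop_top n (fst b) (?P v)"
      unfolding v(2) using m
      by (intro isoproj_commute[symmetric] lin_drop_top drop_top_perm_act[of _ "n - 1"]) auto
    finally show "w \<in> drop_top n (fst b) ` ?P ` specht D" using v(1) by blast
  qed
  moreover have "cfun.subspace (specht E)" by (simp add: specht_def)
  ultimately show ?thesis
    unfolding sdim_def using dim_le_of_surj[OF fin_dim_image[OF lin_isoproj V] _ lin_drop_top] by blast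
qed

lemma isoproj_specht_family:
  assumes "sym_mod m V" "I \<subseteq> youngs m"
  shows "(\<Sum>E\<in>I. cfun.dim (isoproj m (specht E) ` V)) \<le> cfun.dim V"
    and "(\<Sum>E\<in>I. cfun.dim (isoproj m (specht E) ` V)) = cfun.dim V \<Longrightarrow> v \<in> V \<Longrightarrow>
      (\<Sum>E\<in>I. isoproj m (specht E) v) = v"
proof -
  have fin: "finite I" using assms(2) finite_youngs finite_subset by blast
  have s: "simple_mod m (specht E)" if "E \<in> I" for E
    using that assms(2) simple_specht by (auto simp: youngs_def)
  have o: "isoproj m (specht E) (isoproj m (specht F) v) = 0" if "E \<in> I" "F \<in> I" "E \<noteq> F" for E F v
    using that assms(2) no_hom_specht_distinct[of E F m]
    by (intro isoproj_orthogonal s) (auto simp: youngs_def)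
  note fam = orthogonal_idempotents[OF sym_mod_fin_dim[OF assms(1)] fin lin_isoproj isoproj_in[OF assms(1)] isoproj_idem[OF s] o]
  show "(\<Sum>E\<in>I. cfun.dim (isoproj m (specht E) ` V)) \<le> cfun.dim V" by (rule fam(1))
  show "(\<Sum>E\<in>I. cfun.dim (isoproj m (specht E) ` V)) = cfun.dim V \<Longrightarrow> v \<in> V \<Longrightarrow>
      (\<Sum>E\<in>I. isoproj m (specht E) v) = v" by (rule fam(2))
qed

lemma sum_sdim_down_le:
  assumes "young D"
  shows "(\<Sum>E | young_cover E D. sdim E) \<le> sdim D"
proof -
  let ?n = "card D"
  have I: "{E. young_cover E D} \<subseteq> youngs (?n - 1)" by (auto simp: young_cover_def youngs_def)
  have "sym_mod (?n - 1) (specht D)" using sym_mod_mono[OF _ sym_mod_specht[OF young_finite[OF assms]]] by simp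
  then have "(\<Sum>E | young_cover E D. cfun.dim (isoproj (?n - 1) (specht E) ` specht D)) \<le> cfun.dim (specht D)"
    using isoproj_specht_family(1) I by blast
  moreover have "(\<Sum>E | young_cover E D. sdim E) \<le> (\<Sum>E | young_cover E D. cfun.dim (isoproj (?n - 1) (specht E) ` specht D))"
    using sdim_le_image by (intro sum_mono) blast
  ultimately show ?thesis by (simp add: sdim_def)
qed

definition row_len :: "box set \<Rightarrow> nat \<Rightarrow> nat" where
  "row_len D i = card {b\<in>D. fst b = i}"

lemma mem_row_len: "young D \<Longrightarrow> (i, j) \<in> D \<longleftrightarrow> 1 \<le> j \<and> j \<le> row_len D i"
  unfolding row_len_def by (rule young_row_mem)

lemma youngI:
  assumes "finite D" "\<And>i j. (i, j) \<in> D \<Longrightarrow> 1 \<le> i \<and> 1 \<le> j"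
    "\<And>i j i' j'. (i, j) \<in> D \<Longrightarrow> 1 \<le> i' \<Longrightarrow> i' \<le> i \<Longrightarrow> 1 \<le> j' \<Longrightarrow> j' \<le> j \<Longrightarrow> (i', j') \<in> D"
  shows "young D"
  unfolding young_def using assms by blast

lemma young_coverI:
  assumes "young E" "young D" "b \<notin> E" "D = insert b E"
  shows "young_cover E D"
  using assms young_finite[OF assms(1)] by (auto simp: young_cover_def)

lemma row_len_antimono:
  assumes "young D" "1 \<le> i" "i \<le> i'"
  shows "row_len D i' \<le> row_len D i"
proof (cases "row_len D i' = 0")
  case False
  then have "(i', row_len D i') \<in> D" using mem_row_len[OF assms(1)] by simp
  then have "(i, row_len D i') \<in> D" using young_down[OF assms(1)] assms False by simp
  then show ?thesis using mem_row_len[OF assms(1)] by simp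
qed simp

lemma up_eq:
  assumes E: "young E"
  shows "{D. young_cover E D} = (\<lambda>i. insert (i, Suc (row_len E i)) E) `
    {i. 1 \<le> i \<and> (i = 1 \<or> row_len E i < row_len E (i - 1))}" (is "_ = ?f ` ?A")
proof (intro equalityI subsetI)
  fix D assume "D \<in> {D. young_cover E D}"
  then obtain b where b: "b \<notin> E" "D = insert b E" "young D" by (auto elim: young_coverE)
  obtain i j where ij: "b = (i, j)" by (cases b)
  have D: "(i, j) \<in> D" using b ij by simp
  have pos: "1 \<le> i" "1 \<le> j" using young_pos[OF b(3) D] by auto
  have "row_len E i < j" using b(1) ij pos mem_row_len[OF E] by auto
  moreover have "j \<le> Suc (row_len E i)"
  proof (cases "j = 1")
    case False
    then have "(i, j - 1) \<in> D" using young_down[OF b(3) D] pos by simp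
    moreover have "j - 1 \<noteq> j" using pos by simp
    ultimately have "(i, j - 1) \<in> E" using b(2) ij by simp
    then show ?thesis using mem_row_len[OF E] by auto
  qed simp
  ultimately have j: "j = Suc (row_len E i)" by simp
  have "i = 1 \<or> row_len E i < row_len E (i - 1)"
  proof (cases "i = 1")
    case False
    then have "(i - 1, j) \<in> D" using young_down[OF b(3) D] pos by simp
    moreover have "i - 1 \<noteq> i" using pos by simp
    ultimately have "(i - 1, j) \<in> E" using b(2) ij by simp
    then show ?thesis using mem_row_len[OF E] j by auto
  qed simp
  then show "D \<in> ?f ` ?A" using b(2) ij j pos by blast
next
  fix D assume "D \<in> ?f ` ?A"
  then obtain i where i: "1 \<le> i" "i = 1 \<or> row_len E i < row_len E (i - 1)" and D: "D = ?f i" by blast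
  have "young D"
  proof (rule youngI)
    show "finite D" using D young_finite[OF E] by simp
    show "1 \<le> a \<and> 1 \<le> b" if "(a, b) \<in> D" for a b
      using that D i(1) young_pos[OF E] by auto
    fix a b a' b' assume ab: "(a, b) \<in> D" "1 \<le> a'" "a' \<le> a" "1 \<le> b'" "b' \<le> b"
    show "(a', b') \<in> D"
    proof (cases "(a, b) \<in> E")
      case True
      then show ?thesis using young_down[OF E True] ab D by simp
    next
      case False
      then have ab': "a = i" "b = Suc (row_len E i)" using ab D by auto
      show ?thesis
      proof (cases "a' = i")
        case True
        then show ?thesis using ab ab' D mem_row_len[OF E, of i b'] by auto
      next
        case False
        then have "a' \<le> i - 1" "i \<noteq> 1" using ab ab' by auto
        then have "(i - 1, Suc (row_len E i)) \<in> E" using i mem_row_len[OF E] by auto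
        then show ?thesis using young_down[OF E] ab ab' \<open>a' \<le> i - 1\<close> D by blast
      qed
    qed
  qed
  then show "D \<in> {D. young_cover E D}" using young_coverI[OF E _ _ D] mem_row_len[OF E] by simp
qed

lemma down_eq:
  assumes D: "young D"
  shows "{E. young_cover E D} = (\<lambda>i. D - {(i, row_len D i)}) `
    {i. 1 \<le> i \<and> row_len D (Suc i) < row_len D i}" (is "_ = ?f ` ?A")
proof (intro equalityI subsetI)
  fix E assume "E \<in> {E. young_cover E D}"
  then obtain b where b: "b \<notin> E" "D = insert b E" "young E" by (auto elim: young_coverE)
  obtain i j where ij: "b = (i, j)" by (cases b)
  have bD: "(i, j) \<in> D" using b ij by simp
  have pos: "1 \<le> i" "1 \<le> j" using young_pos[OF D bD] by auto
  have notE: "(i, j) \<notin> E" using b ij by simp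
  have "j \<le> row_len D i" using bD mem_row_len[OF D] by simp
  moreover have "\<not> j < row_len D i"
  proof
    assume less: "j < row_len D i"
    then have "(i, row_len D i) \<in> D" using mem_row_len[OF D] by simp
    then have "(i, row_len D i) \<in> E" using b(2) ij less by simp
    then show False using young_down[OF b(3)] pos less notE by simp
  qed
  ultimately have j: "j = row_len D i" by simp
  have "row_len D (Suc i) < row_len D i"
  proof (rule ccontr)
    assume "\<not> ?thesis"
    then have "(Suc i, j) \<in> D" using mem_row_len[OF D] j pos by simp
    then have "(Suc i, j) \<in> E" using b(2) ij by simp
    then show False using young_down[OF b(3)] pos notE by simp
  qed
  moreover have "E = D - {(i, row_len D i)}" unfolding j[symmetric] using b(1,2) ij by auto
  ultimately show "E \<in> ?f ` ?A" using pos by blast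
next
  fix E assume "E \<in> ?f ` ?A"
  then obtain i where i: "1 \<le> i" "row_len D (Suc i) < row_len D i" and E: "E = ?f i" by blast
  have iD: "(i, row_len D i) \<in> D" using mem_row_len[OF D] i by simp
  have "young E"
  proof (rule youngI)
    show "finite E" using E young_finite[OF D] by simp
    show "1 \<le> a \<and> 1 \<le> b" if "(a, b) \<in> E" for a b
      using that E young_pos[OF D] by auto
    fix a b a' b' assume ab: "(a, b) \<in> E" "1 \<le> a'" "a' \<le> a" "1 \<le> b'" "b' \<le> b"
    have abD: "(a, b) \<in> D" "(a, b) \<noteq> (i, row_len D i)" using ab E by auto
    have "(a', b') \<in> D" using young_down[OF D abD(1)] ab by simp
    moreover have "(a', b') \<noteq> (i, row_len D i)"
    proof
      assume "(a', b') = (i, row_len D i)"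
      then have le: "i \<le> a" "row_len D i \<le> b" using ab by auto
      have b: "1 \<le> b" "b \<le> row_len D a" using abD(1) mem_row_len[OF D] by auto
      show False
      proof (cases "a = i")
        case True
        then show False using le b abD(2) by simp
      next
        case False
        then have "row_len D a \<le> row_len D (Suc i)" using le row_len_antimono[OF D] by simp
        then show False using le b i by simp
      qed
    qed
    ultimately show "(a', b') \<in> E" using E by simp
  qed
  then show "E \<in> {E. young_cover E D}"
    using young_coverI[of E D "(i, row_len D i)"] D E iD by (simp add: insert_absorb)
qed

text \<open>Row \<open>i\<close> can lose its last box exactly when row \<open>Suc i\<close> is
  shorter, which is also when row \<open>Suc i\<close> can be lengthened. The shift
  \<open>Suc\<close> thus matches removable boxes with addable ones outside row 1, and row 1 can
  always be lengthened.\<close>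

lemma card_up_eq_Suc_card_down:
  assumes "young D"
  shows "card {E. young_cover D E} = Suc (card {E. young_cover E D})"
proof -
  let ?A = "{i. 1 \<le> i \<and> (i = 1 \<or> row_len D i < row_len D (i - 1))}"
  let ?R = "{i. 1 \<le> i \<and> row_len D (Suc i) < row_len D i}"
  have "?R \<subseteq> fst ` D"
  proof
    fix i assume "i \<in> ?R"
    then have "(i, row_len D i) \<in> D" using mem_row_len[OF assms] by simp
    then show "i \<in> fst ` D" by (rule image_eqI[rotated]) simp
  qed
  then have finR: "finite ?R" using young_finite[OF assms] finite_subset by blast
  have AR: "?A = insert 1 (Suc ` ?R)"
  proof (intro equalityI subsetI)
    fix i assume i: "i \<in> ?A"
    show "i \<in> insert 1 (Suc ` ?R)"
    proof (cases "i = 1")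
      case False
      then have "i - 1 \<in> ?R" "i = Suc (i - 1)" using i by auto
      then show ?thesis by blast
    qed simp
  qed auto
  have "card ?A = Suc (card ?R)" unfolding AR using finR by (subst card_insert_disjoint) (auto simp: card_image)
  moreover have "card {E. young_cover D E} = card ?A"
    unfolding up_eq[OF assms]
  proof (rule card_image, rule inj_onI)
    fix i i' assume eq: "insert (i, Suc (row_len D i)) D = insert (i', Suc (row_len D i')) D"
    have "(i, Suc (row_len D i)) \<notin> D" using mem_row_len[OF assms] by simp
    then show "i = i'" using eq by blast
  qed
  moreover have "card {E. young_cover E D} = card ?R"
    unfolding down_eq[OF assms]
  proof (rule card_image, rule inj_onI)
    fix i i' assume i: "i \<in> ?R" and eq: "D - {(i, row_len D i)} = D - {(i', row_len D i')}"
    have "(i, row_len D i) \<in> D" using mem_row_len[OF assms] i by simp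
    then show "i = i'" using eq by blast
  qed
  ultimately show ?thesis by simp
qed

lemma young_Un: "young D \<Longrightarrow> young E \<Longrightarrow> young (D \<union> E)"
  by (rule youngI) (auto simp: young_finite dest: young_pos intro: young_down)

lemma young_Int: "young D \<Longrightarrow> young E \<Longrightarrow> young (D \<inter> E)"
  by (rule youngI) (auto simp: young_finite dest: young_pos intro: young_down)

text \<open>A common upper neighbour can only be the union, a common lower neighbour only the
  intersection. Their cardinalities add up to \<open>card D + card E\<close>, so either both are
  neighbours or neither is.\<close>

lemma card_up_up_eq_card_down_down:
  assumes "young D" "young E" "card D = card E" "D \<noteq> E"
  shows "card {F. young_cover D F \<and> young_cover E F} = card {F. young_cover F D \<and> young_cover F E}"
proof -
  have fin: "finite D" "finite E" using assms young_finite by auto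
  have nsub: "\<not> D \<subseteq> E" "\<not> E \<subseteq> D" using assms card_subset_eq fin by metis+
  have cu: "card (D \<union> E) + card (D \<inter> E) = card D + card E" using card_Un_Int[OF fin] by simp
  have gt: "card D < card (D \<union> E)" using nsub fin by (intro psubset_card_mono) auto
  have lt: "card (D \<inter> E) < card D" using nsub fin by (intro psubset_card_mono) auto
  have up: "F = D \<union> E" if "young_cover D F" "young_cover E F" for F
  proof -
    have "D \<union> E \<subseteq> F" "finite F" "card F = Suc (card D)" using that young_finite by (auto simp: young_cover_def)
    then have "card (D \<union> E) = card F" using gt card_mono[of F "D \<union> E"] by simp
    then show ?thesis using card_subset_eq \<open>D \<union> E \<subseteq> F\<close> \<open>finite F\<close> by blast
  qed
  have down: "F = D \<inter> E" if "young_cover F D" "young_cover F E" for F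
  proof -
    have "F \<subseteq> D \<inter> E" "card D = Suc (card F)" using that by (auto simp: young_cover_def)
    then have "card F = card (D \<inter> E)" using lt card_mono[of "D \<inter> E" F] fin by simp
    then show ?thesis using card_subset_eq[of "D \<inter> E" F] \<open>F \<subseteq> D \<inter> E\<close> fin by simp
  qed
  show ?thesis
  proof (cases "card (D \<union> E) = Suc (card D)")
    case True
    then have "young_cover D (D \<union> E) \<and> young_cover E (D \<union> E)" "young_cover (D \<inter> E) D \<and> young_cover (D \<inter> E) E"
      using assms cu young_Un young_Int by (auto simp: young_cover_def)
    then have "{F. young_cover D F \<and> young_cover E F} = {D \<union> E}" "{F. young_cover F D \<and> young_cover F E} = {D \<inter> E}"
      using up down by blast+
    then show ?thesis by simp
  next
    case False
    then have "\<not> young_cover D (D \<union> E)" "\<not> young_cover (D \<inter> E) D"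
      using assms cu by (auto simp: young_cover_def)
    then have "{F. young_cover D F \<and> young_cover E F} = {}" "{F. young_cover F D \<and> young_cover F E} = {}"
      using up down by blast+
    then show ?thesis by (simp only:)
  qed
qed

text \<open>Permutations have the same type as tabloids, so the regular representation fits into the
  same function space, with \<open>perm_act\<close> acting by translation.\<close>

definition regular :: "nat \<Rightarrow> (tabloid \<Rightarrow> complex) set" where
  "regular n = cfun.span (basis_vector ` Sym n)"

lemma inj_basis_vector: "inj basis_vector"
  by (rule injI) (auto simp: basis_vector_def fun_eq_iff split: if_splits)

lemma independent_basis_vector: "finite A \<Longrightarrow> cfun.independent (basis_vector ` A)"
proof (rule cfun.independent_if_scalars_zero)
  fix f x assume fin: "finite A" and sum: "(\<Sum>x\<in>basis_vector ` A. fun_scale (f x) x) = 0"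
    and "x \<in> basis_vector ` A"
  then obtain a where a: "a \<in> A" "x = basis_vector a" by blast
  have "(\<Sum>x\<in>basis_vector ` A. fun_scale (f x) x) a = (\<Sum>b\<in>A. fun_scale (f (basis_vector b)) (basis_vector b) a)"
    by (simp add: sum_fun_apply sum.reindex[OF inj_on_subset[OF inj_basis_vector]])
  also have "\<dots> = (\<Sum>b\<in>A. if b = a then f x else 0)"
    by (intro sum.cong refl) (auto simp: fun_scale_apply basis_vector_def a(2))
  finally show "f x = 0" using fin a sum by (simp add: zero_fun_apply)
qed simp

lemma perm_act_basis_vector: "s \<in> Sym n \<Longrightarrow> perm_act s (basis_vector t) = basis_vector (t \<circ> inv s)"
proof
  fix x assume s: "s \<in> Sym n"
  have "x \<circ> s = t \<longleftrightarrow> x = t \<circ> inv s" using Sym_cancel[OF s, of x] Sym_cancel[OF s, of t] by metis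
  then show "perm_act s (basis_vector t) x = basis_vector (t \<circ> inv s) x"
    by (simp add: perm_act_def basis_vector_def)
qed

lemma sym_mod_regular: "sym_mod n (regular n)"
  unfolding sym_mod_def
proof (intro conjI ballI)
  show "fin_dim (regular n)" unfolding fin_dim_def regular_def
    by (intro conjI cfun.subspace_span exI[of _ "basis_vector ` Sym n"] order_refl
        finite_imageI finite_Sym)
  fix g assume g: "g \<in> Sym n"
  show "perm_act g ` regular n \<subseteq> regular n"
  proof (rule image_subsetI)
    fix v assume v: "v \<in> regular n"
    show "perm_act g v \<in> regular n"
    proof (rule lin_span_in[OF lin_perm_act _ _ v[unfolded regular_def]])
      show "cfun.subspace (regular n)" by (simp add: regular_def)
      show "perm_act g b \<in> regular n" if "b \<in> basis_vector ` Sym n" for b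
        using that g by (auto simp: perm_act_basis_vector regular_def intro!: cfun.span_base imageI)
    qed
  qed
qed

lemma dim_regular: "cfun.dim (regular n) = fact n"
  unfolding regular_def
  using cfun.dim_span_eq_card_independent[OF independent_basis_vector[OF finite_Sym]]
  by (simp add: card_image inj_on_subset[OF inj_basis_vector] card_Sym)

lemma character_regular:
  assumes "g \<in> Sym n"
  shows "character (regular n) g = (if g = id then fact n else 0)"
proof (cases "g = id")
  case True
  then show ?thesis using character_id[OF sym_mod_regular] dim_regular by simp
next
  case False
  let ?B = "basis_vector ` Sym n :: (tabloid \<Rightarrow> complex) set"
  have ind: "cfun.independent ?B" by (rule independent_basis_vector) simp
  have "character (regular n) g = (\<Sum>b\<in>?B. coord ?B (perm_act g b) b)"
    using sym_mod_act_image[OF sym_mod_regular assms] sym_mod_fin_dim[OF sym_mod_regular]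
    by (intro trace_basis lin_perm_act ind) (auto simp: regular_def)
  also have "\<dots> = 0"
  proof (rule sum.neutral, rule ballI)
    fix b assume "b \<in> ?B"
    then obtain t where t: "t \<in> Sym n" "b = basis_vector t" by blast
    have "t \<circ> inv g \<noteq> t"
    proof
      assume "t \<circ> inv g = t"
      then have "inv t \<circ> (t \<circ> inv g) = inv t \<circ> t" by simp
      then have "inv g = id" using Sym_cancel(2)[OF t(1)] Sym_inv_o[OF t(1)] by simp
      then have "inv (inv g) = id" by simp
      then show False using False Sym_inv_inv[OF assms] by simp
    qed
    then have "basis_vector (t \<circ> inv g) \<noteq> (basis_vector t :: tabloid \<Rightarrow> complex)"
      by (simp add: inj_eq[OF inj_basis_vector])
    moreover have "perm_act g b = basis_vector (t \<circ> inv g)" using perm_act_basis_vector[OF assms] t by simp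
    moreover have "basis_vector (t \<circ> inv g) \<in> ?B" using t assms by simp
    ultimately show "coord ?B (perm_act g b) b = 0"
      using cfun.representation_basis[OF ind] t(2) by simp
  qed
  finally show ?thesis using False by simp
qed

text \<open>The regular character is concentrated at the identity, so the trace of the projection
  for \<open>D\<close> on the regular representation is the square of \<open>sdim D\<close>; the
  images for different \<open>D\<close> are independent in a space of dimension
  \<open>fact n\<close>.\<close>

lemma sum_sdim_sq_le: "(\<Sum>D\<in>youngs n. sdim D * sdim D) \<le> fact n"
proof -
  have "sdim D * sdim D = cfun.dim (isoproj n (specht D) ` regular n)" if D: "D \<in> youngs n" for D
  proof -
    have s: "simple_mod n (specht D)" using D simple_specht by (simp add: youngs_def)
    then have S: "sym_mod n (specht D)" by (simp add: simple_mod_def)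
    have "of_nat (cfun.dim (isoproj n (specht D) ` regular n)) = trace_on (regular n) (isoproj n (specht D))"
      using isoproj_in[OF sym_mod_regular] isoproj_idem[OF s]
      by (intro trace_idempotent[symmetric] sym_mod_fin_dim[OF sym_mod_regular] lin_isoproj) auto
    also have "\<dots> = trace_on (regular n) (\<lambda>v. perm_act id (isoproj n (specht D) v))" by simp
    also have "\<dots> = (\<Sum>y\<in>Sym n. of_nat (cfun.dim (specht D)) / fact n * character (specht D) y * character (regular n) (id \<circ> inv y))"
      by (rule trace_isoproj[OF sym_mod_regular Sym_id])
    also have "\<dots> = (\<Sum>y\<in>Sym n. if y = id then of_nat (sdim D) * character (specht D) y else 0)"
    proof (intro sum.cong refl)
      fix y assume y: "y \<in> Sym n"
      have "inv y = id \<longleftrightarrow> y = id" using Sym_inv_inv[OF y] inv_id by metis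
      then show "of_nat (cfun.dim (specht D)) / fact n * character (specht D) y * character (regular n) (id \<circ> inv y) =
        (if y = id then of_nat (sdim D) * character (specht D) y else 0)"
        using character_regular[OF Sym_inv[OF y]] by (simp add: sdim_def)
    qed
    also have "\<dots> = of_nat (sdim D * sdim D)" using character_id[OF S] by (simp add: sdim_def)
    finally show ?thesis by (simp only: of_nat_eq_iff)
  qed
  then have "(\<Sum>D\<in>youngs n. sdim D * sdim D) = (\<Sum>D\<in>youngs n. cfun.dim (isoproj n (specht D) ` regular n))"
    by (intro sum.cong refl)
  also have "\<dots> \<le> cfun.dim (regular n)" by (rule isoproj_specht_family(1)[OF sym_mod_regular]) simp
  finally show ?thesis by (simp add: dim_regular)
qed

lemma finite_up [simp]: "finite {D. young_cover E D}"
  by (rule finite_subset[OF _ finite_youngs[of "Suc (card E)"]]) (auto simp: young_cover_def youngs_def)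

lemma finite_down [simp]: "finite {E. young_cover E D}"
  by (rule finite_subset[OF _ finite_youngs[of "card D - 1"]]) (auto simp: young_cover_def youngs_def)

lemma sum_Collect_restrict:
  "finite A \<Longrightarrow> {x. P x} \<subseteq> A \<Longrightarrow> (\<Sum>x | P x. f x) = (\<Sum>x\<in>A. if P x then f x else 0)"
  by (rule sum.mono_neutral_cong_left) auto

lemma up_subset: "E \<in> youngs m \<Longrightarrow> {D. young_cover E D} \<subseteq> youngs (Suc m)"
  by (auto simp: young_cover_def youngs_def)

lemma down_subset: "D \<in> youngs (Suc m) \<Longrightarrow> {E. young_cover E D} \<subseteq> youngs m"
  by (auto simp: young_cover_def youngs_def)

lemma sum_young_cover_swap:
  fixes F :: "box set \<Rightarrow> box set \<Rightarrow> nat"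
  shows "(\<Sum>D\<in>youngs (Suc m). \<Sum>E | young_cover E D. F E D) = (\<Sum>E\<in>youngs m. \<Sum>D | young_cover E D. F E D)"
proof -
  have "(\<Sum>D\<in>youngs (Suc m). \<Sum>E | young_cover E D. F E D) =
    (\<Sum>D\<in>youngs (Suc m). \<Sum>E\<in>youngs m. if young_cover E D then F E D else 0)"
    by (rule sum.cong[OF refl], rule sum_Collect_restrict[OF finite_youngs down_subset])
  also have "\<dots> = (\<Sum>E\<in>youngs m. \<Sum>D\<in>youngs (Suc m). if young_cover E D then F E D else 0)"
    by (rule sum.swap)
  also have "\<dots> = (\<Sum>E\<in>youngs m. \<Sum>D | young_cover E D. F E D)"
    by (rule sum.cong[OF refl], rule sum_Collect_restrict[OF finite_youngs up_subset, symmetric])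
  finally show ?thesis .
qed

text \<open>The relation \<open>DU - UD = 1\<close> of Young's lattice.\<close>

lemma sum_up_down:
  fixes f :: "box set \<Rightarrow> nat"
  assumes "E \<in> youngs m"
  shows "(\<Sum>D | young_cover E D. \<Sum>F | young_cover F D. f F) = f E + (\<Sum>G | young_cover G E. \<Sum>F | young_cover G F. f F)"
proof -
  have E: "young E" "card E = m" using assms by (auto simp: youngs_def)
  have "(\<Sum>D | young_cover E D. \<Sum>F | young_cover F D. f F) = (\<Sum>D | young_cover E D. \<Sum>F\<in>youngs m. if young_cover F D then f F else 0)"
    by (rule sum.cong[OF refl], rule sum_Collect_restrict[OF finite_youngs down_subset])
       (use E in \<open>simp add: young_cover_def youngs_def\<close>)
  also have "\<dots> = (\<Sum>F\<in>youngs m. card {D. young_cover E D \<and> young_cover F D} * f F)"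
    by (subst sum.swap) (simp add: sum.If_cases Int_def)
  also have "\<dots> = (\<Sum>F\<in>youngs m. (if F = E then f E else 0) + card {G. young_cover G E \<and> young_cover G F} * f F)"
  proof (intro sum.cong refl)
    fix F assume "F \<in> youngs m"
    then show "card {D. young_cover E D \<and> young_cover F D} * f F =
      (if F = E then f E else 0) + card {G. young_cover G E \<and> young_cover G F} * f F"
      using card_up_eq_Suc_card_down[OF E(1)] card_up_up_eq_card_down_down[of E F] E
      by (cases "F = E") (auto simp: youngs_def)
  qed
  also have "\<dots> = f E + (\<Sum>F\<in>youngs m. card {G. young_cover G E \<and> young_cover G F} * f F)"
    using assms by (simp add: sum.distrib)
  also have "(\<Sum>F\<in>youngs m. card {G. young_cover G E \<and> young_cover G F} * f F) =
    (\<Sum>G | young_cover G E. \<Sum>F\<in>youngs m. if young_cover G F then f F else 0)"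
    by (subst sum.swap) (simp add: sum.If_cases Int_def)
  also have "\<dots> = (\<Sum>G | young_cover G E. \<Sum>F | young_cover G F. f F)"
    by (rule sum.cong[OF refl], rule sum_Collect_restrict[OF finite_youngs, symmetric])
       (use E in \<open>auto simp: young_cover_def youngs_def\<close>)
  finally show ?thesis .
qed

lemma youngs_0: "youngs 0 = {{}}"
  using young_finite by (auto simp: youngs_def young_def)

text \<open>By induction, with \<open>d = sdim\<close>, the chain \<open>n! \<ge> \<Sum>D. d D ^ 2 \<ge> \<Sum>D. d D * (\<Sum>E below D. d E) =
  \<Sum>E. d E * (\<Sum>D above E. d D) \<ge> n * (\<Sum>E. d E ^ 2) = n!\<close> consists of equalities; the last inequality
  uses \<open>sum_up_down\<close>.\<close>

lemma sdim_relations: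
  "(\<Sum>D\<in>youngs n. sdim D * sdim D) = fact n"
  "D \<in> youngs (Suc m) \<Longrightarrow> Suc m = n \<Longrightarrow> sdim D = (\<Sum>E | young_cover E D. sdim E)"
  "E \<in> youngs m \<Longrightarrow> Suc m = n \<Longrightarrow> (\<Sum>D | young_cover E D. sdim D) = Suc m * sdim E"
proof (induction n arbitrary: m D E)
  case 0
  {
    case 1
    have "0 < sdim {}" using sdim_pos[of "{}"] by (simp add: young_def)
    moreover have "sdim {} * sdim {} \<le> 1" using sum_sdim_sq_le[of 0] by (simp add: youngs_0)
    moreover have "sdim {} * 1 \<le> sdim {} * sdim {}" using \<open>0 < _\<close> by (intro mult_le_mono2) simp
    ultimately have "sdim {} = 1" by linarith
    then show ?case by (simp add: youngs_0)
  next
    case 2 then show ?case by simp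
  next
    case 3 then show ?case by simp
  }
next
  case (Suc n)
  note IH = Suc.IH
  \<comment> \<open>By the hypothesis for \<open>n\<close>, going down from \<open>E\<close> and up
    again contributes \<open>n * sdim E\<close>; the relation of Young's lattice adds one more
    \<open>sdim E\<close>.\<close>
  have up: "Suc n * sdim E \<le> (\<Sum>D | young_cover E D. sdim D)" if E: "E \<in> youngs n" for E
  proof -
    have "n * sdim E = (\<Sum>G | young_cover G E. n * sdim G)"
    proof (cases "n = 0")
      case True
      then show ?thesis by simp
    next
      case False
      then obtain k where k: "n = Suc k" by (cases n) auto
      have "sdim E = (\<Sum>G | young_cover G E. sdim G)"
        by (rule IH(2)[OF E[unfolded k] k[symmetric]])
      then show ?thesis by (simp only: sum_distrib_left)
    qed
    also have "\<dots> = (\<Sum>G | young_cover G E. \<Sum>F | young_cover G F. sdim F)"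
    proof (rule sum.cong[OF refl])
      fix G assume "G \<in> {G. young_cover G E}"
      then have "n = Suc (card G)" "G \<in> youngs (card G)" using E by (auto simp: young_cover_def youngs_def)
      from IH(3)[OF this(2) this(1)[symmetric]] this(1)
      show "n * sdim G = (\<Sum>F | young_cover G F. sdim F)" by (simp only:)
    qed
    finally have "Suc n * sdim E = sdim E + (\<Sum>G | young_cover G E. \<Sum>F | young_cover G F. sdim F)" by simp
    also have "\<dots> = (\<Sum>D | young_cover E D. \<Sum>F | young_cover F D. sdim F)" by (rule sum_up_down[OF E, symmetric])
    also have "\<dots> \<le> (\<Sum>D | young_cover E D. sdim D)"
      by (intro sum_mono sum_sdim_down_le) (simp add: young_cover_def)
    finally show ?thesis .
  qed
  have down: "sdim D * (\<Sum>E | young_cover E D. sdim E) \<le> sdim D * sdim D" if "D \<in> youngs (Suc n)" for D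
    using that sum_sdim_down_le by (simp add: youngs_def)
  have le1: "(\<Sum>D\<in>youngs (Suc n). sdim D * sdim D) \<le> fact (Suc n)" by (rule sum_sdim_sq_le)
  have le2: "(\<Sum>D\<in>youngs (Suc n). sdim D * (\<Sum>E | young_cover E D. sdim E)) \<le> (\<Sum>D\<in>youngs (Suc n). sdim D * sdim D)"
    by (rule sum_mono) (rule down)
  have eq: "(\<Sum>D\<in>youngs (Suc n). sdim D * (\<Sum>E | young_cover E D. sdim E)) =
    (\<Sum>E\<in>youngs n. sdim E * (\<Sum>D | young_cover E D. sdim D))"
    using sum_young_cover_swap[of "\<lambda>E D. sdim D * sdim E" n] by (simp add: sum_distrib_left mult.commute)
  have le3: "(\<Sum>E\<in>youngs n. sdim E * (Suc n * sdim E)) \<le> (\<Sum>E\<in>youngs n. sdim E * (\<Sum>D | young_cover E D. sdim D))"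
    by (intro sum_mono mult_le_mono2 up)
  have "(\<Sum>E\<in>youngs n. sdim E * (Suc n * sdim E)) = Suc n * (\<Sum>E\<in>youngs n. sdim E * sdim E)"
    by (simp only: sum_distrib_left ac_simps)
  then have fact: "(\<Sum>E\<in>youngs n. sdim E * (Suc n * sdim E)) = fact (Suc n)"
    using IH(1) by simp
  {
    case 1
    show ?case using le1 le2 le3 eq fact by linarith
  next
    case 2
    have "(\<Sum>D\<in>youngs (Suc n). sdim D * (\<Sum>E | young_cover E D. sdim E)) = (\<Sum>D\<in>youngs (Suc n). sdim D * sdim D)"
      using le1 le2 le3 eq fact by linarith
    then have "sdim D * (\<Sum>E | young_cover E D. sdim E) = sdim D * sdim D"
      by (rule sum_mono_inv[OF _ down]) (use 2 in simp_all)
    moreover have "0 < sdim D" using 2 sdim_pos by (simp add: youngs_def)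
    ultimately show ?case by simp
  next
    case 3
    have "(\<Sum>E\<in>youngs n. sdim E * (Suc n * sdim E)) = (\<Sum>E\<in>youngs n. sdim E * (\<Sum>D | young_cover E D. sdim D))"
      using le1 le2 le3 eq fact by linarith
    then have "sdim D * (Suc n * sdim D) = sdim D * (\<Sum>F | young_cover D F. sdim F)"
      by (rule sum_mono_inv[OF _ mult_le_mono2[OF up]]) (use 3 in simp_all)
    moreover have "0 < sdim D" using 3 sdim_pos by (simp add: youngs_def)
    ultimately show ?case using 3 by simp
  }
qed

lemma sdim_branching:
  assumes "young D" "card D = Suc m"
  shows "sdim D = (\<Sum>E | young_cover E D. sdim E)"
  using sdim_relations(2)[of D m "Suc m"] assms by (simp add: youngs_def)

text \<open>Each image has dimension at least \<open>sdim E\<close>, and together they have at most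
  \<open>sdim D\<close>. The branching identity makes the outer bounds equal, so every inequality is
  an equality.\<close>

lemma dim_isoproj_image:
  assumes "young D" "card D = Suc m"
  shows "young_cover E D \<Longrightarrow> cfun.dim (isoproj m (specht E) ` specht D) = sdim E"
    and "v \<in> specht D \<Longrightarrow> (\<Sum>E | young_cover E D. isoproj m (specht E) v) = v"
proof -
  have I: "{E. young_cover E D} \<subseteq> youngs m" using assms by (auto simp: young_cover_def youngs_def)
  have V: "sym_mod m (specht D)"
    using sym_mod_mono[OF _ sym_mod_specht[OF young_finite[OF assms(1)]], of m] assms by simp
  have lo: "sdim E \<le> cfun.dim (isoproj m (specht E) ` specht D)" if "young_cover E D" for E
    using sdim_le_image[OF that, of "Suc m"] assms by simp
  have "(\<Sum>E | young_cover E D. cfun.dim (isoproj m (specht E) ` specht D)) \<le> sdim D"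
    using isoproj_specht_family(1)[OF V I] by (simp add: sdim_def)
  moreover have "sdim D \<le> (\<Sum>E | young_cover E D. cfun.dim (isoproj m (specht E) ` specht D))"
    unfolding sdim_branching[OF assms] using lo by (intro sum_mono) simp
  ultimately have eq: "(\<Sum>E | young_cover E D. cfun.dim (isoproj m (specht E) ` specht D)) = sdim D" by simp
  have "(\<Sum>E | young_cover E D. sdim E) = (\<Sum>E | young_cover E D. cfun.dim (isoproj m (specht E) ` specht D))"
    using eq sdim_branching[OF assms] by simp
  then show "young_cover E D \<Longrightarrow> cfun.dim (isoproj m (specht E) ` specht D) = sdim E"
    using sum_mono_inv[of sdim "{E. young_cover E D}" "\<lambda>E. cfun.dim (isoproj m (specht E) ` specht D)" E] lo by simp
  show "v \<in> specht D \<Longrightarrow> (\<Sum>E | young_cover E D. isoproj m (specht E) v) = v"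
    using isoproj_specht_family(2)[OF V I] eq by (simp add: sdim_def)
qed

text \<open>The part of type \<open>E\<close> is a single copy of the Specht module:
  \<open>drop_top\<close> maps it onto that module and the dimensions agree. Equivariance holds for
  all functions, so \<open>A\<close> commutes with projections and Jucys-Murphy elements without
  membership conditions.\<close>

lemma specht_branching_iso:
  assumes "young_cover E D" "card D = Suc m"
  obtains A A' where "lin A" "lin A'" "A ` isoproj m (specht E) ` specht D = specht E"
    "A' ` specht E \<subseteq> isoproj m (specht E) ` specht D"
    "\<forall>w\<in>specht E. A (A' w) = w" "\<forall>v\<in>isoproj m (specht E) ` specht D. A' (A v) = v"
    "\<forall>g\<in>Sym m. \<forall>f. A (perm_act g f) = perm_act g (A f)"
proof -
  obtain b where b: "b \<notin> E" "D = insert b E" "finite E" "young E" "young D" "card D = Suc (card E)"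
    using assms(1) by (rule young_coverE)
  let ?P = "isoproj m (specht E)" and ?A = "drop_top (Suc m) (fst b)"
  have m: "card E = m" using b assms(2) by simp
  have comm: "?A (perm_act g f) = perm_act g (?A f)" if "g \<in> Sym m" for g f
    by (rule drop_top_perm_act[OF that]) simp
  have s: "simple_mod m (specht E)" using simple_specht[OF b(4) m] .
  have V: "fin_dim (?P ` specht D)"
    by (rule fin_dim_image[OF lin_isoproj sym_mod_fin_dim[OF sym_mod_specht[OF young_finite[OF b(5)]]]])
  have surj: "specht E \<subseteq> ?A ` ?P ` specht D"
  proof
    fix w assume w: "w \<in> specht E"
    then obtain v where v: "v \<in> specht D" "w = ?A v"
      using specht_drop_top_surj[OF b(1,3,2), of "Suc m"] assms(2) by auto
    have "w = ?P w" using isoproj_self[OF s w] by simp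
    also have "\<dots> = ?A (?P v)"
      unfolding v(2) by (intro isoproj_commute[symmetric] lin_drop_top comm)
    finally show "w \<in> ?A ` ?P ` specht D" using v(1) by blast
  qed
  have sub: "cfun.subspace (specht E)" by (simp add: specht_def)
  have dim: "cfun.dim (specht E) = cfun.dim (?P ` specht D)"
    using dim_isoproj_image(1)[OF b(5) assms(2,1)] by (simp add: sdim_def)
  show ?thesis
  proof (rule isomorphism_of_dim_eq[OF V sub lin_drop_top surj dim])
    fix A' assume A': "lin A'" "A' ` specht E \<subseteq> ?P ` specht D" "?A ` ?P ` specht D = specht E"
      "\<And>w. w \<in> specht E \<Longrightarrow> ?A (A' w) = w" "\<And>v. v \<in> ?P ` specht D \<Longrightarrow> A' (?A v) = v"
    show ?thesis
      by (rule that[OF lin_drop_top A'(1,3,2)]) (intro ballI A' allI comm; assumption)+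
  qed
qed

section \<open>Jucys-Murphy elements and the recursion for the generalized characters\<close>

text \<open>Ordered pairs give twice the class sum of the transpositions, which is the source of the
  factors 2 below.\<close>

definition transp_sum :: "nat \<Rightarrow> (tabloid \<Rightarrow> complex) \<Rightarrow> tabloid \<Rightarrow> complex" where
  "transp_sum n f = (\<Sum>a\<in>{1..n}. \<Sum>b\<in>{1..n} - {a}. perm_act (transpose a b) f)"

text \<open>In the usual numbering this is the element of index \<open>m + 1\<close>; here the index
  names the group S(m) that commutes with it.\<close>

definition jucys_murphy :: "nat \<Rightarrow> (tabloid \<Rightarrow> complex) \<Rightarrow> tabloid \<Rightarrow> complex" where
  "jucys_murphy m f = (\<Sum>a\<in>{1..m}. perm_act (transpose a (Suc m)) f)"

definition total_content :: "box set \<Rightarrow> complex" where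
  "total_content D = (\<Sum>b\<in>D. of_int (content b))"

lemma transpose_Sym: "a \<in> {1..n} \<Longrightarrow> b \<in> {1..n} \<Longrightarrow> transpose a b \<in> Sym n"
  by (simp add: Sym_def permutes_swap_id)

lemma comp_transpose:
  assumes "g \<in> Sym n"
  shows "g \<circ> transpose a b = transpose (g a) (g b) \<circ> g"
proof
  have "g x = g y \<longleftrightarrow> x = y" for x y using inj_eq[OF bij_is_inj[OF Sym_bij[OF assms]]] .
  then show "(g \<circ> transpose a b) x = (transpose (g a) (g b) \<circ> g) x" for x
    by (simp add: transpose_def)
qed

lemma lin_transp_sum: "lin (transp_sum n)"
  unfolding transp_sum_def[abs_def]
  by (rule linI) (simp_all add: perm_act_simps sum.distrib cfun.scale_sum_right)

lemma lin_jucys_murphy: "lin (jucys_murphy n)"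
  unfolding jucys_murphy_def[abs_def]
  by (rule linI) (simp_all add: perm_act_simps sum.distrib cfun.scale_sum_right)

lemma transp_sum_perm_act:
  assumes "g \<in> Sym n"
  shows "transp_sum n (perm_act g f) = perm_act g (transp_sum n f)"
proof -
  have g: "bij_betw g {1..n} {1..n}" using permutes_imp_bij[OF Sym_permutes[OF assms]] .
  have "perm_act g (transp_sum n f) =
    (\<Sum>a\<in>{1..n}. \<Sum>b\<in>{1..n} - {a}. perm_act (transpose (g a) (g b)) (perm_act g f))"
    by (simp add: transp_sum_def perm_act_simps perm_act_comp comp_transpose[OF assms])
  also have "\<dots> = (\<Sum>a\<in>{1..n}. \<Sum>b\<in>{1..n} - {g a}. perm_act (transpose (g a) b) (perm_act g f))"
  proof (rule sum.cong[OF refl])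
    fix a assume a: "a \<in> {1..n}"
    have "bij_betw g ({1..n} - {a}) ({1..n} - {g a})"
      using bij_betw_DiffI[OF g, of "{a}" "{g a}"] a bij_betwE[OF g] by (simp add: bij_betw_def)
    then show "(\<Sum>b\<in>{1..n} - {a}. perm_act (transpose (g a) (g b)) (perm_act g f)) =
      (\<Sum>b\<in>{1..n} - {g a}. perm_act (transpose (g a) b) (perm_act g f))"
      by (rule sum.reindex_bij_betw)
  qed
  also have "\<dots> = transp_sum n (perm_act g f)"
    unfolding transp_sum_def by (rule sum.reindex_bij_betw[OF g])
  finally show ?thesis ..
qed

lemma transp_sum_in:
  assumes "sym_mod n V" "v \<in> V" shows "transp_sum n v \<in> V"
  unfolding transp_sum_def
  using sym_mod_act[OF assms(1) _ assms(2)] transpose_Sym sym_mod_subspace[OF assms(1)]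
  by (intro cfun.subspace_sum) auto

text \<open>Used to evaluate the central element on a polytabloid. If \<open>a\<close> and
  \<open>b\<close> share neither row nor column, a column permutation producing the tabloid
  \<open>r \<circ> transpose a b\<close> would fix all other entries and then has nowhere to send
  \<open>a\<close>.\<close>

lemma polytab_transpose:
  assumes "ytab D r c" "a \<in> {1..card D}" "b \<in> {1..card D}" "a \<noteq> b"
  shows "polytab (card D) r c (r \<circ> transpose a b) =
    (if r a = r b then 1 else 0) - (if c a = c b then 1 else 0)"
proof -
  let ?n = "card D" and ?t = "transpose a b"
  have inv: "h \<circ> ?t = h" if "h a = h b" for h :: "nat \<Rightarrow> nat"
    using that by (auto simp: fun_eq_iff transpose_def)
  have ne: "\<not> (r a = r b \<and> c a = c b)" using ytab_injD[OF assms(1)] assms(2-4) by blast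
  consider "r a = r b" | "c a = c b" | "r a \<noteq> r b" "c a \<noteq> c b" by blast
  then show ?thesis
  proof cases
    case 1
    then show ?thesis using ne inv[of r] polytab_self[OF assms(1)] by simp
  next
    case 2
    have "?t \<in> col_stab ?n c" using transpose_Sym[OF assms(2,3)] inv[OF 2] by (simp add: col_stab_def)
    then show ?thesis
      using 2 ne polytab_comp[of ?t ?n c r r] polytab_self[OF assms(1)] assms(4) by (simp add: sign_swap_id)
  next
    case 3
    have "polytab ?n r c (r \<circ> ?t) = 0"
    proof (rule ccontr)
      assume "polytab ?n r c (r \<circ> ?t) \<noteq> 0"
      then obtain s where s: "s \<in> col_stab ?n c" "r \<circ> ?t = r \<circ> inv s" by (rule polytab_nonzero)
      define q where "q = inv s"
      have q: "q \<in> col_stab ?n c" using col_stab_inv[OF s(1)] by (simp add: q_def)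
      have rq: "r (?t x) = r (q x)" for x using fun_cong[OF s(2), of x] by (simp add: q_def)
      have cq: "c (q x) = c x" for x by (rule col_stab_apply[OF q])
      have qp: "q permutes {1..?n}" by (rule Sym_permutes[OF col_stab_Sym[OF q]])
      have fix_q: "q x = x" if "x \<noteq> a" "x \<noteq> b" for x
      proof (cases "x \<in> {1..?n}")
        case True
        then have "q x \<in> {1..?n}" using permutes_in_image[OF qp] by blast
        moreover have "r (q x) = r x" using rq[of x] that by (simp add: transpose_def)
        ultimately show ?thesis using ytab_injD[OF assms(1)] cq True by blast
      next
        case False
        then show ?thesis by (rule permutes_not_in[OF qp])
      qed
      consider "q a = a" | "q a = b" | "q a \<noteq> a" "q a \<noteq> b" by blast
      then show False
      proof cases
        case 1
        then show False using rq[of a] 3 by (simp add: transpose_def)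
      next
        case 2
        then show False using cq[of a] 3 by simp
      next
        case 3
        then have "q (q a) = q a" by (rule fix_q)
        then show False using 3 injD[OF permutes_inj[OF qp]] by blast
      qed
    qed
    then show ?thesis using 3 by simp
  qed
qed

text \<open>\<open>X\<close> names the line of an entry, a row or a column, and \<open>Y\<close> its
  position there. An entry has \<open>Y a - 1\<close> predecessors on its line, and the factor 2
  arises because every pair is counted in both orders.\<close>

lemma sum_same_line:
  fixes X Y :: "nat \<Rightarrow> nat"
  assumes inj: "\<And>x y. x \<in> A \<Longrightarrow> y \<in> A \<Longrightarrow> X x = X y \<Longrightarrow> Y x = Y y \<Longrightarrow> x = y" and fin: "finite A"
    and pos: "\<And>x. x \<in> A \<Longrightarrow> 1 \<le> Y x"
    and ex: "\<And>x j. x \<in> A \<Longrightarrow> 1 \<le> j \<Longrightarrow> j < Y x \<Longrightarrow> \<exists>y\<in>A. X y = X x \<and> Y y = j"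
  shows "(\<Sum>a\<in>A. \<Sum>b\<in>A - {a}. if X a = X b then 1 else 0 :: complex) = (\<Sum>a\<in>A. 2 * (of_nat (Y a) - 1))"
proof -
  let ?lt = "\<lambda>a b. if X b = X a \<and> Y b < Y a then 1 else 0 :: complex"
  have lt: "(\<Sum>b\<in>A. ?lt a b) = of_nat (Y a) - 1" if a: "a \<in> A" for a
  proof -
    let ?B = "{b\<in>A. X b = X a \<and> Y b < Y a}"
    have "Y ` ?B = {1..<Y a}"
    proof
      show "Y ` ?B \<subseteq> {1..<Y a}" using pos by auto
      show "{1..<Y a} \<subseteq> Y ` ?B"
      proof
        fix j assume j: "j \<in> {1..<Y a}"
        then obtain y where "y \<in> A" "X y = X a" "Y y = j" using ex[OF a, of j] by auto
        then show "j \<in> Y ` ?B" using j by auto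
      qed
    qed
    moreover have "inj_on Y ?B" using inj by (intro inj_onI) auto
    ultimately have "card ?B = card {1..<Y a}" using card_image by metis
    moreover have "(\<Sum>b\<in>A. ?lt a b) = of_nat (card ?B)"
      using fin by (simp add: sum.If_cases Int_def)
    ultimately show ?thesis using pos[OF a] by (simp add: of_nat_diff)
  qed
  have "(\<Sum>a\<in>A. \<Sum>b\<in>A - {a}. if X a = X b then 1 else 0 :: complex) = (\<Sum>a\<in>A. \<Sum>b\<in>A. ?lt a b + ?lt b a)"
  proof (rule sum.cong[OF refl])
    fix a assume a: "a \<in> A"
    have "(\<Sum>b\<in>A - {a}. if X a = X b then 1 else 0 :: complex) = (\<Sum>b\<in>A - {a}. ?lt a b + ?lt b a)"
    proof (rule sum.cong[OF refl])
      fix b assume "b \<in> A - {a}"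
      then have "X a = X b \<Longrightarrow> Y a \<noteq> Y b" using inj[of a b] a by auto
      then show "(if X a = X b then 1 else 0 :: complex) = ?lt a b + ?lt b a"
        by (cases "Y a < Y b") auto
    qed
    also have "\<dots> = (\<Sum>b\<in>A. ?lt a b + ?lt b a)"
      using fin by (intro sum.mono_neutral_left) auto
    finally show "(\<Sum>b\<in>A - {a}. if X a = X b then 1 else 0 :: complex) = (\<Sum>b\<in>A. ?lt a b + ?lt b a)" .
  qed
  also have "\<dots> = (\<Sum>a\<in>A. \<Sum>b\<in>A. ?lt a b) + (\<Sum>a\<in>A. \<Sum>b\<in>A. ?lt b a)"
    by (simp only: sum.distrib)
  also have "(\<Sum>a\<in>A. \<Sum>b\<in>A. ?lt b a) = (\<Sum>a\<in>A. \<Sum>b\<in>A. ?lt a b)" by (rule sum.swap)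
  also have "(\<Sum>a\<in>A. \<Sum>b\<in>A. ?lt a b) = (\<Sum>a\<in>A. of_nat (Y a) - 1)"
    by (rule sum.cong[OF refl lt])
  finally show ?thesis by (simp only: mult_2 sum.distrib)
qed

text \<open>The operator commutes with S(n), hence is a scalar, and a polytabloid has coefficient 1
  at its own tabloid, where the scalar can be read off. Pairs in rows minus pairs in columns give
  twice the sum of column minus row indices.\<close>

lemma transp_sum_specht:
  assumes "young D" "card D = n" "v \<in> specht D"
  shows "transp_sum n v = fun_scale (2 * total_content D) v"
proof -
  have V: "sym_mod n (specht D)" using sym_mod_specht[OF young_finite[OF assms(1)]] assms(2) by simp
  have "intertw n (specht D) (specht D) (transp_sum n)"
    unfolding intertw_def using lin_transp_sum transp_sum_perm_act transp_sum_in[OF V] by blast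
  then obtain s where s: "\<forall>v\<in>specht D. transp_sum n v = fun_scale s v"
    using simple_specht[OF assms(1,2)] unfolding simple_mod_def by blast
  obtain r c where y: "ytab D r c" using ytab_exists[OF young_finite[OF assms(1)]] by blast
  let ?p = "polytab n r c"
  have p: "?p \<in> specht D" "?p r = 1" using specht_gen[OF y] polytab_self[OF y] assms(2) by simp_all
  have "s = transp_sum n ?p r" using s p by (simp add: fun_scale_apply)
  also have "\<dots> = (\<Sum>a\<in>{1..n}. \<Sum>b\<in>{1..n} - {a}. ?p (r \<circ> transpose a b))"
    by (simp add: transp_sum_def sum_fun_apply perm_act_def)
  also have "\<dots> = (\<Sum>a\<in>{1..n}. \<Sum>b\<in>{1..n} - {a}.
      (if r a = r b then 1 else 0) - (if c a = c b then 1 else 0))"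
    using polytab_transpose[OF y] assms(2) by (intro sum.cong refl) auto
  also have "\<dots> = (\<Sum>a\<in>{1..n}. \<Sum>b\<in>{1..n} - {a}. if r a = r b then 1 else 0) -
      (\<Sum>a\<in>{1..n}. \<Sum>b\<in>{1..n} - {a}. if c a = c b then 1 else 0)"
    by (simp only: sum_subtractf)
  also have "(\<Sum>a\<in>{1..n}. \<Sum>b\<in>{1..n} - {a}. if r a = r b then 1 else 0 :: complex) =
      (\<Sum>a\<in>{1..n}. 2 * (of_nat (c a) - 1))"
  proof (rule sum_same_line)
    show "1 \<le> c x" if "x \<in> {1..n}" for x
      using young_pos[OF assms(1) ytab_mem[OF y, of x]] that assms(2) by simp
    show "\<exists>y\<in>{1..n}. r y = r x \<and> c y = j" if xj: "x \<in> {1..n}" "1 \<le> j" "j < c x" for x j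
    proof -
      have mem: "(r x, c x) \<in> D" using ytab_mem[OF y, of x] xj assms(2) by simp
      have "(r x, j) \<in> D"
        using young_down[OF assms(1) mem, of "r x" j] young_pos[OF assms(1) mem] xj by simp
      then obtain m where "m \<in> {1..card D}" "r m = r x" "c m = j" by (rule ytab_surj[OF y])
      then show ?thesis using assms(2) by blast
    qed
    show "x = y" if "x \<in> {1..n}" "y \<in> {1..n}" "r x = r y" "c x = c y" for x y
      using ytab_injD[OF y that(3,4)] that(1,2) assms(2) by simp
  qed simp
  also have "(\<Sum>a\<in>{1..n}. \<Sum>b\<in>{1..n} - {a}. if c a = c b then 1 else 0 :: complex) =
      (\<Sum>a\<in>{1..n}. 2 * (of_nat (r a) - 1))"
  proof (rule sum_same_line)
    show "1 \<le> r x" if "x \<in> {1..n}" for x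
      using young_pos[OF assms(1) ytab_mem[OF y, of x]] that assms(2) by simp
    show "\<exists>y\<in>{1..n}. c y = c x \<and> r y = j" if xj: "x \<in> {1..n}" "1 \<le> j" "j < r x" for x j
    proof -
      have mem: "(r x, c x) \<in> D" using ytab_mem[OF y, of x] xj assms(2) by simp
      have "(j, c x) \<in> D"
        using young_down[OF assms(1) mem, of j "c x"] young_pos[OF assms(1) mem] xj by simp
      then obtain m where "m \<in> {1..card D}" "r m = j" "c m = c x" by (rule ytab_surj[OF y])
      then show ?thesis using assms(2) by blast
    qed
    show "x = y" if "x \<in> {1..n}" "y \<in> {1..n}" "c x = c y" "r x = r y" for x y
      using ytab_injD[OF y that(4,3)] that(1,2) assms(2) by simp
  qed simp
  also have "(\<Sum>a\<in>{1..n}. 2 * (of_nat (c a) - 1)) - (\<Sum>a\<in>{1..n}. 2 * (of_nat (r a) - 1 :: complex)) =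
      2 * (\<Sum>a\<in>{1..n}. of_int (content (r a, c a)))"
    unfolding sum_subtractf[symmetric] sum_distrib_left
    by (intro sum.cong refl) (simp add: content_def algebra_simps)
  also have "(\<Sum>a\<in>{1..n}. of_int (content (r a, c a))) = total_content D"
    unfolding total_content_def
    using sum.reindex_bij_betw[OF ytab_bij[OF y], of "\<lambda>b. of_int (content b)"] assms(2) by simp
  finally show ?thesis using s assms(3) by blast
qed

lemma transp_sum_Suc: "transp_sum (Suc m) f = transp_sum m f + fun_scale 2 (jucys_murphy m f)"
proof -
  let ?T = "\<lambda>a b. perm_act (transpose a b) f"
  have top: "{1..Suc m} = insert (Suc m) {1..m}" by auto
  have "(\<Sum>b\<in>{1..Suc m} - {a}. ?T a b) = (\<Sum>b\<in>{1..m} - {a}. ?T a b) + ?T a (Suc m)"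
    if "a \<in> {1..m}" for a
  proof -
    have "{1..Suc m} - {a} = insert (Suc m) ({1..m} - {a})" using that by auto
    then show ?thesis by (simp add: add.commute)
  qed
  then have "transp_sum (Suc m) f =
    (\<Sum>b\<in>{1..m}. ?T (Suc m) b) + (\<Sum>a\<in>{1..m}. (\<Sum>b\<in>{1..m} - {a}. ?T a b) + ?T a (Suc m))"
    unfolding transp_sum_def top by (simp add: insert_Diff_if add.commute)
  also have "\<dots> = transp_sum m f + (jucys_murphy m f + jucys_murphy m f)"
    by (simp add: transp_sum_def jucys_murphy_def sum.distrib transpose_commute[of "Suc m"] add_ac)
  also have "jucys_murphy m f + jucys_murphy m f = fun_scale 2 (jucys_murphy m f)"
    by (simp add: fun_eq_iff plus_fun_apply fun_scale_apply)
  finally show ?thesis .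
qed

lemma jucys_murphy_perm_act:
  assumes "g \<in> Sym m"
  shows "jucys_murphy m (perm_act g f) = perm_act g (jucys_murphy m f)"
proof -
  have g: "bij_betw g {1..m} {1..m}" using permutes_imp_bij[OF Sym_permutes[OF assms]] .
  have "perm_act g (jucys_murphy m f) = (\<Sum>a\<in>{1..m}. perm_act (transpose (g a) (Suc m)) (perm_act g f))"
    using Sym_fixes[OF assms, of "Suc m"]
    by (simp add: jucys_murphy_def perm_act_simps perm_act_comp comp_transpose[OF assms])
  also have "\<dots> = jucys_murphy m (perm_act g f)"
    unfolding jucys_murphy_def by (rule sum.reindex_bij_betw[OF g])
  finally show ?thesis ..
qed

text \<open>Conjugation carries each \<open>transpose a (Suc k)\<close> to
  \<open>transpose a (Suc (Suc k))\<close>. The one remaining summand of the larger element is the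
  transposition itself, whose square is the identity and leaves \<open>f\<close>.\<close>

lemma jucys_murphy_swap:
  "jucys_murphy (Suc k) (perm_act (transpose (Suc k) (Suc (Suc k))) f) =
    perm_act (transpose (Suc k) (Suc (Suc k))) (jucys_murphy k f) + f"
proof -
  let ?s = "transpose (Suc k) (Suc (Suc k))"
  have s: "?s \<in> Sym (Suc (Suc k))" by (rule transpose_Sym) auto
  have "perm_act ?s (jucys_murphy k f) = (\<Sum>a\<in>{1..k}. perm_act (transpose a (Suc (Suc k))) (perm_act ?s f))"
    unfolding jucys_murphy_def perm_act_simps perm_act_comp comp_transpose[OF s]
    by (intro sum.cong refl) (simp add: transpose_def)
  moreover have "perm_act ?s (perm_act ?s f) = f" by (simp add: perm_act_comp)
  moreover have "{1..Suc k} = insert (Suc k) {1..k}" by auto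
  ultimately show ?thesis by (simp add: jucys_murphy_def add.commute)
qed

section \<open>Transport between an isotypic part and the smaller Specht module\<close>

lemma sym_mod_isoproj_image:
  assumes "sym_mod m V" "sym_mod m S"
  shows "sym_mod m (isoproj m S ` V)"
  unfolding sym_mod_def
proof (intro conjI ballI)
  show "fin_dim (isoproj m S ` V)" by (rule fin_dim_image[OF lin_isoproj sym_mod_fin_dim[OF assms(1)]])
  fix g assume g: "g \<in> Sym m"
  show "perm_act g ` isoproj m S ` V \<subseteq> isoproj m S ` V"
    using isoproj_perm_act[OF assms(2) g] sym_mod_act[OF assms(1) g] by auto
qed

lemma isoproj_image_subset:
  assumes "sym_mod m V" shows "isoproj m S ` V \<subseteq> V"
  using isoproj_in[OF assms] by blast

text \<open>The sum defining a generalized character is, with its prefactor, the projection \<open>isoproj\<close>; see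
  \<open>gen_char_eq_proj_char\<close>.\<close>

definition proj_char :: "box set \<Rightarrow> box set \<Rightarrow> (nat \<Rightarrow> nat) \<Rightarrow> complex" where
  "proj_char D E x = trace_on (specht D) (\<lambda>v. perm_act x (isoproj (card E) (specht E) v))"

context
  fixes D E :: "box set" and m :: nat
  assumes young_cover: "young_cover E D" and mE: "card E = m"
begin

lemma young_cover_facts: "young D" "young E" "card D = Suc m" "sym_mod (Suc m) (specht D)" "sym_mod m (specht D)"
  "sym_mod m (specht E)" "simple_mod m (specht E)" "sym_mod m (isoproj m (specht E) ` specht D)"
proof -
  show D: "young D" "young E" "card D = Suc m" using young_cover mE by (auto simp: young_cover_def)
  show S: "sym_mod (Suc m) (specht D)" using sym_mod_specht[OF young_finite[OF D(1)]] D(3) by simp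
  show Sm: "sym_mod m (specht D)" by (rule sym_mod_mono[OF _ S]) simp
  show E: "sym_mod m (specht E)" using sym_mod_specht[OF young_finite[OF D(2)]] mE by simp
  show "simple_mod m (specht E)" by (rule simple_specht[OF D(2) mE])
  show "sym_mod m (isoproj m (specht E) ` specht D)" by (rule sym_mod_isoproj_image[OF Sm E])
qed

lemma isoproj_fixes_image: "v \<in> isoproj m (specht E) ` specht D \<Longrightarrow> isoproj m (specht E) v = v"
  using isoproj_idem[OF young_cover_facts(7)] by auto

lemma isoproj_image_mem: "v \<in> isoproj m (specht E) ` specht D \<Longrightarrow> v \<in> specht D"
  using isoproj_image_subset[OF young_cover_facts(5)] by blast

text \<open>The last hypothesis is a naturality condition, met by operators built from the action of
  S(m): \<open>f\<close> commutes with every equivariant linear map, in particular with the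
  branching isomorphism, whose construction can therefore stay hidden.\<close>

lemma trace_isoproj_image:
  assumes "lin f" "f ` isoproj m (specht E) ` specht D \<subseteq> isoproj m (specht E) ` specht D"
    and "\<And>A v. lin A \<Longrightarrow> (\<forall>g\<in>Sym m. \<forall>h. A (perm_act g h) = perm_act g (A h)) \<Longrightarrow> A (f v) = f (A v)"
  shows "trace_on (isoproj m (specht E) ` specht D) f = trace_on (specht E) f"
proof -
  obtain A A' where A: "lin A" "lin A'" "A ` isoproj m (specht E) ` specht D = specht E"
    "A' ` specht E \<subseteq> isoproj m (specht E) ` specht D"
    "\<forall>w\<in>specht E. A (A' w) = w" "\<forall>v\<in>isoproj m (specht E) ` specht D. A' (A v) = v"
    "\<forall>g\<in>Sym m. \<forall>f. A (perm_act g f) = perm_act g (A f)"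
    by (rule specht_branching_iso[OF young_cover young_cover_facts(3)])
  have 1: "A (A' w) = w" if "w \<in> specht E" for w using A(5) that by (rule bspec)
  have 2: "A (f v) = f (A v)" if "v \<in> isoproj m (specht E) ` specht D" for v
    using A(1,7) by (rule assms(3))
  have 3: "A' (A v) = v" if "v \<in> isoproj m (specht E) ` specht D" for v using A(6) that by (rule bspec)
  note tc = trace_conjugate[where V = "isoproj m (specht E) ` specht D" and W = "specht E" and A = A and A' = A' and f = f and g = f]
  show ?thesis
    using sym_mod_fin_dim[OF young_cover_facts(8)] sym_mod_fin_dim[OF young_cover_facts(6)] A(1,2) equalityD1[OF A(3)] A(4) 1 assms(1,2) 2 3
    by (rule tc)
qed

text \<open>\<open>U\<close> marks where in the smaller Specht module the scalar is known:
  everywhere for the sum of all transpositions, on an isotypic part for the next smaller group in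
  the case of a Jucys-Murphy element.\<close>

lemma transfer_scalar:
  assumes "lin f" "f ` isoproj m (specht E) ` specht D \<subseteq> isoproj m (specht E) ` specht D"
    and "\<And>A v. lin A \<Longrightarrow> (\<forall>g\<in>Sym m. \<forall>h. A (perm_act g h) = perm_act g (A h)) \<Longrightarrow> A (f v) = f (A v)"
    and "\<And>w. w \<in> U \<Longrightarrow> w \<in> specht E \<Longrightarrow> f w = fun_scale s w"
    and "v \<in> isoproj m (specht E) ` specht D"
    and "\<And>A. lin A \<Longrightarrow> (\<forall>g\<in>Sym m. \<forall>h. A (perm_act g h) = perm_act g (A h)) \<Longrightarrow>
      A ` isoproj m (specht E) ` specht D = specht E \<Longrightarrow> A v \<in> U"
  shows "f v = fun_scale s v"
proof -
  obtain A A' where A: "lin A" "lin A'" "A ` isoproj m (specht E) ` specht D = specht E"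
    "A' ` specht E \<subseteq> isoproj m (specht E) ` specht D"
    "\<forall>w\<in>specht E. A (A' w) = w" "\<forall>v\<in>isoproj m (specht E) ` specht D. A' (A v) = v"
    "\<forall>g\<in>Sym m. \<forall>f. A (perm_act g f) = perm_act g (A f)"
    by (rule specht_branching_iso[OF young_cover young_cover_facts(3)])
  have Av: "A v \<in> specht E" using A(3) assms(5) by blast
  have "A (f v) = f (A v)" by (rule assms(3)[OF A(1,7)])
  also have "\<dots> = fun_scale s (A v)" by (rule assms(4)[OF assms(6)[OF A(1,7,3)] Av])
  finally have eq: "A' (A (f v)) = fun_scale s (A' (A v))" by (simp add: lin_simps(2)[OF A(2)])
  have "f v \<in> isoproj m (specht E) ` specht D" using assms(2,5) by blast
  then show ?thesis using eq bspec[OF A(6)] assms(5) by simp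
qed

lemma commute_transp_sum:
  assumes "lin A" "\<forall>g\<in>Sym k. \<forall>h. A (perm_act g h) = perm_act g (A h)"
  shows "A (transp_sum k f) = transp_sum k (A f)"
  unfolding transp_sum_def lin_simps(5)[OF assms(1)]
  using assms(2) transpose_Sym by (intro sum.cong refl) auto

text \<open>A Jucys-Murphy element is half the difference of the transposition sums of S(m+1) and
  S(m), and these act by the scalars belonging to \<open>D\<close> and to \<open>E\<close>.\<close>

lemma jucys_murphy_isoproj_image:
  assumes "v \<in> isoproj m (specht E) ` specht D"
  shows "jucys_murphy m v = fun_scale (total_content D - total_content E) v"
proof -
  have "transp_sum m v = fun_scale (2 * total_content E) v"
  proof (rule transfer_scalar[OF lin_transp_sum _ commute_transp_sum _ assms, where U = UNIV])
    show "transp_sum m ` isoproj m (specht E) ` specht D \<subseteq> isoproj m (specht E) ` specht D"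
      using transp_sum_in[OF young_cover_facts(8)] by blast
    show "transp_sum m w = fun_scale (2 * total_content E) w" if "w \<in> specht E" for w
      by (rule transp_sum_specht[OF young_cover_facts(2) mE that])
  qed auto
  moreover have "transp_sum (Suc m) v = fun_scale (2 * total_content D) v"
    by (rule transp_sum_specht[OF young_cover_facts(1,3) isoproj_image_mem[OF assms]])
  ultimately have "fun_scale 2 (jucys_murphy m v) =
      fun_scale 2 (fun_scale (total_content D - total_content E) v)"
    using transp_sum_Suc[of m v] by (simp add: fun_eq_iff fun_scale_apply plus_fun_apply algebra_simps)
  then show ?thesis by (simp only: cfun.scale_cancel_left) simp
qed

lemma proj_char_eq_trace_image:
  assumes "lin A" "A ` specht D \<subseteq> specht D"
  shows "trace_on (specht D) (\<lambda>v. A (isoproj m (specht E) v)) =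
    trace_on (isoproj m (specht E) ` specht D) (\<lambda>v. isoproj m (specht E) (A v))"
  using isoproj_idem[OF young_cover_facts(7)]
  by (intro trace_idempotent_compose sym_mod_fin_dim[OF young_cover_facts(5)] lin_isoproj
      isoproj_image_subset[OF young_cover_facts(5)] assms)

text \<open>This ends the recursion, at cycles of length 1: for elements of S(m) the trace is taken
  over a single copy of the Specht module of \<open>E\<close>.\<close>

lemma proj_char_restrict:
  assumes "x \<in> Sym m"
  shows "proj_char D E x = character (specht E) x"
proof -
  have "proj_char D E x = trace_on (isoproj m (specht E) ` specht D) (\<lambda>v. isoproj m (specht E) (perm_act x v))"
    unfolding proj_char_def mE
    by (rule proj_char_eq_trace_image[OF lin_perm_act sym_mod_act_image[OF young_cover_facts(5) assms]])
  also have "\<dots> = trace_on (isoproj m (specht E) ` specht D) (perm_act x)"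
    by (rule trace_cong[OF sym_mod_fin_dim[OF young_cover_facts(8)]],
        rule isoproj_fixes_image[OF sym_mod_act[OF young_cover_facts(8) assms]])
  also have "\<dots> = character (specht E) x"
    using assms by (intro trace_isoproj_image lin_perm_act sym_mod_act_image[OF young_cover_facts(8)]) auto
  finally show ?thesis .
qed

lemma proj_char_conj:
  assumes "x \<in> Sym (Suc m)" "g \<in> Sym m"
  shows "proj_char D E (g \<circ> x \<circ> inv g) = proj_char D E x"
  unfolding proj_char_def mE
proof (rule sym, rule trace_conjugate[OF sym_mod_fin_dim[OF young_cover_facts(4)] sym_mod_fin_dim[OF young_cover_facts(4)]
      lin_perm_act[of g] lin_perm_act[of "inv g"], where f = "\<lambda>v. perm_act x (isoproj m (specht E) v)"
      and g = "\<lambda>v. perm_act (g \<circ> x \<circ> inv g) (isoproj m (specht E) v)"])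
  note V = young_cover_facts(5)
  show "perm_act g ` specht D \<subseteq> specht D" "perm_act (inv g) ` specht D \<subseteq> specht D"
    by (rule sym_mod_act_image[OF V]; use assms in simp)+
  show "perm_act g (perm_act (inv g) w) = w" "perm_act (inv g) (perm_act g w) = w" for w
    by (simp_all add: perm_act_comp Sym_inv_o[OF assms(2)])
  show "lin (\<lambda>v. perm_act x (isoproj m (specht E) v))" by (rule lin_compose[OF lin_perm_act lin_isoproj])
  show "(\<lambda>v. perm_act x (isoproj m (specht E) v)) ` specht D \<subseteq> specht D"
    using sym_mod_act[OF young_cover_facts(4) assms(1)] isoproj_in[OF V] by blast
  show "perm_act g (perm_act x (isoproj m (specht E) v)) =
      perm_act (g \<circ> x \<circ> inv g) (isoproj m (specht E) (perm_act g v))" for v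
    by (simp add: isoproj_perm_act[OF young_cover_facts(6) assms(2), symmetric] perm_act_comp comp_assoc
        Sym_inv_o[OF assms(2)])
qed

end

text \<open>The projections for all \<open>E\<close> below \<open>D\<close> add up to the identity
  of the Specht module. This leads from the generalized characters back to the ordinary
  ones.\<close>

lemma sum_proj_char:
  assumes "young D" "card D = Suc m" "x \<in> Sym (Suc m)"
  shows "(\<Sum>E | young_cover E D. proj_char D E x) = character (specht D) x"
proof -
  have S: "sym_mod (Suc m) (specht D)" using sym_mod_specht[OF young_finite[OF assms(1)]] assms(2) by simp
  then have Sm: "sym_mod m (specht D)" using sym_mod_mono[of m "Suc m"] by simp
  have "(\<Sum>E | young_cover E D. proj_char D E x) = (\<Sum>E | young_cover E D. trace_on (specht D) (\<lambda>v. perm_act x (isoproj m (specht E) v)))"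
    using assms(2) by (intro sum.cong refl) (simp add: proj_char_def young_cover_def)
  also have "\<dots> = trace_on (specht D) (\<lambda>v. \<Sum>E | young_cover E D. perm_act x (isoproj m (specht E) v))"
    using sym_mod_act[OF S assms(3)] isoproj_in[OF Sm]
    by (intro trace_sum[symmetric] sym_mod_fin_dim[OF S]) blast
  also have "\<dots> = character (specht D) x"
    using dim_isoproj_image(2)[OF assms(1,2)]
    by (intro trace_cong sym_mod_fin_dim[OF S]) (simp add: perm_act_simps(5)[symmetric])
  finally show ?thesis .
qed

text \<open>On the image of \<open>P = isoproj k (specht F) \<circ> isoproj (Suc k) (specht E)\<close> both Jucys-Murphy elements are
  scalars \<open>x\<close> and \<open>y\<close>, so that \<open>jucys_murphy_swap\<close> yields \<open>(x - y) P s P = P\<close> for the transposition \<open>s\<close>.\<close>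

lemma proj_char_swap:
  assumes young_cover: "young_cover E D" and k: "card E = Suc k" and x: "x \<in> Sym (Suc k)"
    and ne: "\<And>F. young_cover F E \<Longrightarrow>
      total_content D - total_content E \<noteq> total_content E - total_content F"
  shows "proj_char D E (x \<circ> transpose (Suc k) (Suc (Suc k))) = (\<Sum>F | young_cover F E.
    inverse ((total_content D - total_content E) - (total_content E - total_content F)) * proj_char E F x)"
proof -
  let ?s = "transpose (Suc k) (Suc (Suc k))"
  let ?PE = "isoproj (Suc k) (specht E)" and ?W = "isoproj (Suc k) (specht E) ` specht D"
  note f = young_cover_facts[OF young_cover k]
  define a where "a = total_content D - total_content E"
  define d where "d = (\<lambda>F. a - (total_content E - total_content F))"
  have s: "?s \<in> Sym (Suc (Suc k))" by (rule transpose_Sym) auto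
  have Wk: "sym_mod k ?W" using sym_mod_mono[OF _ f(8), of k] by simp
  have Ek: "sym_mod k (specht E)" using sym_mod_mono[OF _ f(6), of k] by simp
  have s_comm: "perm_act ?s (perm_act g h) = perm_act g (perm_act ?s h)" if "g \<in> Sym k" for g h
  proof -
    have "g (Suc k) = Suc k" "g (Suc (Suc k)) = Suc (Suc k)" using Sym_fixes[OF that] by simp_all
    then show ?thesis by (simp add: perm_act_comp comp_transpose[OF that])
  qed
  have key: "?PE (perm_act ?s (isoproj k (specht F) v)) = fun_scale (inverse (d F)) (isoproj k (specht F) v)"
    if F: "young_cover F E" and v: "v \<in> ?W" for F v
  proof -
    let ?PF = "isoproj k (specht F)"
    have kF: "card F = k" using F k by (simp add: young_cover_def)
    note fF = young_cover_facts[OF F kF]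
    have PEF: "?PE (?PF h) = ?PF (?PE h)" for h
      by (rule isoproj_commute[OF lin_isoproj], rule isoproj_perm_act[OF f(6), symmetric],
          rule Sym_mono[of k]) simp_all
    define w where "w = ?PF v"
    have wW: "w \<in> ?W" unfolding w_def by (rule isoproj_in[OF Wk v])
    have wD: "w \<in> specht D" by (rule isoproj_image_mem[OF young_cover k wW])
    have PFw: "?PF w = w" unfolding w_def by (rule isoproj_idem[OF fF(7)])
    \<comment> \<open>The scalar is known on the part of type \<open>F\<close> of the Specht module
      of \<open>E\<close>; \<open>w\<close> lies in the copy of that module inside the larger
      one.\<close>
    have JM1: "jucys_murphy k w = fun_scale (total_content E - total_content F) w"
    proof (rule transfer_scalar[OF young_cover k lin_jucys_murphy, where U = "?PF ` specht E"])
      show "jucys_murphy k ` ?W \<subseteq> ?W"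
      proof (rule image_subsetI)
        fix u assume u: "u \<in> ?W"
        show "jucys_murphy k u \<in> ?W"
          unfolding jucys_murphy_def
          by (intro cfun.subspace_sum sym_mod_subspace[OF f(8)] sym_mod_act[OF f(8) _ u] transpose_Sym) auto
      qed
      show "A (jucys_murphy k v) = jucys_murphy k (A v)"
        if "lin A" "\<forall>g\<in>Sym (Suc k). \<forall>h. A (perm_act g h) = perm_act g (A h)" for A v
        unfolding jucys_murphy_def lin_simps(5)[OF that(1)]
        using that(2) transpose_Sym[of _ "Suc k" "Suc k"] by (intro sum.cong refl) auto
      show "jucys_murphy k u = fun_scale (total_content E - total_content F) u" if "u \<in> ?PF ` specht E" for u
        by (rule jucys_murphy_isoproj_image[OF F kF that])
      show "w \<in> ?W" by (rule wW)
      show "A w \<in> ?PF ` specht E"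
        if A: "lin A" "\<forall>g\<in>Sym (Suc k). \<forall>h. A (perm_act g h) = perm_act g (A h)" "A ` ?W = specht E" for A
      proof -
        have "A (?PF v) = ?PF (A v)"
          using A(2) Sym_mono[of k "Suc k"] by (intro isoproj_commute A(1)) simp
        moreover have "A v \<in> specht E" using A(3) v by blast
        ultimately show ?thesis by (simp add: w_def)
      qed
    qed
    define u where "u = ?PE (perm_act ?s w)"
    have sw: "perm_act ?s w \<in> specht D" by (rule sym_mod_act[OF f(4) s wD])
    have uW: "u \<in> ?W" unfolding u_def using sw by blast
    have "jucys_murphy (Suc k) (perm_act ?s w) =
        fun_scale (total_content E - total_content F) (perm_act ?s w) + w"
      by (simp add: jucys_murphy_swap JM1 perm_act_simps)
    then have "?PE (jucys_murphy (Suc k) (perm_act ?s w)) =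
        fun_scale (total_content E - total_content F) u + ?PE w"
      by (simp add: isoproj_simps u_def)
    moreover have "?PE (jucys_murphy (Suc k) (perm_act ?s w)) = jucys_murphy (Suc k) u"
      unfolding u_def
      by (rule isoproj_commute[symmetric, OF lin_jucys_murphy]) (rule jucys_murphy_perm_act)
    moreover have "jucys_murphy (Suc k) u = fun_scale a u"
      unfolding a_def by (rule jucys_murphy_isoproj_image[OF young_cover k uW])
    moreover have "?PE w = w" by (rule isoproj_fixes_image[OF young_cover k wW])
    ultimately have "fun_scale (d F) u = w"
      by (simp add: fun_eq_iff fun_scale_apply plus_fun_apply d_def algebra_simps)
    moreover have "d F \<noteq> 0" using ne[OF F] unfolding d_def a_def by (simp only: right_minus_eq not_False_eq_True)
    ultimately have "u = fun_scale (inverse (d F)) w" using cfun.scale_scale[of "inverse (d F)" "d F" u] by simp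
    then show ?thesis by (simp add: u_def w_def)
  qed
  let ?T = "\<lambda>v. \<Sum>F | young_cover F E. fun_scale (inverse (d F)) (perm_act x (isoproj k (specht F) v))"
  have pointwise: "?PE (perm_act (x \<circ> ?s) v) = ?T v" if v: "v \<in> ?W" for v
  proof -
    \<comment> \<open>The branching decomposition of the Specht module of \<open>E\<close>, pulled
      back to its copy inside the larger one.\<close>
    have dec: "v = (\<Sum>F | young_cover F E. isoproj k (specht F) v)"
    proof -
      obtain A A' where A: "lin A" "lin A'" "A ` ?W = specht E" "A' ` specht E \<subseteq> ?W"
        "\<forall>w\<in>specht E. A (A' w) = w" "\<forall>v\<in>?W. A' (A v) = v"
        "\<forall>g\<in>Sym (Suc k). \<forall>f. A (perm_act g f) = perm_act g (A f)"
        by (rule specht_branching_iso[OF young_cover f(3)])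
      have Av: "A v \<in> specht E" using A(3) v by blast
      have "A (\<Sum>F | young_cover F E. isoproj k (specht F) v) = (\<Sum>F | young_cover F E. isoproj k (specht F) (A v))"
        unfolding lin_simps(5)[OF A(1)] using A(7)
        by (intro sum.cong refl isoproj_commute A(1)) (simp add: Sym_mono[of k "Suc k"])
      also have "\<dots> = A v" by (rule dim_isoproj_image(2)[OF f(2) k Av])
      finally have "A' (A (\<Sum>F | young_cover F E. isoproj k (specht F) v)) = A' (A v)" by simp
      moreover have "(\<Sum>F | young_cover F E. isoproj k (specht F) v) \<in> ?W"
        using isoproj_in[OF Wk v] by (intro cfun.subspace_sum sym_mod_subspace[OF Wk])
      ultimately show ?thesis using bspec[OF A(6)] v by simp
    qed
    have "?PE (perm_act (x \<circ> ?s) v) = perm_act x (?PE (perm_act ?s v))"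
      using isoproj_perm_act[OF f(6) x] by (simp add: perm_act_comp[symmetric])
    also have "?PE (perm_act ?s v) = (\<Sum>F | young_cover F E. ?PE (perm_act ?s (isoproj k (specht F) v)))"
      by (subst dec) (simp add: perm_act_simps(5) isoproj_simps(5))
    also have "\<dots> = (\<Sum>F | young_cover F E. fun_scale (inverse (d F)) (isoproj k (specht F) v))"
      using key[OF _ v] by (intro sum.cong refl) simp
    finally show ?thesis by (simp only: perm_act_simps)
  qed
  have linT: "lin ?T"
    by (intro lin_sum_scale lin_compose[OF lin_perm_act lin_isoproj])
  have "proj_char D E (x \<circ> ?s) = trace_on ?W (\<lambda>v. ?PE (perm_act (x \<circ> ?s) v))"
    unfolding proj_char_def k
    by (rule proj_char_eq_trace_image[OF young_cover k lin_perm_act sym_mod_act_image[OF f(4)]])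
       (use x s Sym_mono[of "Suc k" "Suc (Suc k)" x] in simp)
  also have "\<dots> = trace_on ?W ?T" by (rule trace_cong[OF sym_mod_fin_dim[OF f(8)] pointwise])
  also have "\<dots> = trace_on (specht E) ?T"
  proof (rule trace_isoproj_image[OF young_cover k linT])
    show "?T ` ?W \<subseteq> ?W"
    proof (rule image_subsetI)
      fix u assume u: "u \<in> ?W"
      show "?T u \<in> ?W"
        by (intro cfun.subspace_sum cfun.subspace_scale sym_mod_subspace[OF f(8)] sym_mod_act[OF f(8) x]
            isoproj_in[OF Wk u])
    qed
    fix A v assume A: "lin A" "\<forall>g\<in>Sym (Suc k). \<forall>h. A (perm_act g h) = perm_act g (A h)"
    have "A (isoproj k S v) = isoproj k S (A v)" for S
      using A(2) Sym_mono[of k "Suc k"] by (intro isoproj_commute A(1)) simp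
    then show "A (?T v) = ?T (A v)" using A x by (simp add: lin_simps(2,5)[OF A(1)])
  qed
  also have "\<dots> = (\<Sum>F | young_cover F E. inverse (d F) * trace_on (specht E) (\<lambda>v. perm_act x (isoproj k (specht F) v)))"
    using isoproj_in[OF Ek] sym_mod_act[OF f(6) x]
    by (intro trace_sum_scale sym_mod_fin_dim[OF f(6)]) blast
  also have "\<dots> = (\<Sum>F | young_cover F E. inverse (d F) * proj_char E F x)"
    using k by (intro sum.cong refl) (simp add: proj_char_def young_cover_def)
  finally show ?thesis by (simp add: d_def a_def)
qed

section \<open>Broken border strips\<close>

lemma inverse_mult_inverse:
  fixes p q :: "'a :: field"
  assumes "p \<noteq> 0" "q \<noteq> 0" "p + q \<noteq> 0"
  shows "inverse p * inverse q = inverse (p + q) * (inverse p - inverse (- q))"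
  using assms by (simp add: divide_simps)

text \<open>In the induction step the factors with the new pole are split by
  \<open>inverse_mult_inverse\<close>; the two sums that arise are the induction hypothesis at
  \<open>x\<close> and at \<open>y b\<close>.\<close>

lemma partial_fractions:
  fixes x :: "'a :: field"
  assumes "finite B" "B \<noteq> {}" "inj_on y B" "x \<notin> y ` B"
  shows "(\<Sum>d\<in>B. inverse (x - y d) * (\<Prod>d'\<in>B - {d}. inverse (y d - y d'))) =
    (\<Prod>d\<in>B. inverse (x - y d))"
  using assms
proof (induction B arbitrary: x rule: finite_ne_induct)
  case (singleton b)
  then show ?case by simp
next
  case (insert b B)
  let ?L = "\<lambda>x d. inverse (x - y d) * (\<Prod>d'\<in>B - {d}. inverse (y d - y d'))"
  have inj: "inj_on y B" and yb: "y b \<notin> y ` B" using insert by (auto simp: inj_on_def)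
  have xb: "x \<noteq> y b" using insert by auto
  have B: "(\<Sum>d\<in>B. ?L x d) = (\<Prod>d\<in>B. inverse (x - y d))" "(\<Sum>d\<in>B. ?L (y b) d) = (\<Prod>d\<in>B. inverse (y b - y d))"
    using insert.IH[OF inj] yb insert.prems by auto
  have step: "inverse (x - y d) * (\<Prod>d'\<in>insert b B - {d}. inverse (y d - y d')) =
      inverse (x - y b) * (?L x d - ?L (y b) d)" if d: "d \<in> B" for d
  proof -
    have "insert b B - {d} = insert b (B - {d})" using d insert by auto
    then have P: "(\<Prod>d'\<in>insert b B - {d}. inverse (y d - y d')) =
        inverse (y d - y b) * (\<Prod>d'\<in>B - {d}. inverse (y d - y d'))"
      using insert by (simp add: prod.insert)
    have "y d \<in> y ` B" using d by blast
    then have "y d \<noteq> y b" "x \<noteq> y d" using yb insert.prems(2) by auto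
    then have "inverse (x - y d) * inverse (y d - y b) =
        inverse (x - y b) * (inverse (x - y d) - inverse (y b - y d))"
      using xb inverse_mult_inverse[of "x - y d" "y d - y b"] by simp
    then show ?thesis
      unfolding P mult.assoc[symmetric] by (simp only: left_diff_distrib right_diff_distrib mult.assoc)
  qed
  have "(\<Sum>d\<in>insert b B. inverse (x - y d) * (\<Prod>d'\<in>insert b B - {d}. inverse (y d - y d'))) =
    inverse (x - y b) * (\<Prod>d\<in>B. inverse (y b - y d)) + (\<Sum>d\<in>B. inverse (x - y b) * (?L x d - ?L (y b) d))"
    using insert step by (simp add: insert_Diff_if)
  also have "(\<Sum>d\<in>B. inverse (x - y b) * (?L x d - ?L (y b) d)) =
      inverse (x - y b) * ((\<Prod>d\<in>B. inverse (x - y d)) - (\<Prod>d\<in>B. inverse (y b - y d)))"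
    by (simp only: sum_distrib_left[symmetric] sum_subtractf B)
  also have "inverse (x - y b) * (\<Prod>d\<in>B. inverse (y b - y d)) + \<dots> = (\<Prod>d\<in>insert b B. inverse (x - y d))"
    using insert by (simp add: algebra_simps)
  finally show ?case .
qed

text \<open>Induction on \<open>A\<close>: writing \<open>y d - z a = (x - z a) - (x - y d)\<close> leaves a sum without the
  factor \<open>inverse (x - y d)\<close>; it vanishes, as it is the difference of both sides of the induction
  hypothesis for \<open>B - {b}\<close> at the point \<open>y b\<close>.\<close>

lemma partial_fractions_numerator:
  fixes x :: "'a :: field"
  assumes "finite A" "finite B" "card A < card B" "inj_on y B" "x \<notin> y ` B"
  shows "(\<Sum>d\<in>B. inverse (x - y d) * ((\<Prod>s\<in>A. y d - z s) * (\<Prod>d'\<in>B - {d}. inverse (y d - y d')))) =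
    (\<Prod>s\<in>A. x - z s) * (\<Prod>d\<in>B. inverse (x - y d))"
  using assms
proof (induction A arbitrary: B x rule: finite_induct)
  case empty
  then have "B \<noteq> {}" by auto
  with empty show ?case using partial_fractions[of B y x] by simp
next
  case (insert a A)
  let ?Q = "\<lambda>B d. (\<Prod>s\<in>A. y d - z s) * (\<Prod>d'\<in>B - {d}. inverse (y d - y d'))"
  have card: "card A < card B" "Suc (card A) < card B" using insert by auto
  obtain b where b: "b \<in> B" using card by fastforce
  define C where "C = B - {b}"
  have C: "B = insert b C" "b \<notin> C" "finite C" "card A < card C" "inj_on y C" "y b \<notin> y ` C"
    using b insert.prems card by (auto simp: C_def inj_on_def)
  have "?Q B d = - (inverse (y b - y d) * ?Q C d)" if "d \<in> C" for d
  proof -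
    have "B - {d} = insert b (C - {d})" using C that by auto
    then have "(\<Prod>d'\<in>B - {d}. inverse (y d - y d')) = inverse (y d - y b) * (\<Prod>d'\<in>C - {d}. inverse (y d - y d'))"
      using C by (simp add: prod.insert)
    moreover have "inverse (y d - y b) = - inverse (y b - y d)"
      by (metis inverse_minus_eq minus_diff_eq)
    ultimately show ?thesis by (simp add: algebra_simps)
  qed
  then have "(\<Sum>d\<in>C. ?Q B d) = - (\<Sum>d\<in>C. inverse (y b - y d) * ?Q C d)"
    by (simp add: sum_negf)
  also have "\<dots> = - ?Q B b"
    using insert.IH[OF C(3-6)] C(1,2) by simp
  finally have "(\<Sum>d\<in>C. ?Q B d) + ?Q B b = 0" by simp
  moreover have "(\<Sum>d\<in>B. ?Q B d) = ?Q B b + (\<Sum>d\<in>C. ?Q B d)"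
    using sum.remove[OF insert.prems(1) b, of "?Q B"] by (simp only: C_def)
  ultimately have zero: "(\<Sum>d\<in>B. ?Q B d) = 0" by (simp only: add.commute)
  have "(\<Sum>d\<in>B. inverse (x - y d) * ((\<Prod>s\<in>insert a A. y d - z s) * (\<Prod>d'\<in>B - {d}. inverse (y d - y d')))) =
    (\<Sum>d\<in>B. (x - z a) * (inverse (x - y d) * ?Q B d) - ?Q B d)"
  proof (rule sum.cong[OF refl])
    fix d assume "d \<in> B"
    then have "x - y d \<noteq> 0" using insert.prems by auto
    then have "inverse (x - y d) * (y d - z a) = (x - z a) * inverse (x - y d) - 1"
      by (simp add: field_simps)
    note E = this
    have P: "(\<Prod>s\<in>insert a A. y d - z s) = (y d - z a) * (\<Prod>s\<in>A. y d - z s)"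
      using insert by simp
    have "inverse (x - y d) * ((\<Prod>s\<in>insert a A. y d - z s) * (\<Prod>d'\<in>B - {d}. inverse (y d - y d'))) =
      (inverse (x - y d) * (y d - z a)) * ?Q B d"
      unfolding P by (simp only: mult.assoc)
    also have "\<dots> = (x - z a) * (inverse (x - y d) * ?Q B d) - ?Q B d"
      unfolding E by (simp only: left_diff_distrib mult.assoc mult_1_left)
    finally show "inverse (x - y d) * ((\<Prod>s\<in>insert a A. y d - z s) * (\<Prod>d'\<in>B - {d}. inverse (y d - y d'))) =
      (x - z a) * (inverse (x - y d) * ?Q B d) - ?Q B d" .
  qed
  also have "\<dots> = (x - z a) * (\<Sum>d\<in>B. inverse (x - y d) * ?Q B d)"
    by (simp only: sum_subtractf zero sum_distrib_left diff_0_right)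
  also have "(\<Sum>d\<in>B. inverse (x - y d) * ?Q B d) = (\<Prod>s\<in>A. x - z s) * (\<Prod>d\<in>B. inverse (x - y d))"
    by (rule insert.IH[OF insert.prems(1) card(1) insert.prems(3,4)])
  finally show ?case using insert by (simp add: mult.assoc)
qed

text \<open>Order-convexity is the intrinsic property of a difference of Young diagrams on which the
  strip arguments rest, so no pair of diagrams has to be carried along.\<close>

definition skew :: "box set \<Rightarrow> bool" where
  "skew S \<longleftrightarrow> finite S \<and> (\<forall>i j i' j' a b. (i, j) \<in> S \<longrightarrow> (i', j') \<in> S \<longrightarrow>
     i \<le> a \<longrightarrow> a \<le> i' \<longrightarrow> j \<le> b \<longrightarrow> b \<le> j' \<longrightarrow> (a, b) \<in> S)"

lemma skewD:
  "skew S \<Longrightarrow> (i, j) \<in> S \<Longrightarrow> (i', j') \<in> S \<Longrightarrow> i \<le> a \<Longrightarrow> a \<le> i' \<Longrightarrow> j \<le> b \<Longrightarrow> b \<le> j' \<Longrightarrow> (a, b) \<in> S"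
  unfolding skew_def by blast

lemma skew_finite: "skew S \<Longrightarrow> finite S"
  by (simp add: skew_def)

lemma skew_Diff:
  assumes "young E" "young N"
  shows "skew (E - N)"
  unfolding skew_def
proof (intro conjI allI impI)
  show "finite (E - N)" using young_finite[OF assms(1)] by simp
  fix i j i' j' a b
  assume 1: "(i, j) \<in> E - N" "(i', j') \<in> E - N" and 2: "i \<le> a" "a \<le> i'" "j \<le> b" "b \<le> j'"
  have p: "1 \<le> i" "1 \<le> j" using young_pos[OF assms(1)] 1 by blast+
  have "(a, b) \<in> E" using young_down[OF assms(1), of i' j' a b] 1 2 p by simp
  moreover have "(a, b) \<notin> N" using young_down[OF assms(2), of a b i j] 1 2 p by blast
  ultimately show "(a, b) \<in> E - N" by simp
qed

lemma broken_border_stripD: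
  "broken_border_strip S \<Longrightarrow> (i, j) \<in> S \<Longrightarrow> (Suc i, j) \<in> S \<Longrightarrow> (i, Suc j) \<in> S \<Longrightarrow> (Suc i, Suc j) \<in> S \<Longrightarrow> False"
  unfolding broken_border_strip_def by auto

lemma content_diagonal:
  assumes "content (i, j) = content (i', j')" "(i, j) \<noteq> (i', j')"
  shows "i < i' \<and> j < j' \<or> i' < i \<and> j' < j"
  using assms by (auto simp: content_def)

text \<open>Of two boxes on one diagonal, one lies strictly below and to the right of the other, and
  convexity then fills in a 2 x 2 block.\<close>

lemma content_inj_on_strip:
  assumes "skew S" "broken_border_strip S"
  shows "inj_on content S"
proof (rule inj_onI, rule ccontr)
  have *: False if "(i, j) \<in> S" "(i', j') \<in> S" "i < i'" "j < j'" for i j i' j'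
    using skewD[OF assms(1) that(1,2)] that
    by (intro broken_border_stripD[OF assms(2), of i j]) auto
  fix a b assume ab: "a \<in> S" "b \<in> S" "content a = content b" "a \<noteq> b"
  then show False
    using content_diagonal[of "fst a" "snd a" "fst b" "snd b"]
      *[of "fst a" "snd a" "fst b" "snd b"] *[of "fst b" "snd b" "fst a" "snd a"] by auto
qed

lemma dull_boxesD:
  "(i, j) \<in> dull_boxes S \<longleftrightarrow> (i, j) \<in> S \<and> (Suc i, j) \<notin> S \<and> (i, Suc j) \<notin> S"
  by (simp add: dull_boxes_def)

lemma sharp_cornersD:
  "(i, j) \<in> sharp_corners S \<longleftrightarrow> (i, j) \<in> S \<and> (Suc i, j) \<in> S \<and> (i, Suc j) \<in> S"
  by (simp add: sharp_corners_def)

lemma dull_boxes_subset: "dull_boxes S \<subseteq> S"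
  by (auto simp: dull_boxes_def)

lemma sharp_corners_subset: "sharp_corners S \<subseteq> S"
  by (auto simp: sharp_corners_def)

text \<open>Sharp corners are the boxes with two, dull boxes those with no forward edge (down or right), so
  the claim says that there are fewer edges than boxes.  An edge is determined by the larger content
  of its two ends, and the box of smallest content is not such an end.\<close>

lemma card_sharp_corners_less:
  assumes "skew S" "broken_border_strip S" "S \<noteq> {}"
  shows "card (sharp_corners S) < card (dull_boxes S)"
proof -
  have fin: "finite S" by (rule skew_finite[OF assms(1)])
  have inj: "a = b" if "a \<in> S" "b \<in> S" "content a = content b" for a b
    using inj_onD[OF content_inj_on_strip[OF assms(1,2)] that(3,1,2)] .
  let ?down = "{b\<in>S. (Suc (fst b), snd b) \<in> S}" and ?right = "{b\<in>S. (fst b, Suc (snd b)) \<in> S}"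
  \<comment> \<open>A horizontal edge is moved from its left to its right end, the end of larger
    content; for a vertical edge that is the upper end, already collected in
    \<open>?down\<close>.\<close>
  let ?R' = "(\<lambda>b. (fst b, Suc (snd b))) ` ?right"
  define m where "m = arg_min_on content S"
  have m: "m \<in> S" "content m \<le> content b" if "b \<in> S" for b
    using arg_min_if_finite[OF fin assms(3), of content] that unfolding m_def by force+
  have "card ?R' = card ?right" by (rule card_image) (auto simp: inj_on_def)
  moreover have disj: "?R' \<inter> ?down = {}"
  proof (rule equals0I)
    fix x assume "x \<in> ?R' \<inter> ?down"
    then obtain b where b: "b \<in> ?right" "x = (fst b, Suc (snd b))" and x: "x \<in> ?down" by blast
    have "b = (Suc (fst x), snd x)"
      using b x by (intro inj) (auto simp: content_def)
    then show False using b(2) by (metis fst_conv n_not_Suc_n)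
  qed
  moreover have sub: "?R' \<union> ?down \<subseteq> S - {m}"
  proof
    fix x assume x: "x \<in> ?R' \<union> ?down"
    then have "x \<in> S" by auto
    have "\<exists>b\<in>S. content b < content x"
    proof (cases "x \<in> ?down")
      case True
      then show ?thesis by (intro bexI[of _ "(Suc (fst x), snd x)"]) (auto simp: content_def)
    next
      case False
      then obtain b where b: "b \<in> ?right" "x = (fst b, Suc (snd b))" using x by blast
      then show ?thesis by (intro bexI[of _ b]) (auto simp: content_def)
    qed
    then show "x \<in> S - {m}" using \<open>x \<in> S\<close> m(2) by force
  qed
  ultimately have "card ?right + card ?down \<le> card (S - {m})"
    using fin card_mono[OF _ sub] card_Un_disjoint[of ?R' ?down] by simp
  moreover have "card (S - {m}) < card S" using m fin assms(3) by (intro card_Diff1_less) auto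
  moreover have "card ?right + card ?down = card (?right \<union> ?down) + card (?right \<inter> ?down)"
    using fin by (intro card_Un_Int) auto
  moreover have "?right \<inter> ?down = sharp_corners S" by (auto simp: sharp_corners_def)
  moreover have "card S = card (?right \<union> ?down) + card (dull_boxes S)"
  proof -
    have "S = (?right \<union> ?down) \<union> dull_boxes S" by (auto simp: dull_boxes_def)
    moreover have "(?right \<union> ?down) \<inter> dull_boxes S = {}" by (auto simp: dull_boxes_def)
    ultimately show ?thesis
      using fin card_Un_disjoint[of "?right \<union> ?down" "dull_boxes S"] finite_subset[OF dull_boxes_subset fin]
      by simp
  qed
  ultimately show ?thesis by simp
qed

text \<open>For skew broken border strips this is the height, by
  \<open>strip_height_eq_vert\<close>. Being a count over single boxes, it shows directly how the
  height changes when a box is added.\<close>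

definition vert :: "box set \<Rightarrow> nat" where
  "vert S = card {b\<in>S. (Suc (fst b), snd b) \<in> S}"

abbreviation adj :: "box set \<Rightarrow> (box \<times> box) set" where
  "adj S \<equiv> {(a, b). a \<in> S \<and> b \<in> S \<and> shares_edge a b}"

lemma sym_adj: "sym (adj S)"
  by (auto simp: sym_def shares_edge_def)

lemma adj_component_eq:
  assumes "b \<in> (adj S)\<^sup>* `` {a}"
  shows "(adj S)\<^sup>* `` {b} = (adj S)\<^sup>* `` {a}"
proof -
  have ab: "(a, b) \<in> (adj S)\<^sup>*" using assms by simp
  then have ba: "(b, a) \<in> (adj S)\<^sup>*" by (rule symD[OF sym_rtrancl[OF sym_adj]])
  show ?thesis
  proof (rule set_eqI)
    fix x
    have "(a, x) \<in> (adj S)\<^sup>* \<longleftrightarrow> (b, x) \<in> (adj S)\<^sup>*"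
      using rtrancl_trans[OF ab, of x] rtrancl_trans[OF ba, of x] by blast
    then show "x \<in> (adj S)\<^sup>* `` {b} \<longleftrightarrow> x \<in> (adj S)\<^sup>* `` {a}" by simp
  qed
qed

lemma box_components_disjoint:
  assumes "C \<in> box_components S" "b \<in> C"
  shows "C = (adj S)\<^sup>* `` {b}"
  using assms adj_component_eq unfolding box_components_def by blast

lemma box_components_subset:
  assumes "C \<in> box_components S" shows "C \<subseteq> S"
proof
  obtain a where a: "a \<in> S" "C = (adj S)\<^sup>* `` {a}" using assms unfolding box_components_def by blast
  fix b assume "b \<in> C"
  then have "(a, b) \<in> (adj S)\<^sup>*" using a by blast
  then show "b \<in> S" using a(1) by (induction rule: rtrancl_induct) auto
qed

lemma box_components_step:
  assumes "C \<in> box_components S" "b \<in> C" "b' \<in> S" "shares_edge b b'"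
  shows "b' \<in> C"
proof -
  have "b \<in> S" using box_components_subset assms by blast
  then have "(b, b') \<in> (adj S)\<^sup>*" using assms by (intro r_into_rtrancl) simp
  then show ?thesis using box_components_disjoint[OF assms(1,2)] by blast
qed

text \<open>Every row of the component except the lowest has exactly one box with a box beneath it:
  two would give a 2 x 2 block by convexity, and with none no path could descend to the lowest
  row.\<close>

lemma component_height:
  assumes "skew S" "broken_border_strip S" "C \<in> box_components S"
  shows "card (fst ` C) - 1 = card {b\<in>C. (Suc (fst b), snd b) \<in> S}"
proof -
  let ?V = "{b\<in>C. (Suc (fst b), snd b) \<in> S}"
  have CS: "C \<subseteq> S" by (rule box_components_subset[OF assms(3)])
  have fin: "finite C" using CS skew_finite[OF assms(1)] finite_subset by blast
  have ne: "C \<noteq> {}" using assms(3) unfolding box_components_def by blast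
  define M where "M = Max (fst ` C)"
  have M: "M \<in> fst ` C" "\<And>b. b \<in> C \<Longrightarrow> fst b \<le> M" using fin ne by (auto simp: M_def)
  have inj: "inj_on fst ?V"
  proof (rule inj_onI, rule ccontr)
    have *: False if "(i, j) \<in> S" "(Suc i, j) \<in> S" "(i, j') \<in> S" "(Suc i, j') \<in> S" "j < j'" for i j j'
      using skewD[OF assms(1) that(1,3), of i "Suc j"] skewD[OF assms(1) that(2,4), of "Suc i" "Suc j"] that
      by (intro broken_border_stripD[OF assms(2) that(1,2)]) simp_all
    fix a b assume ab: "a \<in> ?V" "b \<in> ?V" "fst a = fst b" "a \<noteq> b"
    obtain i j where a: "a = (i, j)" by (cases a)
    obtain j' where b: "b = (i, j')" using ab(3) a by (cases b) simp
    have S: "(i, j) \<in> S" "(Suc i, j) \<in> S" "(i, j') \<in> S" "(Suc i, j') \<in> S"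
      using ab(1,2) CS by (auto simp: a b)
    have "j < j' \<or> j' < j" using ab(4) a b by auto
    then show False using *[OF S] *[OF S(3,4,1,2)] by blast
  qed
  have "fst ` ?V = fst ` C - {M}"
  proof (intro equalityI subsetI)
    fix i assume "i \<in> fst ` ?V"
    then obtain b where b: "b \<in> ?V" "i = fst b" by blast
    have bC: "b \<in> C" and bS: "(Suc (fst b), snd b) \<in> S" using b(1) by simp_all
    have "(Suc (fst b), snd b) \<in> C"
      by (rule box_components_step[OF assms(3) bC bS]) (simp add: shares_edge_def)
    from M(2)[OF this] have "Suc i \<le> M" using b by simp
    then show "i \<in> fst ` C - {M}" using bC b(2) by simp
  next
    fix i assume i: "i \<in> fst ` C - {M}"
    then obtain b where b: "b \<in> C" "fst b = i" by blast
    obtain t where t: "t \<in> C" "fst t = M" using M(1) by blast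
    show "i \<in> fst ` ?V"
    proof (rule ccontr)
      assume no: "i \<notin> fst ` ?V"
      have "t \<in> (adj S)\<^sup>* `` {b}" using t(1) by (subst (asm) box_components_disjoint[OF assms(3) b(1)])
      then have "(b, t) \<in> (adj S)\<^sup>*" by simp
      then have "t \<in> C \<and> fst t \<le> i"
      proof (induction rule: rtrancl_induct)
        case base
        then show ?case using b by simp
      next
        case (step u v)
        then have uv: "u \<in> C" "fst u \<le> i" "v \<in> S" "shares_edge u v" by auto
        have "v \<in> C" by (rule box_components_step[OF assms(3) uv(1,3,4)])
        moreover have "fst v \<le> i"
        proof (rule ccontr)
          assume "\<not> fst v \<le> i"
          then have "fst u = i" "v = (Suc (fst u), snd u)"
            using uv(2,4) by (auto simp: shares_edge_def prod_eq_iff)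
          then have "u \<in> ?V" using uv by simp
          then show False using no \<open>fst u = i\<close> by blast
        qed
        ultimately show ?case by simp
      qed
      then show False using t i M(2)[OF b(1)] b by simp
    qed
  qed
  then have "card ?V = card (fst ` C - {M})" using card_image[OF inj] by simp
  also have "\<dots> = card (fst ` C) - 1" using M(1) fin by simp
  finally show ?thesis ..
qed

lemma strip_height_eq_vert:
  assumes "skew S" "broken_border_strip S"
  shows "strip_height S = vert S"
proof -
  let ?V = "\<lambda>C. {b\<in>C. (Suc (fst b), snd b) \<in> S}"
  have fin: "finite S" by (rule skew_finite[OF assms(1)])
  have finC: "finite (box_components S)" unfolding box_components_def using fin by simp
  have un: "?V S = (\<Union>C\<in>box_components S. ?V C)"
  proof (intro equalityI subsetI)
    fix b assume b: "b \<in> ?V S"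
    then have "(adj S)\<^sup>* `` {b} \<in> box_components S" "b \<in> (adj S)\<^sup>* `` {b}"
      unfolding box_components_def by auto
    then show "b \<in> (\<Union>C\<in>box_components S. ?V C)" using b by blast
  next
    fix b assume "b \<in> (\<Union>C\<in>box_components S. ?V C)"
    then show "b \<in> ?V S" using box_components_subset by blast
  qed
  have "vert S = (\<Sum>C\<in>box_components S. card (?V C))"
    unfolding vert_def un
  proof (rule card_UN_disjoint[OF finC])
    show "\<forall>C\<in>box_components S. finite (?V C)"
    proof
      fix C assume "C \<in> box_components S"
      then have "finite C" using box_components_subset fin by (intro finite_subset[of C S])
      then show "finite (?V C)" by simp
    qed
    show "\<forall>C\<in>box_components S. \<forall>C'\<in>box_components S. C \<noteq> C' \<longrightarrow> ?V C \<inter> ?V C' = {}"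
    proof (intro ballI impI equals0I)
      fix C C' b assume "C \<in> box_components S" "C' \<in> box_components S" "C \<noteq> C'" "b \<in> ?V C \<inter> ?V C'"
      then show False using box_components_disjoint[of C S b] box_components_disjoint[of C' S b] by simp
    qed
  qed
  then show ?thesis unfolding strip_height_def using component_height[OF assms] by simp
qed

section \<open>The coefficients and their recursion\<close>

definition strip_phi :: "box \<Rightarrow> box set \<Rightarrow> complex" where
  "strip_phi e S = (if broken_border_strip S then
     (-1) ^ strip_height S * (\<Prod>s\<in>sharp_corners S. of_int (content e - content s)) *
     (\<Prod>d\<in>dull_boxes S - {e}. inverse (of_int (content e - content d))) else 0)"

lemma phi_eq_strip_phi:
  "phi mu lam nu = strip_phi (the_elem (diagram lam - diagram mu)) (diagram lam - diagram nu)"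
  by (simp add: phi_def strip_phi_def Let_def)

text \<open>Collecting the sign and both products into one product over \<open>S\<close> allows a
  box-by-box comparison.\<close>

lemma prod_filter_split:
  fixes g h :: "'a \<Rightarrow> complex"
  assumes "finite S"
  shows "(-1) ^ card {b\<in>S. P b} * prod g {b\<in>S. Q b} * prod h {b\<in>S. R b} =
    (\<Prod>b\<in>S. (if P b then -1 else 1) * (if Q b then g b else 1) * (if R b then h b else 1))"
proof -
  have "(-1) ^ card {b\<in>S. P b} = (\<Prod>b\<in>{b\<in>S. P b}. -1 :: complex)" by simp
  then show ?thesis by (simp only: prod.inter_filter[OF assms] prod.distrib)
qed

text \<open>Adding the corner \<open>e\<close> to \<open>S\<close> only affects the boxes to the left of and above \<open>e\<close>, and for each of
  them the changes of its contributions (to the height, to the sharp corners, and to the dull boxes)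
  cancel, since its content differs from that of \<open>e\<close> by 1.\<close>

lemma strip_phi_insert_corner:
  assumes "skew (insert e S)" "finite S" "e \<notin> S" "(Suc (fst e), snd e) \<notin> S" "(fst e, Suc (snd e)) \<notin> S"
    "broken_border_strip (insert e S)"
  shows "strip_phi e (insert e S) = (-1) ^ vert S *
    (\<Prod>s\<in>sharp_corners S. of_int (content e - content s)) *
    (\<Prod>d\<in>dull_boxes S. inverse (of_int (content e - content d)))"
proof -
  let ?T = "insert e S"
  obtain p q where e: "e = (p, q)" by (cases e)
  let ?g = "\<lambda>b. of_int (content e - content b) :: complex"
  have T: "{b\<in>?T. (Suc (fst b), snd b) \<in> ?T} = {b\<in>S. (Suc (fst b), snd b) \<in> ?T}"
    "sharp_corners ?T = {b\<in>S. b \<in> sharp_corners ?T}" "dull_boxes ?T - {e} = {b\<in>S. b \<in> dull_boxes ?T}"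
    using assms(3-5) by (auto simp: sharp_corners_def dull_boxes_def e)
  have S: "sharp_corners S = {b\<in>S. b \<in> sharp_corners S}" "dull_boxes S = {b\<in>S. b \<in> dull_boxes S}"
    by (auto simp: sharp_corners_def dull_boxes_def)
  have "strip_phi e ?T = (-1) ^ card {b\<in>S. (Suc (fst b), snd b) \<in> ?T} *
      prod ?g {b\<in>S. b \<in> sharp_corners ?T} * prod (\<lambda>b. inverse (?g b)) {b\<in>S. b \<in> dull_boxes ?T}"
    using assms(6) strip_height_eq_vert[OF assms(1,6)] unfolding strip_phi_def vert_def
    by (simp only: if_True T[symmetric])
  also have "\<dots> = (\<Prod>b\<in>S. (if (Suc (fst b), snd b) \<in> ?T then -1 else 1) *
      (if b \<in> sharp_corners ?T then ?g b else 1) * (if b \<in> dull_boxes ?T then inverse (?g b) else 1))"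
    by (rule prod_filter_split[OF assms(2)])
  also have "\<dots> = (\<Prod>b\<in>S. (if (Suc (fst b), snd b) \<in> S then -1 else 1) *
      (if b \<in> sharp_corners S then ?g b else 1) * (if b \<in> dull_boxes S then inverse (?g b) else 1))"
  proof (rule prod.cong[OF refl])
    fix b assume bS: "b \<in> S"
    obtain i j where b: "b = (i, j)" by (cases b)
    consider "i = p" "Suc j = q" | "Suc i = p" "j = q"
      | "(Suc i, j) \<noteq> e" "(i, Suc j) \<noteq> e" using e by auto
    then show "(if (Suc (fst b), snd b) \<in> ?T then -1 else 1) *
      (if b \<in> sharp_corners ?T then ?g b else 1) * (if b \<in> dull_boxes ?T then inverse (?g b) else 1) =
      (if (Suc (fst b), snd b) \<in> S then -1 else 1) *
      (if b \<in> sharp_corners S then ?g b else 1) * (if b \<in> dull_boxes S then inverse (?g b) else 1)"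
    proof cases
      case 1
      \<comment> \<open>The box to the left of \<open>e\<close> has factor 1, so becoming sharp or
        ceasing to be dull changes nothing.\<close>
      then have "?g b = 1" by (auto simp: content_def e b)
      then show ?thesis using 1 by (auto simp: e b)
    next
      case 2
      \<comment> \<open>The box above \<open>e\<close> gains a vertical edge, hence a sign -1. If it
        has a right neighbour it becomes a sharp corner with factor -1; otherwise it ceases to be
        dull and loses a factor -1.\<close>
      then have g: "content (i, j) = content e + 1" by (auto simp: content_def e)
      have r: "(i, Suc j) \<noteq> e" "(Suc i, j) = e" using 2 e by auto
      have notS: "(Suc i, j) \<notin> S" using r assms(3) by simp
      show ?thesis
        using bS notS r by (simp add: sharp_cornersD dull_boxesD b g)
    next
      case 3
      then show ?thesis using bS by (simp add: sharp_cornersD dull_boxesD b)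
    qed
  qed
  also have "\<dots> = (-1) ^ vert S * prod ?g {b\<in>S. b \<in> sharp_corners S} *
      prod (\<lambda>b. inverse (?g b)) {b\<in>S. b \<in> dull_boxes S}"
    unfolding vert_def by (rule prod_filter_split[OF assms(2), symmetric])
  finally show ?thesis unfolding S[symmetric] .
qed

lemma broken_border_strip_subset: "broken_border_strip T \<Longrightarrow> S \<subseteq> T \<Longrightarrow> broken_border_strip S"
  unfolding broken_border_strip_def by blast

text \<open>The only new \<open>2 \<times> 2\<close> block has \<open>e\<close> as its last box, so its first box is a sharp corner of \<open>S\<close> with
  the content of \<open>e\<close>.\<close>

lemma sharp_corner_of_new_block:
  assumes "e \<notin> S" "(Suc (fst e), snd e) \<notin> S" "(fst e, Suc (snd e)) \<notin> S"
    "broken_border_strip S" "\<not> broken_border_strip (insert e S)"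
  obtains s where "s \<in> sharp_corners S" "content s = content e"
proof -
  obtain i j where b: "(i, j) \<in> insert e S" "(Suc i, j) \<in> insert e S" "(i, Suc j) \<in> insert e S"
    "(Suc i, Suc j) \<in> insert e S"
    using assms(5) unfolding broken_border_strip_def by auto
  have ne: "(i, j) \<noteq> e" "(Suc i, j) \<noteq> e" "(i, Suc j) \<noteq> e" using b assms(1-3) by auto
  then have S: "(i, j) \<in> S" "(Suc i, j) \<in> S" "(i, Suc j) \<in> S" using b by auto
  then have "e = (Suc i, Suc j)" using b(4) broken_border_stripD[OF assms(4) S] by auto
  then show ?thesis using that[of "(i, j)"] S by (auto simp: sharp_cornersD content_def)
qed

text \<open>If some box of \<open>S\<close> lay strictly below and to the right of a dull box,
  convexity would put the box directly beneath the dull one into \<open>S\<close>.\<close>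

lemma dull_boxes_content_inj:
  assumes "skew S" shows "inj_on content (dull_boxes S)"
proof (rule inj_onI, rule ccontr)
  have *: False if "(i, j) \<in> dull_boxes S" "(i', j') \<in> S" "i < i'" "j < j'" for i j i' j'
    using skewD[OF assms, of i j i' j' "Suc i" j] that by (auto simp: dull_boxesD)
  fix a b assume ab: "a \<in> dull_boxes S" "b \<in> dull_boxes S" "content a = content b" "a \<noteq> b"
  obtain i j i' j' where ij: "a = (i, j)" "b = (i', j')" by (cases a, cases b) auto
  have "(i, j) \<in> S" "(i', j') \<in> S" using ab dull_boxes_subset ij by blast+
  then show False
    using content_diagonal[of i j i' j'] ab ij *[of i j i' j'] *[of i' j' i j] by auto
qed

lemma young_cover_corner:
  assumes "young_cover E D" "D = insert e E" "e \<notin> E"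
  shows "(Suc (fst e), snd e) \<notin> D" "(fst e, Suc (snd e)) \<notin> D"
proof -
  have Y: "young D" "young E" using assms by (auto simp: young_cover_def)
  have p: "1 \<le> fst e" "1 \<le> snd e" using young_pos[OF Y(1), of "fst e" "snd e"] assms(2) by simp_all
  show "(Suc (fst e), snd e) \<notin> D"
  proof
    assume "(Suc (fst e), snd e) \<in> D"
    then have "(Suc (fst e), snd e) \<in> E" using assms(2) by (cases e) auto
    from young_down[OF Y(2) this, of "fst e" "snd e"] have "(fst e, snd e) \<in> E" using p by simp
    then show False using assms(3) by simp
  qed
  show "(fst e, Suc (snd e)) \<notin> D"
  proof
    assume "(fst e, Suc (snd e)) \<in> D"
    then have "(fst e, Suc (snd e)) \<in> E" using assms(2) by (cases e) auto
    from young_down[OF Y(2) this, of "fst e" "snd e"] have "(fst e, snd e) \<in> E" using p by simp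
    then show False using assms(3) by simp
  qed
qed

text \<open>This keeps the denominators nonzero. A dull box on the diagonal of \<open>e\<close> and
  above it would have its lower neighbour in \<open>E - N\<close>; one below it would force
  \<open>e\<close> into \<open>E\<close>.\<close>

lemma corner_content_neq_dull:
  assumes "young_cover E D" "D = insert e E" "e \<notin> E" "young N" "N \<subseteq> E" "d \<in> dull_boxes (E - N)"
  shows "content e \<noteq> content d"
proof
  assume eq: "content e = content d"
  have Y: "young D" "young E" using assms by (auto simp: young_cover_def)
  obtain i j p q where d: "d = (i, j)" and e: "e = (p, q)" by (cases d, cases e) auto
  have dE: "(i, j) \<in> E" "(i, j) \<notin> N" using assms(6) d by (auto simp: dull_boxesD)
  have pq: "(p, q) \<in> D" "(p, q) \<notin> E" using assms e by auto
  have pos: "1 \<le> i" "1 \<le> j" "1 \<le> p" "1 \<le> q" using young_pos[OF Y(2) dE(1)] young_pos[OF Y(1) pq(1)] by auto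
  have "(i, j) \<noteq> (p, q)" using dE pq by auto
  then consider "i < p" "j < q" | "p < i" "q < j"
    using content_diagonal[of p q i j] eq d e by auto
  then show False
  proof cases
    case 1
    then have "(Suc i, j) \<in> D" using young_down[OF Y(1) pq(1)] pos by simp
    moreover have "(Suc i, j) \<noteq> e" using 1 e by simp
    ultimately have "(Suc i, j) \<in> E" using assms(2) by auto
    moreover have "(Suc i, j) \<notin> N" using young_down[OF assms(4), of "Suc i" j i j] pos dE(2) by auto
    ultimately show False using assms(6) d by (simp add: dull_boxesD)
  next
    case 2
    then show False using young_down[OF Y(2) dE(1), of p q] pos pq by simp
  qed
qed

lemma young_cover_remove_dull:
  assumes "young E" "young N" "d \<in> dull_boxes (E - N)"
  shows "young_cover (E - {d}) E"
proof -
  obtain i j where d: "d = (i, j)" by (cases d)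
  have dE: "(i, j) \<in> E" "(i, j) \<notin> N" "(Suc i, j) \<notin> E - N" "(i, Suc j) \<notin> E - N"
    using assms(3) d by (auto simp: dull_boxesD)
  have pos: "1 \<le> i" "1 \<le> j" using young_pos[OF assms(1) dE(1)] by auto
  have nE: "(Suc i, j) \<notin> E" "(i, Suc j) \<notin> E"
    using dE young_down[OF assms(2), of "Suc i" j i j] young_down[OF assms(2), of i "Suc j" i j] pos by auto
  have "young (E - {d})"
  proof (rule youngI)
    show "finite (E - {d})" using young_finite[OF assms(1)] by simp
    show "1 \<le> a \<and> 1 \<le> b" if "(a, b) \<in> E - {d}" for a b using that young_pos[OF assms(1)] by blast
    fix a b a' b' assume ab: "(a, b) \<in> E - {d}" "1 \<le> a'" "a' \<le> a" "1 \<le> b'" "b' \<le> b"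
    have "(a', b') \<in> E" using young_down[OF assms(1), of a b a' b'] ab by simp
    moreover have "(a', b') \<noteq> d"
    proof
      assume "(a', b') = d"
      then have "i < a \<or> j < b" "i \<le> a" "j \<le> b" using ab d by auto
      then show False
        using young_down[OF assms(1), of a b "Suc i" j] young_down[OF assms(1), of a b i "Suc j"] nE ab pos by auto
    qed
    ultimately show "(a', b') \<in> E - {d}" by simp
  qed
  then show ?thesis using assms(1) dE(1) d by (intro young_coverI[of _ _ d]) auto
qed

text \<open>Together with \<open>young_cover_remove_dull\<close> this matches the diagrams that
  contain \<open>N\<close> and arise from \<open>E\<close> by removing a box with the dull boxes of
  \<open>E - N\<close>.\<close>

lemma dull_of_young_cover:
  assumes "young_cover F E" "E = insert f F" "f \<notin> F" "young N" "N \<subseteq> F"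
  shows "f \<in> dull_boxes (E - N)"
  using young_cover_corner[OF assms(1-3)] assms(2,3,5) by (cases f) (auto simp: dull_boxesD)

text \<open>The sum over \<open>F\<close> becomes a sum over the dull boxes of \<open>E - N\<close>;
  their contents are the poles of the partial fractions, evaluated at the content of
  \<open>e\<close>. That \<open>N\<close> differs from \<open>E\<close> makes the strip nonempty, so
  that it has fewer sharp corners than dull boxes.\<close>

lemma strip_phi_recursion:
  assumes "young_cover E D" "D = insert e E" "e \<notin> E" "young N" "N \<subseteq> E" "N \<noteq> E"
  shows "strip_phi e (D - N) = (\<Sum>F | young_cover F E \<and> N \<subseteq> F.
    inverse (of_int (content e - content (the_elem (E - F)))) * strip_phi (the_elem (E - F)) (E - N))"
proof -
  let ?S = "E - N"
  have Y: "young D" "young E" using assms by (auto simp: young_cover_def)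
  have T: "D - N = insert e ?S" using assms by auto
  have skT: "skew (insert e ?S)" using skew_Diff[OF Y(1) assms(4)] T by simp
  have sk: "skew ?S" by (rule skew_Diff[OF Y(2) assms(4)])
  have fin: "finite ?S" by (rule skew_finite[OF sk])
  have out: "e \<notin> ?S" "(Suc (fst e), snd e) \<notin> ?S" "(fst e, Suc (snd e)) \<notin> ?S"
    using assms(3) young_cover_corner[OF assms(1-3)] assms(2) by auto
  have "(\<Sum>F | young_cover F E \<and> N \<subseteq> F.
      inverse (of_int (content e - content (the_elem (E - F)))) * strip_phi (the_elem (E - F)) ?S) =
    (\<Sum>d\<in>dull_boxes ?S. inverse (of_int (content e - content d)) * strip_phi d ?S)"
  proof (rule sum.reindex_bij_witness[of _ "\<lambda>d. E - {d}" "\<lambda>F. the_elem (E - F)"])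
    fix F assume "F \<in> {F. young_cover F E \<and> N \<subseteq> F}"
    then have F: "young_cover F E" "N \<subseteq> F" by auto
    obtain f where f: "f \<notin> F" "E = insert f F" using F(1) by (rule young_coverE)
    have "E - F = {f}" using f by auto
    then have el: "the_elem (E - F) = f" by simp
    show "E - {the_elem (E - F)} = F" unfolding el using f by auto
    show "the_elem (E - F) \<in> dull_boxes ?S" unfolding el by (rule dull_of_young_cover[OF F(1) f(2,1) assms(4) F(2)])
  next
    fix d assume d: "d \<in> dull_boxes ?S"
    then have "d \<in> ?S" using dull_boxes_subset by blast
    then show "the_elem (E - (E - {d})) = d" by (simp add: Diff_Diff_Int)
    show "E - {d} \<in> {F. young_cover F E \<and> N \<subseteq> F}"
      using young_cover_remove_dull[OF Y(2) assms(4) d] \<open>d \<in> ?S\<close> assms(5) by auto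
  qed simp
  also have "\<dots> = strip_phi e (D - N)"
  proof (cases "broken_border_strip ?S")
    case False
    then have "\<not> broken_border_strip (insert e ?S)" using broken_border_strip_subset by blast
    then show ?thesis using False T by (simp add: strip_phi_def)
  next
    case True
    let ?x = "of_int (content e) :: complex" and ?y = "\<lambda>b. of_int (content b) :: complex"
    have "(\<Sum>d\<in>dull_boxes ?S. inverse (of_int (content e - content d)) * strip_phi d ?S) =
      (\<Sum>d\<in>dull_boxes ?S. (-1) ^ vert ?S * (inverse (?x - ?y d) *
        ((\<Prod>s\<in>sharp_corners ?S. ?y d - ?y s) * (\<Prod>d'\<in>dull_boxes ?S - {d}. inverse (?y d - ?y d')))))"
      using True strip_height_eq_vert[OF sk True]
      by (intro sum.cong refl) (simp add: strip_phi_def mult_ac)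
    also have "\<dots> = (-1) ^ vert ?S * (\<Sum>d\<in>dull_boxes ?S. inverse (?x - ?y d) *
        ((\<Prod>s\<in>sharp_corners ?S. ?y d - ?y s) * (\<Prod>d'\<in>dull_boxes ?S - {d}. inverse (?y d - ?y d'))))"
      by (simp only: sum_distrib_left)
    also have "(\<Sum>d\<in>dull_boxes ?S. inverse (?x - ?y d) *
        ((\<Prod>s\<in>sharp_corners ?S. ?y d - ?y s) * (\<Prod>d'\<in>dull_boxes ?S - {d}. inverse (?y d - ?y d')))) =
        (\<Prod>s\<in>sharp_corners ?S. ?x - ?y s) * (\<Prod>d\<in>dull_boxes ?S. inverse (?x - ?y d))"
    proof (rule partial_fractions_numerator)
      show "finite (sharp_corners ?S)" "finite (dull_boxes ?S)"
        using finite_subset[OF sharp_corners_subset fin] finite_subset[OF dull_boxes_subset fin] by auto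
      show "card (sharp_corners ?S) < card (dull_boxes ?S)"
        using assms(5,6) by (intro card_sharp_corners_less[OF sk True]) auto
      show "inj_on ?y (dull_boxes ?S)"
        using dull_boxes_content_inj[OF sk] by (simp add: inj_on_def)
      show "?x \<notin> ?y ` dull_boxes ?S"
        using corner_content_neq_dull[OF assms(1-5)] by auto
    qed
    also have "(-1) ^ vert ?S * \<dots> = strip_phi e (D - N)"
    proof (cases "broken_border_strip (insert e ?S)")
      case True
      show ?thesis unfolding T strip_phi_insert_corner[OF skT fin out True]
        by (simp add: mult.assoc)
    next
      case False
      \<comment> \<open>When \<open>e\<close> completes a 2 x 2 block, a sharp corner on its
        diagonal annihilates the numerator, in agreement with the value 0 in the definition.\<close>
      obtain s where s: "s \<in> sharp_corners ?S" "content s = content e"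
        by (rule sharp_corner_of_new_block[OF out True False])
      have "(\<Prod>s\<in>sharp_corners ?S. ?x - ?y s) = 0"
        using s by (intro prod_zero finite_subset[OF sharp_corners_subset fin] bexI[of _ s]) simp_all
      then show ?thesis using False T by (simp add: strip_phi_def)
    qed
    finally show ?thesis .
  qed
  finally show ?thesis ..
qed

lemma strip_phi_singleton: "strip_phi e {e} = 1"
proof -
  have bbs: "broken_border_strip {e}" by (auto simp: broken_border_strip_def)
  have "skew {e}" by (auto simp: skew_def)
  from strip_height_eq_vert[OF this bbs] have "strip_height {e} = vert {e}" .
  moreover have "{b \<in> {e}. (Suc (fst b), snd b) \<in> {e}} = {}" by (cases e) auto
  then have "vert {e} = 0" by (simp add: vert_def)
  moreover have "sharp_corners {e} = {}" by (auto simp: sharp_corners_def)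
  moreover have D: "dull_boxes {e} - {e} = {}" by (auto simp: dull_boxes_def)
  ultimately show ?thesis using bbs unfolding strip_phi_def D by simp
qed

lemma total_content_insert:
  "finite E \<Longrightarrow> e \<notin> E \<Longrightarrow> total_content (insert e E) - total_content E = of_int (content e)"
  by (simp add: total_content_def)

section \<open>Diagrams, tableaux and cycle types\<close>

lemma diagram_mem: "(i, j) \<in> diagram p \<longleftrightarrow> 1 \<le> i \<and> i \<le> length p \<and> 1 \<le> j \<and> j \<le> p ! (i - 1)"
  by (simp add: diagram_def)

text \<open>Indices starting from 0 give a dependent sum of intervals, from which finiteness and
  cardinality are immediate.\<close>

lemma diagram_image: "diagram p = (\<lambda>(i, j). (Suc i, Suc j)) ` (SIGMA i:{..<length p}. {..<p ! i})"
proof (rule set_eqI)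
  fix b :: box
  obtain i j where b: "b = (i, j)" by (cases b)
  show "b \<in> diagram p \<longleftrightarrow> b \<in> (\<lambda>(i, j). (Suc i, Suc j)) ` (SIGMA i:{..<length p}. {..<p ! i})"
    by (cases i; cases j) (force simp: b diagram_mem)+
qed

lemma card_diagram: "card (diagram p) = sum_list p"
proof -
  have "inj_on (\<lambda>(i, j). (Suc i, Suc j)) (SIGMA i:{..<length p}. {..<p ! i})"
    by (auto simp: inj_on_def)
  then have "card (diagram p) = card (SIGMA i:{..<length p}. {..<p ! i})"
    unfolding diagram_image by (rule card_image)
  then show ?thesis by (simp add: sum_list_sum_nth atLeast0LessThan)
qed

lemma finite_diagram: "finite (diagram p)"
  unfolding diagram_image by simp

lemma young_diagram:
  assumes "partition_of n p"
  shows "young (diagram p)"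
proof (rule youngI[OF finite_diagram])
  fix i j i' j' assume ij: "(i, j) \<in> diagram p" and le: "1 \<le> i'" "i' \<le> i" "1 \<le> j'" "j' \<le> j"
  have "p ! (i - 1) \<le> p ! (i' - 1)"
  proof (cases "i' = i")
    case False
    then have "i' - 1 < i - 1" "i - 1 < length p" using ij le by (auto simp: diagram_mem)
    then show ?thesis using assms sorted_wrt_nth_less[of "(\<ge>)" p] by (simp add: partition_of_def)
  qed simp
  then show "(i', j') \<in> diagram p" using ij le by (auto simp: diagram_mem)
qed (auto simp: diagram_mem)

lemma diagram_in_youngs: "partition_of n p \<Longrightarrow> diagram p \<in> youngs n"
  using young_diagram card_diagram by (auto simp: youngs_def partition_of_def)

lemma row_len_diagram: "1 \<le> i \<Longrightarrow> i \<le> length p \<Longrightarrow> row_len (diagram p) i = p ! (i - 1)"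
proof -
  assume i: "1 \<le> i" "i \<le> length p"
  then have "{b \<in> diagram p. fst b = i} = Pair i ` {1..p ! (i - 1)}"
    by (auto simp: diagram_mem)
  then show ?thesis by (simp add: row_len_def card_image inj_on_def)
qed

lemma rows_diagram:
  assumes "0 \<notin> set p"
  shows "fst ` diagram p = {1..length p}"
proof (intro equalityI subsetI)
  fix i assume i: "i \<in> {1..length p}"
  then have "p ! (i - 1) \<in> set p" by (intro nth_mem) auto
  then have "p ! (i - 1) \<noteq> 0" using assms by (intro notI) simp
  then have "(i, 1) \<in> diagram p" using i by (simp add: diagram_mem Suc_le_eq)
  then show "i \<in> fst ` diagram p" by force
qed (auto simp: diagram_mem)

lemma diagram_inj:
  assumes "0 \<notin> set p" "0 \<notin> set q" "diagram p = diagram q"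
  shows "p = q"
proof (rule nth_equalityI)
  have "card (fst ` diagram p) = card (fst ` diagram q)" using assms(3) by simp
  then show len: "length p = length q" by (simp add: rows_diagram assms(1,2))
  fix i assume "i < length p"
  then show "p ! i = q ! i"
    using row_len_diagram[of "Suc i" p] row_len_diagram[of "Suc i" q] assms(3) len by simp
qed

lemma young_is_diagram:
  assumes "young D"
  obtains p where "partition_of (card D) p" "diagram p = D"
proof -
  define L where "L = card (fst ` D)"
  have rows: "fst ` D = {1..L}"
    unfolding L_def
  proof (rule down_closed_eq_interval)
    show "finite (fst ` D)" using young_finite[OF assms] by simp
    show "0 \<notin> fst ` D"
    proof
      assume "0 \<in> fst ` D"
      then obtain j where "(0, j) \<in> D" by force
      then show False using young_pos[OF assms] by fastforce
    qed
    fix x y assume "x \<in> fst ` D" "1 \<le> y" "y \<le> x"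
    then obtain j where j: "(x, j) \<in> D" by force
    then have "(y, j) \<in> D" using young_down[OF assms j, of y j] young_pos[OF assms j] \<open>1 \<le> y\<close> \<open>y \<le> x\<close> by simp
    then show "y \<in> fst ` D" by force
  qed
  define p where "p = map (\<lambda>i. row_len D (Suc i)) [0..<L]"
  have D: "diagram p = D"
  proof (rule set_eqI)
    fix b :: box
    obtain i j where b: "b = (i, j)" by (cases b)
    have "(i, j) \<in> D \<Longrightarrow> 1 \<le> i \<and> i \<le> L" using rows by (metis atLeastAtMost_iff fst_conv imageI)
    then show "b \<in> diagram p \<longleftrightarrow> b \<in> D"
      using mem_row_len[OF assms, of i j] by (auto simp: b diagram_mem p_def)
  qed
  have "0 \<notin> set p"
  proof
    assume "0 \<in> set p"
    then obtain i where i: "i < L" "row_len D (Suc i) = 0" by (auto simp: p_def)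
    then have "Suc i \<in> fst ` D" using rows by simp
    then obtain j where "(Suc i, j) \<in> D" by force
    then have "1 \<le> j \<and> j \<le> 0" using i(2) mem_row_len[OF assms, of "Suc i" j] by (simp only:)
    then show False by linarith
  qed
  moreover have "sorted_wrt (\<ge>) p"
    unfolding p_def sorted_wrt_iff_nth_less using row_len_antimono[OF assms] by simp
  ultimately have "partition_of (card D) p" using card_diagram[of p] D by (simp add: partition_of_def)
  then show ?thesis using that D by blast
qed

lemma bij_betw_diagram: "bij_betw diagram {p. partition_of n p} (youngs n)"
proof (rule bij_betw_imageI)
  show "inj_on diagram {p. partition_of n p}"
    by (rule inj_onI) (auto simp: partition_of_def intro: diagram_inj)
  show "diagram ` {p. partition_of n p} = youngs n"
  proof (intro equalityI subsetI)
    fix D assume "D \<in> youngs n"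
    then have "young D" "card D = n" by (auto simp: youngs_def)
    then show "D \<in> diagram ` {p. partition_of n p}" using young_is_diagram by blast
  qed (use diagram_in_youngs in auto)
qed

lemma adds_box_young_cover:
  assumes "partition_of n lam" "partition_of m mu" "mu \<nearrow> lam"
  shows "young_cover (diagram mu) (diagram lam)"
  using assms young_coverI[OF young_diagram[OF assms(2)] young_diagram[OF assms(1)]]
  unfolding adds_box_def by blast

section \<open>The tableaux and Specht modules of the definitions in the row and column
  encoding\<close>

definition col_of :: "nat list \<Rightarrow> (box \<Rightarrow> nat) \<Rightarrow> nat \<Rightarrow> nat" where
  "col_of lam T = (\<lambda>m. if m \<in> T ` diagram lam then snd (the_inv_into (diagram lam) T m) else 0)"

lemma tableau_props:
  assumes "tableau lam T"
  shows "b \<in> diagram lam \<Longrightarrow> tabloid_of lam T (T b) = fst b"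
    and "b \<in> diagram lam \<Longrightarrow> col_of lam T (T b) = snd b"
    and "T ` diagram lam = {1..sum_list lam}"
    and "m \<notin> {1..sum_list lam} \<Longrightarrow> tabloid_of lam T m = 0"
    and "m \<notin> {1..sum_list lam} \<Longrightarrow> col_of lam T m = 0"
proof -
  have inj: "inj_on T (diagram lam)" and im: "T ` diagram lam = {1..sum_list lam}"
    using assms by (auto simp: tableau_def bij_betw_def)
  show "T ` diagram lam = {1..sum_list lam}" by (rule im)
  show "b \<in> diagram lam \<Longrightarrow> tabloid_of lam T (T b) = fst b" "b \<in> diagram lam \<Longrightarrow> col_of lam T (T b) = snd b"
    by (simp_all add: tabloid_of_def col_of_def the_inv_into_f_f[OF inj])
  show "m \<notin> {1..sum_list lam} \<Longrightarrow> tabloid_of lam T m = 0" "m \<notin> {1..sum_list lam} \<Longrightarrow> col_of lam T m = 0"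
    by (simp_all only: tabloid_of_def col_of_def im if_False)
qed

lemma tableau_ytab:
  assumes "tableau lam T"
  shows "ytab (diagram lam) (tabloid_of lam T) (col_of lam T)"
proof -
  note T = tableau_props[OF assms]
  let ?f = "\<lambda>m. (tabloid_of lam T m, col_of lam T m)"
  have im: "T ` diagram lam = {1..card (diagram lam)}" unfolding card_diagram by (rule T(3))
  have fT: "?f (T b) = b" if "b \<in> diagram lam" for b using T(1,2)[OF that] by simp
  have "bij_betw ?f {1..card (diagram lam)} (diagram lam)"
    unfolding im[symmetric]
  proof (rule bij_betw_byWitness[where f' = T])
    show "\<forall>m\<in>T ` diagram lam. T (?f m) = m" using fT by auto
    show "?f ` T ` diagram lam \<subseteq> diagram lam" using fT by auto
  qed (use fT in auto)
  then show ?thesis using T(4,5) by (simp add: ytab_def card_diagram)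
qed

lemma tabloid_of_comp:
  assumes "tableau lam T" "s \<in> Sym (sum_list lam)"
  shows "tabloid_of lam (s \<circ> T) = tabloid_of lam T \<circ> inv s"
proof
  fix m
  have s: "s permutes {1..sum_list lam}" using Sym_permutes[OF assms(2)] .
  have sT: "tableau lam (s \<circ> T)"
    using assms(1) permutes_imp_bij[OF s] by (auto simp: tableau_def intro: bij_betw_trans)
  show "tabloid_of lam (s \<circ> T) m = (tabloid_of lam T \<circ> inv s) m"
  proof (cases "m \<in> {1..sum_list lam}")
    case True
    then have "m \<in> (s \<circ> T) ` diagram lam" using tableau_props(3)[OF sT] by simp
    then obtain b where b: "b \<in> diagram lam" "m = (s \<circ> T) b" by blast
    then show ?thesis
      using tableau_props(1)[OF sT b(1)] tableau_props(1)[OF assms(1) b(1)] permutes_inverses(2)[OF s] by simp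
  next
    case False
    then have "inv s m = m" using permutes_not_in[OF permutes_inv[OF s]] by simp
    then show ?thesis using tableau_props(4)[OF sT False] tableau_props(4)[OF assms(1) False] by simp
  qed
qed

lemma column_stabilizer_eq:
  assumes "tableau lam T"
  shows "column_stabilizer lam T = col_stab (sum_list lam) (col_of lam T)"
proof (intro equalityI subsetI)
  note T = tableau_props[OF assms]
  fix s assume "s \<in> column_stabilizer lam T"
  then have s: "s \<in> Sym (sum_list lam)"
    "\<And>b. b \<in> diagram lam \<Longrightarrow> \<exists>b'\<in>diagram lam. snd b' = snd b \<and> s (T b) = T b'"
    by (auto simp: column_stabilizer_def)
  show "s \<in> col_stab (sum_list lam) (col_of lam T)"
  proof (rule col_stabI[OF s(1)])
    fix m
    show "col_of lam T (s m) = col_of lam T m"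
    proof (cases "m \<in> {1..sum_list lam}")
      case True
      then obtain b where b: "b \<in> diagram lam" "m = T b" using T(3) by blast
      obtain b' where "b' \<in> diagram lam" "snd b' = snd b" "s (T b) = T b'" using s(2)[OF b(1)] by blast
      then show ?thesis using T(2) b by simp
    next
      case False
      then show ?thesis using permutes_not_in[OF Sym_permutes[OF s(1)]] by simp
    qed
  qed
next
  note T = tableau_props[OF assms]
  fix s assume s: "s \<in> col_stab (sum_list lam) (col_of lam T)"
  have S: "s \<in> Sym (sum_list lam)" by (rule col_stab_Sym[OF s])
  have "\<exists>b'\<in>diagram lam. snd b' = snd b \<and> s (T b) = T b'" if b: "b \<in> diagram lam" for b
  proof -
    have "T b \<in> {1..sum_list lam}" using T(3) b by blast
    then have "s (T b) \<in> T ` diagram lam" using permutes_in_image[OF Sym_permutes[OF S]] T(3) by blast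
    then obtain b' where b': "b' \<in> diagram lam" "s (T b) = T b'" by blast
    then have "snd b' = snd b" using col_stab_apply[OF s, of "T b"] T(2) b by simp
    then show ?thesis using b' by blast
  qed
  then show "s \<in> column_stabilizer lam T" using S by (simp add: column_stabilizer_def)
qed

lemma polytabloid_eq_polytab:
  assumes "tableau lam T"
  shows "polytabloid lam T = polytab (card (diagram lam)) (tabloid_of lam T) (col_of lam T)"
proof
  fix t
  let ?n = "sum_list lam" and ?r = "tabloid_of lam T" and ?c = "col_of lam T"
  have "polytabloid lam T t = (\<Sum>s\<in>col_stab ?n ?c. of_int (sign s) * basis_vector (tabloid_of lam (s \<circ> T)) t)"
    by (simp add: polytabloid_def column_stabilizer_eq[OF assms] sum_fun_apply fun_scale_apply)
  also have "\<dots> = (\<Sum>s\<in>col_stab ?n ?c. if t \<circ> s = ?r then of_int (sign s) else 0)"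
  proof (rule sum.cong[OF refl])
    fix s assume "s \<in> col_stab ?n ?c"
    then have S: "s \<in> Sym ?n" by (rule col_stab_Sym)
    have "t = ?r \<circ> inv s \<longleftrightarrow> t \<circ> s = ?r"
      using Sym_cancel(3)[OF S, of t] Sym_cancel(4)[OF S, of ?r] by auto
    then show "of_int (sign s) * basis_vector (tabloid_of lam (s \<circ> T)) t =
        (if t \<circ> s = ?r then of_int (sign s) else 0)"
      by (simp add: basis_vector_def tabloid_of_comp[OF assms S])
  qed
  finally show "polytabloid lam T t = polytab (card (diagram lam)) ?r ?c t"
    by (simp add: polytab_def card_diagram)
qed

lemma ytab_tableau:
  assumes "ytab (diagram lam) r c"
  obtains T where "tableau lam T" "r = tabloid_of lam T" "c = col_of lam T"
proof -
  let ?f = "\<lambda>m. (r m, c m)"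
  have f: "bij_betw ?f {1..sum_list lam} (diagram lam)" using ytab_bij[OF assms] by (simp add: card_diagram)
  define T where "T = the_inv_into {1..sum_list lam} ?f"
  have tab: "tableau lam T" unfolding tableau_def T_def by (rule bij_betw_the_inv_into[OF f])
  have inv: "T (r m, c m) = m" if "m \<in> {1..sum_list lam}" for m
    unfolding T_def using the_inv_into_f_f[OF bij_betw_imp_inj_on[OF f] that] by simp
  have "r m = tabloid_of lam T m \<and> c m = col_of lam T m" for m
  proof (cases "m \<in> {1..sum_list lam}")
    case True
    then have "(r m, c m) \<in> diagram lam" using bij_betwE[OF f] by blast
    then show ?thesis using tableau_props(1,2)[OF tab, of "(r m, c m)"] inv[OF True] by simp
  next
    case False
    then show ?thesis
      using tableau_props(4,5)[OF tab False] ytab_out[OF assms, of m] by (simp add: card_diagram)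
  qed
  then show ?thesis using that[OF tab] by blast
qed

lemma specht_module_eq_specht: "specht_module lam = specht (diagram lam)"
proof -
  have "polytabloid lam ` {T. tableau lam T} = {polytab (card (diagram lam)) r c | r c. ytab (diagram lam) r c}"
  proof (intro equalityI subsetI)
    fix f assume "f \<in> polytabloid lam ` {T. tableau lam T}"
    then obtain T where "tableau lam T" "f = polytabloid lam T" by blast
    then show "f \<in> {polytab (card (diagram lam)) r c | r c. ytab (diagram lam) r c}"
      using tableau_ytab polytabloid_eq_polytab by blast
  next
    fix f assume "f \<in> {polytab (card (diagram lam)) r c | r c. ytab (diagram lam) r c}"
    then obtain r c where f: "f = polytab (card (diagram lam)) r c" "ytab (diagram lam) r c" by blast
    obtain T where T: "tableau lam T" "r = tabloid_of lam T" "c = col_of lam T"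
      by (rule ytab_tableau[OF f(2)])
    then have "f = polytabloid lam T" using polytabloid_eq_polytab[OF T(1)] f(1) by simp
    then show "f \<in> polytabloid lam ` {T. tableau lam T}" using T(1) by blast
  qed
  then show ?thesis by (simp add: specht_module_def specht_def)
qed

lemma irr_char_eq_character: "irr_char lam s = character (specht (diagram lam)) s"
  by (simp add: irr_char_def specht_module_eq_specht)

text \<open>Expanding the projection inside the trace yields the defining sum, the dimension of the
  smaller module being its character at the identity.\<close>

lemma gen_char_eq_proj_char:
  assumes "partition_of (Suc m) lam" "partition_of m mu" "x \<in> Sym (Suc m)"
  shows "gen_char lam mu x = proj_char (diagram lam) (diagram mu) x"
proof -
  let ?D = "diagram lam" and ?E = "diagram mu"
  have D: "young ?D" "card ?D = Suc m" and E: "young ?E" "card ?E = m"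
    using diagram_in_youngs[OF assms(1)] diagram_in_youngs[OF assms(2)] by (auto simp: youngs_def)
  have V: "sym_mod (Suc m) (specht ?D)" using sym_mod_specht[OF young_finite[OF D(1)]] D(2) by simp
  have S: "sym_mod m (specht ?E)" using sym_mod_specht[OF young_finite[OF E(1)]] E(2) by simp
  have x_inv: "x \<circ> inv y \<in> Sym (Suc m)" if "y \<in> Sym m" for y
    using assms(3) Sym_mono[of m "Suc m" "inv y"] that by simp
  have "proj_char ?D ?E x = trace_on (specht ?D) (\<lambda>v. \<Sum>y\<in>Sym m.
      fun_scale (of_nat (cfun.dim (specht ?E)) / fact m * character (specht ?E) y) (perm_act (x \<circ> inv y) v))"
    unfolding proj_char_def E(2)
    by (rule trace_cong[OF sym_mod_fin_dim[OF V]]) (simp add: isoproj_def perm_act_simps perm_act_comp)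
  also have "\<dots> = (\<Sum>y\<in>Sym m. of_nat (cfun.dim (specht ?E)) / fact m * character (specht ?E) y * character (specht ?D) (x \<circ> inv y))"
    by (rule trace_sum_scale[OF sym_mod_fin_dim[OF V] sym_mod_act[OF V x_inv]])
  also have "\<dots> = gen_char lam mu x"
  proof -
    have "sum_list lam = Suc m" using assms(1) by (simp add: partition_of_def)
    then show ?thesis
      by (simp add: gen_char_def irr_char_eq_character character_id[OF S] sum_distrib_left mult_ac)
  qed
  finally show ?thesis ..
qed

section \<open>Cycle types and the classes of the generalized characters\<close>

definition cyc_type :: "nat \<Rightarrow> (nat \<Rightarrow> nat) \<Rightarrow> nat multiset" where
  "cyc_type n s = image_mset card (mset_set (orbit s ` {1..n}))"

lemma cycle_class_iff: "s \<in> cycle_class n rho \<longleftrightarrow> s \<in> Sym n \<and> cyc_type n s = mset rho"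
  by (simp add: cycle_class_def cyc_type_def)

lemma Sym_permutation: "s \<in> Sym n \<Longrightarrow> permutation s"
  unfolding Sym_def permutation_permutes by blast

lemma self_in_orbit: "s \<in> Sym n \<Longrightarrow> x \<in> orbit s x"
  by (rule permutation_self_in_orbit[OF Sym_permutation])

lemma orbit_eq:
  assumes "s \<in> Sym n" "a \<in> orbit s b"
  shows "orbit s a = orbit s b"
proof -
  have "b \<in> orbit s a" by (rule orbit_swap[OF self_in_orbit[OF assms(1)] assms(2)])
  then show ?thesis
    by (intro equalityI subsetI) (erule orbit_trans[OF _ assms(2)], erule orbit_trans)
qed

lemma orbit_subset_Sym: "s \<in> Sym n \<Longrightarrow> x \<in> {1..n} \<Longrightarrow> orbit s x \<subseteq> {1..n}"
  by (rule permutes_orbit_subset[OF Sym_permutes])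

lemma orbit_conj_subset:
  assumes "bij g"
  shows "g ` orbit s x \<subseteq> orbit (g \<circ> s \<circ> inv g) (g x)"
proof (rule image_subsetI)
  define h where "h = g \<circ> s \<circ> inv g"
  have h: "h (g z) = g (s z)" for z using bij_is_inj[OF assms] by (simp add: h_def)
  fix y assume "y \<in> orbit s x"
  then have "g y \<in> orbit h (g x)"
  proof induction
    case base
    show ?case using orbit.base[of h "g x"] by (simp only: h)
  next
    case (step y)
    show ?case using orbit.step[OF step.IH] by (simp only: h)
  qed
  then show "g y \<in> orbit (g \<circ> s \<circ> inv g) (g x)" by (simp only: h_def)
qed

lemma orbit_conj:
  assumes "g \<in> Sym n"
  shows "orbit (g \<circ> s \<circ> inv g) (g x) = g ` orbit s x"
proof
  have b: "bij g" by (rule Sym_bij[OF assms])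
  have "inv g ` orbit (g \<circ> s \<circ> inv g) (g x) \<subseteq>
      orbit (inv g \<circ> (g \<circ> s \<circ> inv g) \<circ> inv (inv g)) (inv g (g x))"
    by (rule orbit_conj_subset[OF bij_imp_bij_inv[OF b]])
  also have "\<dots> = orbit s x"
    using bij_is_inj[OF b] by (simp add: Sym_inv_inv[OF assms] comp_assoc Sym_cancel[OF assms] Sym_inv_o[OF assms])
  finally have "g ` inv g ` orbit (g \<circ> s \<circ> inv g) (g x) \<subseteq> g ` orbit s x" by (rule image_mono)
  then show "orbit (g \<circ> s \<circ> inv g) (g x) \<subseteq> g ` orbit s x"
    by (simp add: image_image surj_f_inv_f[OF bij_is_surj[OF b]])
qed (rule orbit_conj_subset[OF Sym_bij[OF assms]])

lemma orbits_conj: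
  assumes "g \<in> Sym n"
  shows "orbit (g \<circ> s \<circ> inv g) ` {1..n} = (`) g ` orbit s ` {1..n}"
proof -
  have g: "g ` {1..n} = {1..n}" by (rule permutes_image[OF Sym_permutes[OF assms]])
  have "orbit (g \<circ> s \<circ> inv g) ` {1..n} = orbit (g \<circ> s \<circ> inv g) ` g ` {1..n}" by (simp only: g)
  also have "\<dots> = (`) g ` orbit s ` {1..n}" by (simp only: image_image orbit_conj[OF assms])
  finally show ?thesis .
qed

lemma image_mset_card_image:
  assumes "bij g"
  shows "image_mset card (mset_set ((`) g ` A)) = image_mset card (mset_set A)"
proof -
  have inj: "inj g" by (rule bij_is_inj[OF assms])
  then have "inj_on ((`) g) A" by (simp add: inj_on_def inj_image_eq_iff)
  then have "mset_set ((`) g ` A) = image_mset ((`) g) (mset_set A)" by (rule image_mset_mset_set[symmetric])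
  moreover have "card (g ` X) = card X" for X by (rule card_image[OF inj_on_subset[OF inj subset_UNIV]])
  ultimately show ?thesis by (simp add: image_mset.compositionality comp_def)
qed

lemma cyc_type_conj: "g \<in> Sym n \<Longrightarrow> cyc_type n (g \<circ> s \<circ> inv g) = cyc_type n s"
  unfolding cyc_type_def orbits_conj by (rule image_mset_card_image[OF Sym_bij])

text \<open>The full cycle type is invariant under all conjugations, so that in
  \<open>gen_class_conj\<close> only the cycle of \<open>n\<close> needs attention.\<close>

lemma gen_class_cyc_type:
  assumes "s \<in> Sym n" "1 \<le> n"
  shows "s \<in> gen_class n j rho \<longleftrightarrow> card (orbit s n) = j \<and> cyc_type n s = add_mset j (mset rho)"
proof -
  let ?O = "orbit s ` {1..n}" and ?o = "orbit s n"
  have "?o \<in> ?O" using assms(2) by simp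
  then have "mset_set ?O = add_mset ?o (mset_set (?O - {?o}))"
    by (simp add: mset_set.remove)
  then have "cyc_type n s = add_mset (card ?o) (image_mset card (mset_set (?O - {?o})))"
    by (simp add: cyc_type_def)
  then show ?thesis using assms(1) by (auto simp: gen_class_def)
qed

lemma gen_class_conj:
  assumes "s \<in> gen_class n j rho" "g \<in> Sym n" "g n = n" "1 \<le> n"
  shows "g \<circ> s \<circ> inv g \<in> gen_class n j rho"
proof -
  have s: "s \<in> Sym n" using assms(1) by (simp add: gen_class_def)
  have "card (orbit (g \<circ> s \<circ> inv g) n) = card (orbit s n)"
    using orbit_conj[OF assms(2), of s n] assms(3)
    by (simp add: card_image[OF inj_on_subset[OF bij_is_inj[OF Sym_bij[OF assms(2)]] subset_UNIV]])
  then show ?thesis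
    using assms s by (simp add: gen_class_cyc_type cyc_type_conj)
qed

text \<open>The product sends \<open>m\<close> to \<open>Suc m\<close> and \<open>Suc m\<close> to
  \<open>y m\<close>: it inserts \<open>Suc m\<close> into the cycle of \<open>m\<close> right after
  \<open>m\<close> and leaves the other cycles alone.\<close>

lemma orbits_comp_transpose:
  assumes "y \<in> Sym m" "1 \<le> m"
  defines "x \<equiv> y \<circ> transpose m (Suc m)"
  shows "orbit x (Suc m) = insert (Suc m) (orbit y m)"
    and "orbit x ` {1..Suc m} - {orbit x (Suc m)} = orbit y ` {1..m} - {orbit y m}"
proof -
  have yS: "y (Suc m) = Suc m" using Sym_fixes[OF assms(1)] by simp
  have x: "x m = Suc m" "x (Suc m) = y m" "\<And>z. z \<noteq> m \<Longrightarrow> z \<noteq> Suc m \<Longrightarrow> x z = y z"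
    by (simp_all add: x_def yS)
  have xSym: "x \<in> Sym (Suc m)"
    unfolding x_def using assms(1,2) Sym_mono[of m "Suc m" y] transpose_Sym[of m "Suc m" "Suc m"] by simp
  have my: "orbit y z \<subseteq> {1..m}" if "z \<in> {1..m}" for z by (rule orbit_subset_Sym[OF assms(1) that])
  have m: "m \<in> {1..m}" using assms(2) by simp
  show top: "orbit x (Suc m) = insert (Suc m) (orbit y m)"
  proof (intro equalityI subsetI)
    fix z assume "z \<in> orbit x (Suc m)"
    then show "z \<in> insert (Suc m) (orbit y m)"
    proof induction
      case base then show ?case using orbit.base[of y m] by (simp add: x)
    next
      case (step z)
      then consider "z = Suc m" | "z = m" | "z \<in> orbit y m" "z \<noteq> m" "z \<noteq> Suc m" by blast
      then show ?case
      proof cases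
        case 1 then show ?thesis using orbit.base[of y m] by (simp add: x)
      next
        case 2 then show ?thesis by (simp add: x)
      next
        case 3 then show ?thesis using orbit.step[OF 3(1)] by (simp add: x)
      qed
    qed
  next
    fix z assume "z \<in> insert (Suc m) (orbit y m)"
    then consider "z = Suc m" | "z \<in> orbit y m" by blast
    then show "z \<in> orbit x (Suc m)"
    proof cases
      case 1 then show ?thesis using self_in_orbit[OF xSym] by simp
    next
      case 2
      then show ?thesis
      proof induction
        case base
        then show ?case using orbit.base[of x "Suc m"] by (simp add: x)
      next
        case (step w)
        show ?case
        proof (cases "w = m")
          case True
          then show ?thesis using orbit.base[of x "Suc m"] by (simp add: x)
        next
          case False
          moreover have "w \<noteq> Suc m" using my[OF m] step.hyps by fastforce
          ultimately show ?thesis using orbit.step[OF step.IH] by (simp add: x)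
        qed
      qed
    qed
  qed
  have low: "orbit x z = orbit y z" if z: "z \<in> {1..m}" "z \<notin> orbit y m" for z
  proof (rule orbit_cong[OF self_in_orbit[OF assms(1)]])
    fix w assume w: "w \<in> orbit y z"
    have "w \<noteq> Suc m" using my[OF z(1)] w by fastforce
    moreover have "w \<noteq> m"
    proof
      assume "w = m"
      then have "orbit y m = orbit y z" using orbit_eq[OF assms(1) w] by simp
      then show False using z(2) self_in_orbit[OF assms(1)] by blast
    qed
    ultimately show "x w = y w" by (simp add: x)
  qed
  show "orbit x ` {1..Suc m} - {orbit x (Suc m)} = orbit y ` {1..m} - {orbit y m}"
  proof (intro equalityI subsetI)
    fix C assume "C \<in> orbit x ` {1..Suc m} - {orbit x (Suc m)}"
    then obtain z where z: "z \<in> {1..Suc m}" "C = orbit x z" "orbit x z \<noteq> orbit x (Suc m)" by blast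
    then have zn: "z \<notin> orbit x (Suc m)" using orbit_eq[OF xSym] by blast
    then have zm: "z \<notin> orbit y m" "z \<noteq> Suc m" using top by auto
    then have "z \<in> {1..m}" using z(1) by auto
    moreover have "orbit y z \<noteq> orbit y m" using zm self_in_orbit[OF assms(1)] by blast
    ultimately show "C \<in> orbit y ` {1..m} - {orbit y m}" using z(2) low zm(1) by auto
  next
    fix C assume "C \<in> orbit y ` {1..m} - {orbit y m}"
    then obtain z where z: "z \<in> {1..m}" "C = orbit y z" "orbit y z \<noteq> orbit y m" by blast
    then have zm: "z \<notin> orbit y m" using orbit_eq[OF assms(1)] by blast
    moreover have "z \<noteq> Suc m" using z(1) by auto
    ultimately have "z \<notin> orbit x (Suc m)" using top by simp
    then have "orbit x z \<noteq> orbit x (Suc m)" using self_in_orbit[OF xSym] by blast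
    then show "C \<in> orbit x ` {1..Suc m} - {orbit x (Suc m)}" using z low[OF z(1) zm] by auto
  qed
qed

lemma gen_class_comp_transpose:
  assumes "y \<in> Sym m" "1 \<le> m"
  shows "y \<circ> transpose m (Suc m) \<in> gen_class (Suc m) (Suc j) rho \<longleftrightarrow> y \<in> gen_class m j rho"
proof -
  let ?x = "y \<circ> transpose m (Suc m)"
  have S: "?x \<in> Sym (Suc m)"
    using assms Sym_mono[of m "Suc m" y] transpose_Sym[of m "Suc m" "Suc m"] by simp
  have sub: "orbit y m \<subseteq> {1..m}" using orbit_subset_Sym[OF assms(1)] assms(2) by simp
  then have "Suc m \<notin> orbit y m" by fastforce
  then have "card (orbit ?x (Suc m)) = Suc (card (orbit y m))"
    using orbits_comp_transpose(1)[OF assms] finite_subset[OF sub] by simp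
  then show ?thesis
    unfolding gen_class_def using S assms(1) orbits_comp_transpose(2)[OF assms] by simp
qed

lemma gen_class_1: "gen_class (Suc m) 1 rho = cycle_class m rho"
proof -
  have fixed: "s \<in> Sym m" if "s \<in> Sym (Suc m)" "card (orbit s (Suc m)) = 1" for s
  proof -
    obtain z where "orbit s (Suc m) = {z}" using \<open>card _ = 1\<close> by (auto simp: card_1_singleton_iff)
    then have "s (Suc m) = Suc m" using self_in_orbit[OF that(1), of "Suc m"] orbit.base[of s "Suc m"] by simp
    then show ?thesis by (rule Sym_predI[OF that(1)])
  qed
  have orbits: "orbit s (Suc m) = {Suc m} \<and> orbit s ` {1..Suc m} - {orbit s (Suc m)} = orbit s ` {1..m}"
    if s: "s \<in> Sym m" for s
  proof -
    have "s (Suc m) = Suc m" using Sym_fixes[OF s] by simp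
    then have 1: "orbit s (Suc m) = {Suc m}" by (simp add: orbit_eq_singleton_iff)
    have "{Suc m} \<notin> orbit s ` {1..m}"
    proof
      assume "{Suc m} \<in> orbit s ` {1..m}"
      then obtain z where z: "z \<in> {1..m}" "{Suc m} = orbit s z" by blast
      then have "Suc m \<in> {1..m}" using orbit_subset_Sym[OF s z(1)] by blast
      then show False by simp
    qed
    moreover have "{1..Suc m} = insert (Suc m) {1..m}" by auto
    ultimately have "orbit s ` {1..Suc m} - {orbit s (Suc m)} = orbit s ` {1..m}" by (simp add: 1)
    then show ?thesis using 1 by simp
  qed
  have iff: "s \<in> gen_class (Suc m) 1 rho \<longleftrightarrow> s \<in> cycle_class m rho" if s: "s \<in> Sym m" for s
  proof -
    have "s \<in> Sym (Suc m)" using Sym_mono[of m "Suc m" s] s by simp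
    moreover have "card (orbit s (Suc m)) = 1" using orbits[OF s] by simp
    ultimately show ?thesis
      unfolding gen_class_def cycle_class_def mem_Collect_eq conjunct2[OF orbits[OF s]] using s by blast
  qed
  show ?thesis
  proof (intro equalityI subsetI)
    fix s assume s: "s \<in> gen_class (Suc m) 1 rho"
    then have "s \<in> Sym m" using fixed by (simp add: gen_class_def)
    then show "s \<in> cycle_class m rho" using s iff by blast
  next
    fix s assume s: "s \<in> cycle_class m rho"
    then have "s \<in> Sym m" by (simp add: cycle_class_def)
    then show "s \<in> gen_class (Suc m) 1 rho" using s iff by blast
  qed
qed

section \<open>The value on a class\<close>

text \<open>Meaningful where the character is constant on the class, which is what
  \<open>class_fun\<close> provides.\<close>

definition char_at :: "box set \<Rightarrow> nat list \<Rightarrow> complex" where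
  "char_at N rho = the_elem (character (specht N) ` cycle_class (card N) rho)"

definition class_fun :: "nat \<Rightarrow> bool" where
  "class_fun n \<longleftrightarrow> (\<forall>D\<in>youngs n. \<forall>x\<in>Sym n. \<forall>y\<in>Sym n.
     cyc_type n x = cyc_type n y \<longrightarrow> character (specht D) x = character (specht D) y)"

lemma char_at_eq:
  assumes "class_fun (card N)" "young N" "x \<in> cycle_class (card N) rho"
  shows "char_at N rho = character (specht N) x"
proof -
  have "character (specht N) y = character (specht N) x" if "y \<in> cycle_class (card N) rho" for y
    using assms that unfolding class_fun_def cycle_class_iff youngs_def by auto
  then have "character (specht N) ` cycle_class (card N) rho = {character (specht N) x}" using assms(3) by blast
  then show ?thesis by (simp add: char_at_def)
qed

text \<open>Conjugation by the transposition of \<open>m\<close> with the preimage \<open>p\<close>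
  of \<open>Suc m\<close> places \<open>m\<close> immediately before \<open>Suc m\<close> in its
  cycle; multiplication by the last transposition then cuts \<open>Suc m\<close> out.\<close>

lemma gen_class_reduce:
  assumes "x \<in> gen_class (Suc m) (Suc j) rho" "1 \<le> j"
  obtains g y where "1 \<le> m" "g \<in> Sym m" "y \<in> Sym m" "y \<in> gen_class m j rho"
    "g \<circ> x \<circ> inv g = y \<circ> transpose m (Suc m)"
proof -
  have x: "x \<in> Sym (Suc m)" "card (orbit x (Suc m)) = Suc j" using assms(1) by (auto simp: gen_class_def)
  have xp: "x permutes {1..Suc m}" by (rule Sym_permutes[OF x(1)])
  define p where "p = inv x (Suc m)"
  have p: "x p = Suc m" unfolding p_def by (rule permutes_inverses(1)[OF xp])
  have "p \<noteq> Suc m"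
  proof
    assume "p = Suc m"
    then have "orbit x (Suc m) = {Suc m}" using p by (simp add: orbit_eq_singleton_iff)
    then show False using x(2) assms(2) by simp
  qed
  moreover have "p \<in> {1..Suc m}" using permutes_in_image[OF xp, of p] p by simp
  ultimately have pm: "p \<in> {1..m}" by auto
  then have m: "1 \<le> m" by simp
  define g where "g = transpose p m"
  have g: "g \<in> Sym m" unfolding g_def using pm m by (intro transpose_Sym) auto
  have gtop: "g (Suc m) = Suc m" using Sym_fixes[OF g] by simp
  have ginv: "inv g m = p" unfolding g_def by simp
  define x1 where "x1 = g \<circ> x \<circ> inv g"
  have gS: "g \<in> Sym (Suc m)" using Sym_mono[of m "Suc m" g] g by simp
  have x1: "x1 \<in> gen_class (Suc m) (Suc j) rho"
    unfolding x1_def by (rule gen_class_conj[OF assms(1) gS gtop]) simp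
  have x1m: "x1 m = Suc m" by (simp add: x1_def ginv p gtop)
  define y where "y = x1 \<circ> transpose m (Suc m)"
  have "x1 \<in> Sym (Suc m)" using x1 by (simp add: gen_class_def)
  then have "y \<in> Sym (Suc m)" unfolding y_def using m by (intro Sym_comp transpose_Sym) auto
  moreover have "y (Suc m) = Suc m" by (simp add: y_def x1m)
  ultimately have y: "y \<in> Sym m" by (rule Sym_predI)
  have yx: "g \<circ> x \<circ> inv g = y \<circ> transpose m (Suc m)" by (simp add: y_def comp_assoc x1_def)
  then have "y \<in> gen_class m j rho"
    using gen_class_comp_transpose[OF y m, of j rho] x1 by (simp only: x1_def)
  then show ?thesis using that[OF m g y _ yx] by blast
qed

lemma sum_down_swap:
  fixes f :: "box set \<Rightarrow> box set \<Rightarrow> complex"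
  shows "(\<Sum>F | young_cover F E. \<Sum>N | N \<in> youngs r \<and> N \<subseteq> F. f F N) =
    (\<Sum>N | N \<in> youngs r \<and> N \<subseteq> E. \<Sum>F | young_cover F E \<and> N \<subseteq> F. f F N)"
proof -
  let ?Y = "{N. N \<in> youngs r \<and> N \<subseteq> E}"
  have fin: "finite ?Y" using finite_subset[OF _ finite_youngs[of r]] by auto
  have "(\<Sum>F | young_cover F E. \<Sum>N | N \<in> youngs r \<and> N \<subseteq> F. f F N) = (\<Sum>F | young_cover F E. \<Sum>N\<in>?Y. if N \<subseteq> F then f F N else 0)"
  proof (rule sum.cong[OF refl])
    fix F assume "F \<in> {F. young_cover F E}"
    then have "{N. N \<in> youngs r \<and> N \<subseteq> F} = {N\<in>?Y. N \<subseteq> F}" by (auto simp: young_cover_def)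
    then show "(\<Sum>N | N \<in> youngs r \<and> N \<subseteq> F. f F N) = (\<Sum>N\<in>?Y. if N \<subseteq> F then f F N else 0)"
      using sum.inter_filter[OF fin] by simp
  qed
  also have "\<dots> = (\<Sum>N\<in>?Y. \<Sum>F | young_cover F E. if N \<subseteq> F then f F N else 0)" by (rule sum.swap)
  also have "\<dots> = (\<Sum>N\<in>?Y. \<Sum>F | young_cover F E \<and> N \<subseteq> F. f F N)"
  proof (rule sum.cong[OF refl])
    fix N
    show "(\<Sum>F | young_cover F E. if N \<subseteq> F then f F N else 0) = (\<Sum>F | young_cover F E \<and> N \<subseteq> F. f F N)"
      using sum.inter_filter[OF finite_down, of "\<lambda>F. f F N" E "\<lambda>F. N \<subseteq> F"] by simp
  qed
  finally show ?thesis .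
qed

lemma young_empty: "young {}"
  by (simp add: young_def)

text \<open>\<open>class_fun\<close> is assumed up to \<open>m\<close> only, so that it can in turn
  be derived for \<open>Suc m\<close> from this formula. A cycle of length 1 leaves the single
  summand \<open>N = E\<close> with coefficient 1; a longer one is shortened by
  \<open>proj_char_swap\<close>, and \<open>strip_phi_recursion\<close> reassembles the
  coefficients.\<close>

lemma proj_char_formula:
  assumes "\<And>k. k \<le> m \<Longrightarrow> class_fun k" "young_cover E D" "card E = m" "D = insert e E" "e \<notin> E"
    "1 \<le> j" "x \<in> gen_class (Suc m) j rho"
  shows "proj_char D E x = (\<Sum>N | N \<in> youngs (Suc m - j) \<and> N \<subseteq> E. strip_phi e (D - N) * char_at N rho)"
  using assms
proof (induction m arbitrary: D E e j x)
  case (0 D E e j x)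
  then have "E = {}" using young_finite[of E] by (simp add: young_cover_def)
  moreover have "x \<in> Sym (Suc 0)" "card (orbit x (Suc 0)) = j" using 0 by (auto simp: gen_class_def)
  then have "j \<le> 1" using card_mono[OF _ orbit_subset_Sym[of x "Suc 0" "Suc 0"]] by simp
  then have j: "j = 1" using 0 by simp
  then have x: "x \<in> cycle_class 0 rho" using 0 gen_class_1[of 0 rho] by simp
  then have "proj_char D E x = char_at E rho"
    using proj_char_restrict[OF 0(2,3)] char_at_eq[of E x rho] 0 by (simp add: young_cover_def cycle_class_def)
  moreover have "{N. N \<in> youngs 0 \<and> N \<subseteq> E} = {E}" using \<open>E = {}\<close> young_empty by (auto simp: youngs_def)
  moreover have "D - E = {e}" using 0 by auto
  ultimately show ?case using j by (simp add: strip_phi_singleton)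
next
  case (Suc k D E e j x)
  have Y: "young D" "young E" "card D = Suc (Suc k)" using Suc.prems(2,3) by (auto simp: young_cover_def)
  show ?case
  proof (cases "j = 1")
    case True
    then have x: "x \<in> cycle_class (Suc k) rho" using Suc.prems(7) gen_class_1[of "Suc k" rho] by simp
    then have "proj_char D E x = char_at E rho"
      using proj_char_restrict[OF Suc.prems(2,3)] char_at_eq[of E x rho] Suc.prems(1,3) Y
      by (simp add: cycle_class_def)
    moreover have "{N. N \<in> youngs (Suc k) \<and> N \<subseteq> E} = {E}"
      using Y(2) Suc.prems(3) card_subset_eq[OF young_finite[OF Y(2)]] by (auto simp: youngs_def)
    moreover have "D - E = {e}" using Suc.prems(4,5) by auto
    ultimately show ?thesis using True by (simp add: strip_phi_singleton)
  next
    case False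
    then obtain i where i: "j = Suc i" "1 \<le> i" using Suc.prems(6) by (cases j) auto
    obtain g y where gy: "g \<in> Sym (Suc k)" "y \<in> Sym (Suc k)" "y \<in> gen_class (Suc k) i rho"
      "g \<circ> x \<circ> inv g = y \<circ> transpose (Suc k) (Suc (Suc k))"
      using gen_class_reduce[OF Suc.prems(7)[unfolded i(1)] i(2)] by blast
    have x: "x \<in> Sym (Suc (Suc k))" using Suc.prems(7) by (simp add: gen_class_def)
    have cE: "total_content D - total_content E = of_int (content e)"
      using total_content_insert[OF young_finite[OF Y(2)] Suc.prems(5)] Suc.prems(4) by simp
    have F_props: "\<exists>f. f \<notin> F \<and> E = insert f F \<and> the_elem (E - F) = f \<and>
        total_content E - total_content F = of_int (content f) \<and> content e \<noteq> content f" if F: "young_cover F E" for F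
    proof -
      obtain f where f: "f \<notin> F" "E = insert f F" "finite F" using F by (rule young_coverE)
      have "E - F = {f}" using f by auto
      \<comment> \<open>With the empty diagram for \<open>N\<close>, the removable box
        \<open>f\<close> of \<open>E\<close> is dull and hence not on the diagonal of the addable
        box \<open>e\<close>.\<close>
      moreover have "f \<in> dull_boxes (E - {})" by (rule dull_of_young_cover[OF F f(2,1) young_empty]) simp
      then have "content e \<noteq> content f"
        using corner_content_neq_dull[OF Suc.prems(2,4,5) young_empty] by simp
      ultimately show ?thesis
        using f(1,2) total_content_insert[OF f(3,1)] by (intro exI[of _ f]) simp
    qed
    have "proj_char D E x = proj_char D E (y \<circ> transpose (Suc k) (Suc (Suc k)))"
      using proj_char_conj[OF Suc.prems(2,3) x gy(1)] gy(4) by simp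
    also have "\<dots> = (\<Sum>F | young_cover F E. inverse ((total_content D - total_content E) -
        (total_content E - total_content F)) * proj_char E F y)"
    proof (rule proj_char_swap[OF Suc.prems(2,3) gy(2)])
      fix F assume "young_cover F E"
      from F_props[OF this] show "total_content D - total_content E \<noteq> total_content E - total_content F"
        using cE by auto
    qed
    also have "\<dots> = (\<Sum>F | young_cover F E. \<Sum>N | N \<in> youngs (Suc k - i) \<and> N \<subseteq> F.
        inverse (of_int (content e - content (the_elem (E - F)))) *
          strip_phi (the_elem (E - F)) (E - N) * char_at N rho)"
    proof (rule sum.cong[OF refl])
      fix F assume "F \<in> {F. young_cover F E}"
      then have F: "young_cover F E" by simp
      then have kF: "card F = k" using Suc.prems(3) by (simp add: young_cover_def)
      obtain f where f: "f \<notin> F" "E = insert f F" "the_elem (E - F) = f"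
        "total_content E - total_content F = of_int (content f)" using F_props[OF F] by blast
      \<comment> \<open>Passing from \<open>D\<close>, \<open>E\<close>, \<open>j\<close> to
        \<open>E\<close>, \<open>F\<close>, \<open>i\<close> lowers the number of boxes and the
        cycle length by one each, so the size of \<open>N\<close> stays the same.\<close>
      have "proj_char E F y = (\<Sum>N | N \<in> youngs (Suc k - i) \<and> N \<subseteq> F. strip_phi f (E - N) * char_at N rho)"
        by (rule Suc.IH[OF Suc.prems(1) F kF f(2,1) i(2) gy(3)]) simp
      then show "inverse ((total_content D - total_content E) - (total_content E - total_content F)) * proj_char E F y =
        (\<Sum>N | N \<in> youngs (Suc k - i) \<and> N \<subseteq> F.
        inverse (of_int (content e - content (the_elem (E - F)))) *
          strip_phi (the_elem (E - F)) (E - N) * char_at N rho)"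
        unfolding cE f(3,4) by (simp add: sum_distrib_left mult.assoc)
    qed
    also have "\<dots> = (\<Sum>N | N \<in> youngs (Suc k - i) \<and> N \<subseteq> E. \<Sum>F | young_cover F E \<and> N \<subseteq> F.
        inverse (of_int (content e - content (the_elem (E - F)))) *
          strip_phi (the_elem (E - F)) (E - N) * char_at N rho)"
      by (rule sum_down_swap)
    also have "\<dots> = (\<Sum>N | N \<in> youngs (Suc k - i) \<and> N \<subseteq> E. strip_phi e (D - N) * char_at N rho)"
    proof (rule sum.cong[OF refl])
      fix N assume "N \<in> {N. N \<in> youngs (Suc k - i) \<and> N \<subseteq> E}"
      then have N: "young N" "card N = Suc k - i" "N \<subseteq> E" by (auto simp: youngs_def)
      then have "N \<noteq> E" using Suc.prems(3) i(2) by auto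
      from strip_phi_recursion[OF Suc.prems(2,4,5) N(1,3) this]
      show "(\<Sum>F | young_cover F E \<and> N \<subseteq> F. inverse (of_int (content e - content (the_elem (E - F)))) *
          strip_phi (the_elem (E - F)) (E - N) * char_at N rho) = strip_phi e (D - N) * char_at N rho"
        by (simp only: sum_distrib_right)
    qed
    finally show ?thesis by (simp add: i(1))
  qed
qed

lemma card_orbit_pos: "s \<in> Sym n \<Longrightarrow> x \<in> {1..n} \<Longrightarrow> 1 \<le> card (orbit s x)"
  using finite_subset[OF orbit_subset_Sym] orbit_nonempty[of s x]
  by (metis One_nat_def Suc_leI card_gt_0_iff finite_atLeastAtMost)

text \<open>Summing the formula for the generalized characters over \<open>E\<close> expresses the character of \<open>D\<close> at a
  permutation by the length of the cycle of the largest point and the remaining cycle type.  By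
  conjugation, any cycle length can be achieved for that point.\<close>

lemma class_fun: "class_fun n"
proof (induction n rule: less_induct)
  case (less n)
  show ?case
  proof (cases n)
    case 0
    have "x = id" if "x \<in> Sym n" for x
      using that 0 by (simp add: Sym_def)
    then show ?thesis unfolding class_fun_def by metis
  next
    case (Suc m)
    have IH: "class_fun k" if "k \<le> m" for k using less.IH[of k] that Suc by simp
    have eq: "character (specht D) x = character (specht D) y"
      if D: "D \<in> youngs (Suc m)" and xy: "x \<in> gen_class (Suc m) j rho" "y \<in> gen_class (Suc m) j rho" and j: "1 \<le> j"
      for D x y j rho
    proof -
      have Y: "young D" "card D = Suc m" using D by (auto simp: youngs_def)
      have "proj_char D E x = proj_char D E y" if E: "young_cover E D" for E
      proof -
        obtain e where e: "e \<notin> E" "D = insert e E" using E by (rule young_coverE)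
        have m: "card E = m" using E Y(2) by (simp add: young_cover_def)
        show ?thesis
          using proj_char_formula[OF IH E m e(2,1) j xy(1)] proj_char_formula[OF IH E m e(2,1) j xy(2)] by simp
      qed
      moreover have "x \<in> Sym (Suc m)" "y \<in> Sym (Suc m)" using xy by (auto simp: gen_class_def)
      ultimately show ?thesis using sum_proj_char[OF Y] by (metis (no_types, lifting) mem_Collect_eq sum.cong)
    qed
    show ?thesis
      unfolding class_fun_def Suc
    proof (intro ballI impI)
      fix D x y assume D: "D \<in> youngs (Suc m)" and x: "x \<in> Sym (Suc m)" and y: "y \<in> Sym (Suc m)"
        and xy: "cyc_type (Suc m) x = cyc_type (Suc m) y"
      define j where "j = card (orbit x (Suc m))"
      have j1: "1 \<le> j" unfolding j_def by (rule card_orbit_pos[OF x]) simp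
      have "j \<in># cyc_type (Suc m) x" by (auto simp: cyc_type_def j_def)
      \<comment> \<open>Any arrangement of the remaining cycle lengths in a list serves as
        \<open>rho\<close>.\<close>
      then obtain rho where rho: "cyc_type (Suc m) x = add_mset j (mset rho)"
        by (metis ex_mset insert_DiffM)
      have xg: "x \<in> gen_class (Suc m) j rho" using rho x by (simp add: gen_class_cyc_type j_def)
      have rho': "cyc_type (Suc m) y = add_mset j (mset rho)" by (rule trans[OF xy[symmetric] rho])
      have "j \<in># cyc_type (Suc m) y" by (simp add: rho')
      then obtain z where z: "z \<in> {1..Suc m}" "card (orbit y z) = j" by (auto simp: cyc_type_def)
      define h where "h = transpose z (Suc m)"
      have h: "h \<in> Sym (Suc m)" unfolding h_def using z(1) by (intro transpose_Sym) auto
      have hz: "h z = Suc m" by (simp add: h_def)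
      let ?y = "h \<circ> y \<circ> inv h"
      have "orbit ?y (Suc m) = h ` orbit y z" using orbit_conj[OF h, of y z] hz by simp
      then have "card (orbit ?y (Suc m)) = j"
        using z(2) card_image[OF inj_on_subset[OF bij_is_inj[OF Sym_bij[OF h]] subset_UNIV]] by simp
      moreover have "?y \<in> Sym (Suc m)" using h y by simp
      ultimately have "?y \<in> gen_class (Suc m) j rho"
        using rho' by (simp add: gen_class_cyc_type cyc_type_conj[OF h])
      then have "character (specht D) x = character (specht D) ?y" by (rule eq[OF D xg _ j1])
      also have "\<dots> = character (specht D) y"
      proof (rule character_conj[OF _ y h])
        show "sym_mod (Suc m) (specht D)" using sym_mod_specht[of D] D young_finite by (auto simp: youngs_def)
      qed
      finally show "character (specht D) x = character (specht D) y" .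
    qed
  qed
qed

text \<open>An empty class would have an empty image instead of a single value. Members are built by
  inserting points one at a time, and a cycle type is realised through the class belonging to its
  first part.\<close>

lemma classes_nonempty:
  shows "partition_of n tau \<Longrightarrow> cycle_class n tau \<noteq> {}"
    and "1 \<le> j \<Longrightarrow> j \<le> n \<Longrightarrow> partition_of (n - j) rho \<Longrightarrow> gen_class n j rho \<noteq> {}"
proof (induction n arbitrary: tau j rho)
  case 0
  {
    case 1
    then have "tau = []" by (cases tau) (auto simp: partition_of_def)
    then have "id \<in> cycle_class 0 tau" by (simp add: cycle_class_def)
    then show ?case by blast
  next
    case 2 then show ?case by simp
  }
next
  case (Suc m)
  have gen: "gen_class (Suc m) j rho \<noteq> {}" if jr: "1 \<le> j" "j \<le> Suc m" "partition_of (Suc m - j) rho" for j rho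
  proof (cases "j = 1")
    case True
    then show ?thesis using Suc.IH(1)[of rho] jr(3) gen_class_1[of m rho] by simp
  next
    case False
    then obtain i where i: "j = Suc i" "1 \<le> i" using jr(1) by (cases j) auto
    then have "gen_class m i rho \<noteq> {}" using Suc.IH(2)[of i rho] jr by simp
    then obtain y where y: "y \<in> gen_class m i rho" by blast
    then have "y \<in> Sym m" by (simp add: gen_class_def)
    then show ?thesis using gen_class_comp_transpose[of y m i rho] y i jr(2) by auto
  qed
  {
    case 1
    then obtain j rho where tau: "tau = j # rho" by (cases tau) (auto simp: partition_of_def)
    then have "1 \<le> j" "j \<le> Suc m" "partition_of (Suc m - j) rho" using 1 by (auto simp: partition_of_def)
    then obtain s where s: "s \<in> gen_class (Suc m) j rho" using gen by blast
    then have "s \<in> Sym (Suc m)" by (simp add: gen_class_def)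
    then have "s \<in> cycle_class (Suc m) tau" using s by (simp add: gen_class_cyc_type cycle_class_iff tau)
    then show ?case by blast
  next
    case 2 then show ?case using gen by blast
  }
qed

lemma irr_char_at_eq_char_at: "irr_char_at nu rho = char_at (diagram nu) rho"
  by (simp add: irr_char_at_def char_at_def card_diagram irr_char_eq_character[abs_def] image_def)

theorem theorem3p1:
  fixes n j :: nat and lam mu rho :: "nat list"
  assumes "n \<ge> 1"
    and "partition_of n lam" and "partition_of (n - 1) mu" and "mu \<nearrow> lam"
    and "1 \<le> j" and "j \<le> n" and "partition_of (n - j) rho"
  shows "gen_char lam mu ` gen_class n j rho =
    {\<Sum>nu | partition_of (n - j) nu \<and> diagram nu \<subseteq> diagram mu.
       phi mu lam nu * irr_char_at nu rho}"
proof -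
  obtain m where n: "n = Suc m" using assms(1) by (cases n) auto
  have lam: "partition_of (Suc m) lam" and mu: "partition_of m mu" using assms(2,3) n by auto
  have young_cover: "young_cover (diagram mu) (diagram lam)" by (rule adds_box_young_cover[OF lam mu assms(4)])
  then obtain e where e: "e \<notin> diagram mu" "diagram lam = insert e (diagram mu)" by (rule young_coverE)
  then have "diagram lam - diagram mu = {e}" by auto
  then have el: "the_elem (diagram lam - diagram mu) = e" by simp
  have m: "card (diagram mu) = m" using mu by (simp add: card_diagram partition_of_def)
  let ?A = "{nu. partition_of (n - j) nu \<and> diagram nu \<subseteq> diagram mu}"
  let ?rhs = "\<Sum>nu\<in>?A. phi mu lam nu * irr_char_at nu rho"
  have bij: "bij_betw diagram {nu. partition_of (n - j) nu} (youngs (n - j))" by (rule bij_betw_diagram)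
  have "diagram ` ?A = {N \<in> diagram ` {nu. partition_of (n - j) nu}. N \<subseteq> diagram mu}" by auto
  also have "diagram ` {nu. partition_of (n - j) nu} = youngs (n - j)"
    by (rule bij_betw_imp_surj_on[OF bij])
  finally have "bij_betw diagram ?A {N \<in> youngs (n - j). N \<subseteq> diagram mu}"
    by (rule bij_betw_subset[OF bij, rotated]) auto
  \<comment> \<open>Turns the sum over Young diagrams contained in that of \<open>mu\<close> into
    the sum over partitions.\<close>
  note reindex = sum.reindex_bij_betw[OF this, symmetric]
  have val: "gen_char lam mu x = ?rhs" if x: "x \<in> gen_class n j rho" for x
  proof -
    have "x \<in> Sym (Suc m)" using x n by (simp add: gen_class_def)
    then have "gen_char lam mu x = proj_char (diagram lam) (diagram mu) x" by (rule gen_char_eq_proj_char[OF lam mu])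
    also have "\<dots> = (\<Sum>N | N \<in> youngs (n - j) \<and> N \<subseteq> diagram mu.
        strip_phi e (diagram lam - N) * char_at N rho)"
      unfolding n by (rule proj_char_formula[OF class_fun young_cover m e(2,1) assms(5) x[unfolded n]])
    also have "\<dots> = (\<Sum>nu\<in>?A. strip_phi e (diagram lam - diagram nu) * char_at (diagram nu) rho)"
      by (rule reindex)
    finally show ?thesis by (simp only: phi_eq_strip_phi el irr_char_at_eq_char_at)
  qed
  have "gen_char lam mu ` gen_class n j rho = (\<lambda>_. ?rhs) ` gen_class n j rho"
    by (rule image_cong[OF refl val])
  also have "\<dots> = {?rhs}"
    using classes_nonempty(2)[OF assms(5-7)] by (simp only: image_constant_conv if_False)
  finally show ?thesis .
qed

end
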